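(* Let $\mathcal{F}:X_1\times\cdots\times X_m\dashrightarrow Y$ be a dominant rational map defined by multi-homogeneous elements $f_0,\ldots,f_s\in R$ of the same multi-degree, with $\mathbf{x}_i$-partial Jacobian dual matrices $\psi_1,\ldots,\psi_m$ and full Jacobian dual matrix $\psi$ (defined in the context). Then the following three conditions are equivalent: (i) $\mathcal{F}$ is birational. (ii) $\mathrm{rank}_S(\psi_i\otimes_{\mathbb{K}[\mathbf{y}]}S)=r_i$ for each $i=1,\ldots,m$. (iii) $\mathrm{rank}_S(\psi\otimes_{\mathbb{K}[\mathbf{y}]}S)=r_1+r_2+\cdots+r_m$. In addition, if $\mathcal{F}$ is birational then its inverse is of the form $\mathcal{G}:Y\dashrightarrow X_1\times\cdots\times X_m$, where each map $Y\dashrightarrow X_i$ is given by the signed ordered maximal minors of an $r_i\times(r_i+1)$ submatrix of $\psi_i$ of rank $r_i$ (rank taken over $S$).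
   Context: Setting. $\mathbb{K}$ is a field; for $i=1,\ldots,m$, $X_i\subset\mathbb{P}^{r_i}_{\mathbb{K}}$ is an integral projective variety with homogeneous coordinate ring $A_i=\mathbb{K}[\mathbf{x}_i]/\mathfrak{a}_i$, $\mathbf{x}_i=(x_{i,0},\ldots,x_{i,r_i})$. Put $R=A_1\otimes_{\mathbb{K}}\cdots\otimes_{\mathbb{K}}A_m=\mathbb{K}[\mathbf{x}]/(\mathfrak{a}_1,\ldots,\mathfrak{a}_m)$ with its natural $\mathbb{Z}^m$-grading, and $X=X_1\times_{\mathbb{K}}\cdots\times_{\mathbb{K}}X_m$, assumed to be an integral scheme. $Y\subset\mathbb{P}^s_{\mathbb{K}}$ is an integral projective variety with homogeneous coordinate ring $S=\mathbb{K}[\mathbf{y}]/\mathfrak{b}$, $\mathbf{y}=(y_0,\ldots,y_s)$, and $\mathcal{F}=(f_0:\cdots:f_s)$; $I=(f_0,\ldots,f_s)\subset R$. $\mathcal{F}$ is birational if it is dominant and has an inverse $\mathcal{G}:Y\dashrightarrow(X_1,\ldots,X_m)$ given by a tuple of rational maps $Y\dashrightarrow X_i\subset\mathbb{P}^{r_i}$, each defined by $r_i+1$ homogeneous forms of $S$ of the same degree. Jacobian dual matrices. Let $\mathcal{E}\subset\mathbb{K}[\mathbf{x},\mathbf{y}]$ be the kernel of the surjection $\mathbb{K}[\mathbf{x},\mathbf{y}]\to\mathcal{R}_R(I)=R[f_0t,\ldots,f_st]\subset R[t]$ sending each $x_{i,j}$ to its class and $y_j\mapsto f_jt$ (it contains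 $\mathfrak{a}_1,\ldots,\mathfrak{a}_m$ and is multi-homogeneous in $\mathbf{x}_1,\ldots,\mathbf{x}_m,\mathbf{y}$). For each $i$, let $h_{i,1},\ldots,h_{i,k_i}$ be a minimal set of (multi-homogeneous) generators, over $\mathbb{K}[\mathbf{y}]$, of the part of $\mathcal{E}$ of degree $1$ in $\mathbf{x}_i$, degree $0$ in $\mathbf{x}_l$ for $l\ne i$, and arbitrary degree in $\mathbf{y}$. The $\mathbf{x}_i$-partial Jacobian dual matrix is the $k_i\times(r_i+1)$ matrix $\psi_i=\big(\partial h_{i,a}/\partial x_{i,b}\big)_{1\le a\le k_i,\,0\le b\le r_i}$, with entries in $\mathbb{K}[\mathbf{y}]$. The full Jacobian dual matrix $\psi$ is the block-diagonal matrix with diagonal blocks $\psi_1,\ldots,\psi_m$. $\psi_i\otimes_{\mathbb{K}[\mathbf{y}]}S$ denotes the matrix with entries reduced modulo $\mathfrak{b}$, and $\mathrm{rank}_S$ is rank over the fraction field of $S$. *)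

theory Defs
  imports
    "HOL-Library.Poly_Mapping"
    "HOL-Computational_Algebra.Polynomial"
    "HOL-Algebra.QuotRing"
    "Jordan_Normal_Form.Determinant"
    "Jordan_Normal_Form.DL_Submatrix"
begin

section \<open>Polynomials in the variables x and y\<close>

text \<open>
  \<open>XVar i j\<close> is $x_{i,j}$ and \<open>YVar j\<close> is $y_j$; the factors are numbered $0,\ldots,m-1$
  instead of $1,\ldots,m$. A polynomial ring in finitely many of these variables is a subring,
  with carrier cut out by the variables that may occur, of one ring of all polynomials.
\<close>

datatype pvar = XVar nat nat | YVar nat

type_synonym 'k mpoly = "(pvar \<Rightarrow>\<^sub>0 nat) \<Rightarrow>\<^sub>0 'k"

definition Var :: "pvar \<Rightarrow> 'k::comm_ring_1 mpoly" where
  "Var v = Poly_Mapping.single (Poly_Mapping.single v 1) 1"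

definition Const :: "'k::comm_ring_1 \<Rightarrow> 'k mpoly" where
  "Const c = Poly_Mapping.single 0 c"

definition vars :: "'k::zero mpoly \<Rightarrow> pvar set" where
  "vars p = (\<Union>u\<in>Poly_Mapping.keys p. Poly_Mapping.keys u)"

definition poly_ring :: "pvar set \<Rightarrow> 'k::comm_ring_1 mpoly ring" where
  "poly_ring V =
     \<lparr>carrier = {p. vars p \<subseteq> V}, monoid.mult = (*), one = 1, zero = 0, add = (+)\<rparr>"

definition xvars_of :: "(nat \<Rightarrow> nat) \<Rightarrow> nat \<Rightarrow> pvar set" where
  "xvars_of r i = {XVar i j |j. j \<le> r i}"

definition xvars :: "nat \<Rightarrow> (nat \<Rightarrow> nat) \<Rightarrow> pvar set" where
  "xvars m r = (\<Union>i<m. xvars_of r i)"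

definition yvars :: "nat \<Rightarrow> pvar set" where
  "yvars s = {YVar j |j. j \<le> s}"

definition mp_eval ::
    "('k::comm_ring_1 \<Rightarrow> 'b::comm_ring_1) \<Rightarrow> (pvar \<Rightarrow> 'b) \<Rightarrow> 'k mpoly \<Rightarrow> 'b" where
  "mp_eval \<phi> \<sigma> p = (\<Sum>u\<in>Poly_Mapping.keys p. \<phi> (Poly_Mapping.lookup p u) *
      (\<Prod>v\<in>Poly_Mapping.keys u. \<sigma> v ^ Poly_Mapping.lookup u v))"

definition subst_x :: "(nat \<Rightarrow> nat \<Rightarrow> 'k::comm_ring_1 mpoly) \<Rightarrow> 'k mpoly \<Rightarrow> 'k mpoly" where
  "subst_x g = mp_eval Const (\<lambda>v. case v of XVar i j \<Rightarrow> g i j | YVar j \<Rightarrow> Var (YVar j))"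

definition subst_y :: "(nat \<Rightarrow> 'k::comm_ring_1 mpoly) \<Rightarrow> 'k mpoly \<Rightarrow> 'k mpoly" where
  "subst_y f = mp_eval Const (\<lambda>v. case v of XVar i j \<Rightarrow> Var (XVar i j) | YVar j \<Rightarrow> f j)"

definition partial_deriv :: "pvar \<Rightarrow> 'k::comm_ring_1 mpoly \<Rightarrow> 'k mpoly" where
  "partial_deriv v p = (\<Sum>u\<in>Poly_Mapping.keys p.
      Poly_Mapping.single (u - Poly_Mapping.single v 1)
        (of_nat (Poly_Mapping.lookup u v) * Poly_Mapping.lookup p u))"


section \<open>Multi-degrees\<close>

text \<open>
  The degree of a monomial is the pair of its degrees in $\mathbf{x}_0,\mathbf{x}_1,\ldots$ (a
  function of the block number) and its degree in $\mathbf{y}$. Restricted to the subrings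
  $\mathbb{K}[\mathbf{x}_i]$, $\mathbb{K}[\mathbf{x}]$ and $\mathbb{K}[\mathbf{y}]$ this gives
  their usual (multi-)grading, so the notions below serve for all of them.
\<close>

definition xdeg :: "(pvar \<Rightarrow>\<^sub>0 nat) \<Rightarrow> nat \<Rightarrow> nat" where
  "xdeg u i = (\<Sum>v\<in>Poly_Mapping.keys u.
      case v of XVar l j \<Rightarrow> (if l = i then Poly_Mapping.lookup u v else 0) | YVar j \<Rightarrow> 0)"

definition ydeg :: "(pvar \<Rightarrow>\<^sub>0 nat) \<Rightarrow> nat" where
  "ydeg u = (\<Sum>v\<in>Poly_Mapping.keys u.
      case v of XVar l j \<Rightarrow> 0 | YVar j \<Rightarrow> Poly_Mapping.lookup u v)"

definition mdeg :: "(pvar \<Rightarrow>\<^sub>0 nat) \<Rightarrow> (nat \<Rightarrow> nat) \<times> nat" where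
  "mdeg u = (xdeg u, ydeg u)"

definition homogeneous :: "(nat \<Rightarrow> nat) \<times> nat \<Rightarrow> 'k::zero mpoly \<Rightarrow> bool" where
  "homogeneous \<delta> p \<longleftrightarrow> (\<forall>u\<in>Poly_Mapping.keys p. mdeg u = \<delta>)"

definition hom_component :: "(nat \<Rightarrow> nat) \<times> nat \<Rightarrow> 'k::comm_ring_1 mpoly \<Rightarrow> 'k mpoly" where
  "hom_component \<delta> p = (\<Sum>u\<in>{u\<in>Poly_Mapping.keys p. mdeg u = \<delta>}.
      Poly_Mapping.single u (Poly_Mapping.lookup p u))"

definition homogeneous_ideal :: "'k::comm_ring_1 mpoly set \<Rightarrow> pvar set \<Rightarrow> bool" where
  "homogeneous_ideal I V \<longleftrightarrow> ideal I (poly_ring V) \<and> (\<forall>p\<in>I. \<forall>\<delta>. hom_component \<delta> p \<in> I)"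


section \<open>Integral varieties\<close>

text \<open>
  \<open>J\<close> is the homogeneous ideal of an integral closed subscheme of the projective space with
  homogeneous coordinates \<open>V\<close>.
\<close>

definition integral_projective_variety :: "pvar set \<Rightarrow> 'k::comm_ring_1 mpoly set \<Rightarrow> bool" where
  "integral_projective_variety V J \<longleftrightarrow>
     primeideal J (poly_ring V) \<and> homogeneous_ideal J V \<and> (\<exists>v\<in>V. Var v \<notin> J)"

text \<open>The ideal $(\mathfrak{a}_1,\ldots,\mathfrak{a}_m)$ with $R=\mathbb{K}[\mathbf{x}]/(\mathfrak{a}_1,\ldots,\mathfrak{a}_m)$.\<close>

definition prod_ideal ::
    "nat \<Rightarrow> (nat \<Rightarrow> nat) \<Rightarrow> (nat \<Rightarrow> 'k::comm_ring_1 mpoly set) \<Rightarrow> 'k mpoly set" where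
  "prod_ideal m r \<aa> = Idl\<^bsub>poly_ring (xvars m r)\<^esub> (\<Union>i<m. \<aa> i)"

text \<open>
  The points of $X_1\times_{\mathbb{K}}\cdots\times_{\mathbb{K}}X_m$ as those of the
  multiprojective spectrum of $R=\mathbb{K}[\mathbf{x}]/J$: multi-homogeneous primes of $R$
  (taken as primes of $\mathbb{K}[\mathbf{x}]$ above $J$) not containing any of the $m$
  irrelevant ideals.
\<close>

definition multiproj ::
    "nat \<Rightarrow> (nat \<Rightarrow> nat) \<Rightarrow> 'k::comm_ring_1 mpoly set \<Rightarrow> 'k mpoly set set" where
  "multiproj m r J = {P. primeideal P (poly_ring (xvars m r)) \<and> homogeneous_ideal P (xvars m r) \<and>
      J \<subseteq> P \<and> (\<forall>i<m. \<exists>j\<le>r i. Var (XVar i j) \<notin> P)}"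

text \<open>
  Any two nonempty open sets meet; it suffices to say so for the basic open sets
  $\{P \mid u\notin P\}$ with $u$ multi-homogeneous.
\<close>

definition irreducible_scheme ::
    "nat \<Rightarrow> (nat \<Rightarrow> nat) \<Rightarrow> 'k::comm_ring_1 mpoly set \<Rightarrow> bool" where
  "irreducible_scheme m r J \<longleftrightarrow> multiproj m r J \<noteq> {} \<and>
     (\<forall>u\<in>carrier (poly_ring (xvars m r)). \<forall>v\<in>carrier (poly_ring (xvars m r)). \<forall>\<delta> \<epsilon>.
        homogeneous \<delta> u \<and> homogeneous \<epsilon> v \<and>
        (\<exists>P\<in>multiproj m r J. u \<notin> P) \<and> (\<exists>P\<in>multiproj m r J. v \<notin> P) \<longrightarrow>
        (\<exists>P\<in>multiproj m r J. u \<notin> P \<and> v \<notin> P))"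

text \<open>
  The local ring at $P$ consists of the fractions $u/t$ with $u,t$ multi-homogeneous of the same
  degree and $t\notin P$; such a fraction is zero iff $wu=0$ in $R$ for some multi-homogeneous
  $w\notin P$.
\<close>

definition zero_at ::
    "nat \<Rightarrow> (nat \<Rightarrow> nat) \<Rightarrow> 'k::comm_ring_1 mpoly set \<Rightarrow> 'k mpoly set \<Rightarrow> 'k mpoly \<Rightarrow> bool" where
  "zero_at m r J P u \<longleftrightarrow>
     (\<exists>w\<in>carrier (poly_ring (xvars m r)). (\<exists>\<delta>. homogeneous \<delta> w) \<and> w \<notin> P \<and> w * u \<in> J)"

definition reduced_scheme ::
    "nat \<Rightarrow> (nat \<Rightarrow> nat) \<Rightarrow> 'k::comm_ring_1 mpoly set \<Rightarrow> bool" where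
  "reduced_scheme m r J \<longleftrightarrow> (\<forall>P\<in>multiproj m r J.
     \<forall>u\<in>carrier (poly_ring (xvars m r)). \<forall>t\<in>carrier (poly_ring (xvars m r)). \<forall>\<delta> n.
       homogeneous \<delta> u \<and> homogeneous \<delta> t \<and> t \<notin> P \<and> zero_at m r J P (u ^ n) \<longrightarrow>
       zero_at m r J P u)"

definition integral_scheme ::
    "nat \<Rightarrow> (nat \<Rightarrow> nat) \<Rightarrow> 'k::comm_ring_1 mpoly set \<Rightarrow> bool" where
  "integral_scheme m r J \<longleftrightarrow> irreducible_scheme m r J \<and> reduced_scheme m r J"


section \<open>Rational maps\<close>

text \<open>
  Elements of $R$ and $S$ are given by representatives in $\mathbb{K}[\mathbf{x}]$ and
  $\mathbb{K}[\mathbf{y}]$. Tuples $(g_0,\ldots,g_n)$ and $(g'_0,\ldots,g'_n)$, both nonzero modulo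
  a prime \<open>J\<close>, define the same rational map iff they are proportional modulo \<open>J\<close>.
\<close>

definition same_rational_map ::
    "'k::comm_ring_1 mpoly set \<Rightarrow> nat \<Rightarrow> (nat \<Rightarrow> 'k mpoly) \<Rightarrow> (nat \<Rightarrow> 'k mpoly) \<Rightarrow> bool" where
  "same_rational_map J n g g' \<longleftrightarrow> (\<forall>j\<le>n. \<forall>l\<le>n. g j * g' l - g l * g' j \<in> J)"

definition rational_map ::
    "nat \<Rightarrow> (nat \<Rightarrow> nat) \<Rightarrow> nat \<Rightarrow> (nat \<Rightarrow> 'k::comm_ring_1 mpoly set) \<Rightarrow> 'k mpoly set \<Rightarrow>
     (nat \<Rightarrow> 'k mpoly) \<Rightarrow> bool" where
  "rational_map m r s \<aa> \<bb> f \<longleftrightarrow>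
     (\<exists>d. \<forall>j\<le>s. f j \<in> carrier (poly_ring (xvars m r)) \<and> homogeneous (d, 0) (f j)) \<and>
     (\<exists>j\<le>s. f j \<notin> prod_ideal m r \<aa>) \<and>
     (\<forall>p\<in>\<bb>. subst_y f p \<in> prod_ideal m r \<aa>)"

text \<open>The image is dense in \<open>Y\<close>: every form vanishing on the image vanishes on \<open>Y\<close>.\<close>

definition dominant ::
    "nat \<Rightarrow> (nat \<Rightarrow> nat) \<Rightarrow> nat \<Rightarrow> (nat \<Rightarrow> 'k::comm_ring_1 mpoly set) \<Rightarrow> 'k mpoly set \<Rightarrow>
     (nat \<Rightarrow> 'k mpoly) \<Rightarrow> bool" where
  "dominant m r s \<aa> \<bb> f \<longleftrightarrow> (\<forall>p\<in>carrier (poly_ring (yvars s)). \<forall>\<delta>.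
     homogeneous \<delta> p \<and> subst_y f p \<in> prod_ideal m r \<aa> \<longrightarrow> p \<in> \<bb>)"

definition rational_map_tuple ::
    "nat \<Rightarrow> (nat \<Rightarrow> nat) \<Rightarrow> nat \<Rightarrow> (nat \<Rightarrow> 'k::comm_ring_1 mpoly set) \<Rightarrow> 'k mpoly set \<Rightarrow>
     (nat \<Rightarrow> nat \<Rightarrow> 'k mpoly) \<Rightarrow> bool" where
  "rational_map_tuple m r s \<aa> \<bb> g \<longleftrightarrow> (\<forall>i<m.
     (\<exists>e. \<forall>j\<le>r i. g i j \<in> carrier (poly_ring (yvars s)) \<and> homogeneous (\<lambda>_. 0, e) (g i j)) \<and>
     (\<exists>j\<le>r i. g i j \<notin> \<bb>) \<and>
     (\<forall>p\<in>\<aa> i. subst_x g p \<in> \<bb>))"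

text \<open>
  Both compositions are defined (some coordinate is nonzero) and are the identity of
  $X_1\times\cdots\times X_m$, as the tuple of the $(x_{i,0}:\cdots:x_{i,r_i})$, respectively
  of \<open>Y\<close>.
\<close>

definition inverse_map ::
    "nat \<Rightarrow> (nat \<Rightarrow> nat) \<Rightarrow> nat \<Rightarrow> (nat \<Rightarrow> 'k::comm_ring_1 mpoly set) \<Rightarrow> 'k mpoly set \<Rightarrow>
     (nat \<Rightarrow> 'k mpoly) \<Rightarrow> (nat \<Rightarrow> nat \<Rightarrow> 'k mpoly) \<Rightarrow> bool" where
  "inverse_map m r s \<aa> \<bb> f g \<longleftrightarrow> rational_map_tuple m r s \<aa> \<bb> g \<and>
     (\<forall>i<m. (\<exists>j\<le>r i. subst_y f (g i j) \<notin> prod_ideal m r \<aa>) \<and>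
        same_rational_map (prod_ideal m r \<aa>) (r i)
          (\<lambda>j. subst_y f (g i j)) (\<lambda>j. Var (XVar i j))) \<and>
     (\<exists>j\<le>s. subst_x g (f j) \<notin> \<bb>) \<and>
     same_rational_map \<bb> s (\<lambda>j. subst_x g (f j)) (\<lambda>j. Var (YVar j))"

definition birational ::
    "nat \<Rightarrow> (nat \<Rightarrow> nat) \<Rightarrow> nat \<Rightarrow> (nat \<Rightarrow> 'k::comm_ring_1 mpoly set) \<Rightarrow> 'k mpoly set \<Rightarrow>
     (nat \<Rightarrow> 'k mpoly) \<Rightarrow> bool" where
  "birational m r s \<aa> \<bb> f \<longleftrightarrow> dominant m r s \<aa> \<bb> f \<and> (\<exists>g. inverse_map m r s \<aa> \<bb> f g)"


section \<open>Jacobian dual matrices\<close>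

text \<open>
  $x_{i,j}\mapsto x_{i,j}$, $y_j\mapsto f_jt$, with values in $\mathbb{K}[\mathbf{x}][t]$; composing
  with $\mathbb{K}[\mathbf{x}][t]\to R[t]$, a polynomial is in the kernel iff all its coefficients
  at powers of $t$ go to the ideal defining $R$.
\<close>

definition rees_map :: "(nat \<Rightarrow> 'k::comm_ring_1 mpoly) \<Rightarrow> 'k mpoly \<Rightarrow> 'k mpoly poly" where
  "rees_map f = mp_eval (\<lambda>c. [:Const c:])
     (\<lambda>v. case v of XVar i j \<Rightarrow> [:Var (XVar i j):] | YVar j \<Rightarrow> Polynomial.monom (f j) 1)"

definition rees_ideal ::
    "nat \<Rightarrow> (nat \<Rightarrow> nat) \<Rightarrow> nat \<Rightarrow> (nat \<Rightarrow> 'k::comm_ring_1 mpoly set) \<Rightarrow>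
     (nat \<Rightarrow> 'k mpoly) \<Rightarrow> 'k mpoly set" where
  "rees_ideal m r s \<aa> f = {p \<in> carrier (poly_ring (xvars m r \<union> yvars s)).
     \<forall>n. Polynomial.coeff (rees_map f p) n \<in> prod_ideal m r \<aa>}"

definition linear_part ::
    "nat \<Rightarrow> (nat \<Rightarrow> nat) \<Rightarrow> nat \<Rightarrow> (nat \<Rightarrow> 'k::comm_ring_1 mpoly set) \<Rightarrow>
     (nat \<Rightarrow> 'k mpoly) \<Rightarrow> nat \<Rightarrow> 'k mpoly set" where
  "linear_part m r s \<aa> f i = {p \<in> rees_ideal m r s \<aa> f.
     \<forall>u\<in>Poly_Mapping.keys p. xdeg u = (\<lambda>l. if l = i then 1 else 0)}"

definition y_span :: "nat \<Rightarrow> 'k::comm_ring_1 mpoly set \<Rightarrow> 'k mpoly set" where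
  "y_span s G = {\<Sum>g\<in>G. c g * g |c. \<forall>g\<in>G. c g \<in> carrier (poly_ring (yvars s))}"

text \<open>\<open>h 0, \<dots>, h (k - 1)\<close> lists, without repetition, a minimal set of multi-homogeneous generators.\<close>

definition minimal_generators ::
    "nat \<Rightarrow> 'k::comm_ring_1 mpoly set \<Rightarrow> nat \<Rightarrow> (nat \<Rightarrow> 'k mpoly) \<Rightarrow> bool" where
  "minimal_generators s M k h \<longleftrightarrow>
     inj_on h {..<k} \<and> (\<forall>a<k. \<exists>\<delta>. homogeneous \<delta> (h a)) \<and>
     y_span s (h ` {..<k}) = M \<and> (\<forall>G. G \<subset> h ` {..<k} \<longrightarrow> y_span s G \<noteq> M)"

definition jacobian_dual ::
    "(nat \<Rightarrow> nat) \<Rightarrow> (nat \<Rightarrow> nat) \<Rightarrow> (nat \<Rightarrow> nat \<Rightarrow> 'k::comm_ring_1 mpoly) \<Rightarrow> nat \<Rightarrow> 'k mpoly mat" where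
  "jacobian_dual r k h i = mat (k i) (r i + 1) (\<lambda>(a, b). partial_deriv (XVar i b) (h i a))"

definition full_jacobian_dual ::
    "nat \<Rightarrow> (nat \<Rightarrow> nat) \<Rightarrow> (nat \<Rightarrow> nat) \<Rightarrow> (nat \<Rightarrow> nat \<Rightarrow> 'k::comm_ring_1 mpoly) \<Rightarrow> 'k mpoly mat" where
  "full_jacobian_dual m r k h = diag_block_mat (map (jacobian_dual r k h) [0..<m])"

text \<open>
  The ordered signed maximal minors of the submatrix of \<open>A\<close> on the rows in \<open>I\<close> (and all columns).
\<close>

definition signed_minor :: "'a::comm_ring_1 mat \<Rightarrow> nat set \<Rightarrow> nat \<Rightarrow> 'a" where
  "signed_minor A I j = (- 1) ^ j * det (submatrix A I (- {j}))"


section \<open>Rank over the fraction field\<close>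

definition frac_rel :: "('a, 'c) ring_scheme \<Rightarrow> (('a \<times> 'a) \<times> ('a \<times> 'a)) set" where
  "frac_rel D = {((a, b), (c, d)). a \<in> carrier D \<and> c \<in> carrier D \<and>
     b \<in> carrier D - {\<zero>\<^bsub>D\<^esub>} \<and> d \<in> carrier D - {\<zero>\<^bsub>D\<^esub>} \<and> a \<otimes>\<^bsub>D\<^esub> d = c \<otimes>\<^bsub>D\<^esub> b}"

definition frac :: "('a, 'c) ring_scheme \<Rightarrow> 'a \<Rightarrow> 'a \<Rightarrow> ('a \<times> 'a) set" where
  "frac D a b = frac_rel D `` {(a, b)}"

definition frac_field :: "('a, 'c) ring_scheme \<Rightarrow> ('a \<times> 'a) set ring" where
  "frac_field D =
     \<lparr>carrier = (carrier D \<times> (carrier D - {\<zero>\<^bsub>D\<^esub>})) // frac_rel D,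
      monoid.mult = (\<lambda>p q. \<Union>(a, b)\<in>p. \<Union>(c, d)\<in>q. frac D (a \<otimes>\<^bsub>D\<^esub> c) (b \<otimes>\<^bsub>D\<^esub> d)),
      one = frac D \<one>\<^bsub>D\<^esub> \<one>\<^bsub>D\<^esub>,
      zero = frac D \<zero>\<^bsub>D\<^esub> \<one>\<^bsub>D\<^esub>,
      add = (\<lambda>p q. \<Union>(a, b)\<in>p. \<Union>(c, d)\<in>q.
               frac D (a \<otimes>\<^bsub>D\<^esub> d \<oplus>\<^bsub>D\<^esub> c \<otimes>\<^bsub>D\<^esub> b) (b \<otimes>\<^bsub>D\<^esub> d))\<rparr>"

definition rows_independent :: "('a, 'c) ring_scheme \<Rightarrow> 'a mat \<Rightarrow> nat set \<Rightarrow> bool" where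
  "rows_independent F A I \<longleftrightarrow> I \<subseteq> {..<dim_row A} \<and>
     (\<forall>c \<in> I \<rightarrow> carrier F.
        (\<forall>b<dim_col A. (\<Oplus>\<^bsub>F\<^esub>a\<in>I. c a \<otimes>\<^bsub>F\<^esub> A $$ (a, b)) = \<zero>\<^bsub>F\<^esub>) \<longrightarrow>
        (\<forall>a\<in>I. c a = \<zero>\<^bsub>F\<^esub>))"

definition rank_over :: "('a, 'c) ring_scheme \<Rightarrow> 'a mat \<Rightarrow> nat" where
  "rank_over F A = Max {card I |I. rows_independent F A I}"

definition coord_ring :: "nat \<Rightarrow> 'k::comm_ring_1 mpoly set \<Rightarrow> 'k mpoly set ring" where
  "coord_ring s \<bb> = poly_ring (yvars s) Quot \<bb>"

text \<open>
  $\mathrm{rank}_S(A\otimes_{\mathbb{K}[\mathbf{y}]}S)$ for a matrix \<open>A\<close> over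
  $\mathbb{K}[\mathbf{y}]$, where $S=\mathbb{K}[\mathbf{y}]/\mathfrak{b}$.
\<close>

definition rank_S :: "nat \<Rightarrow> 'k::comm_ring_1 mpoly set \<Rightarrow> 'k mpoly mat \<Rightarrow> nat" where
  "rank_S s \<bb> A = rank_over (frac_field (coord_ring s \<bb>))
     (map_mat (\<lambda>p. frac (coord_ring s \<bb>) (\<bb> +>\<^bsub>poly_ring (yvars s)\<^esub> p) \<one>\<^bsub>coord_ring s \<bb>\<^esub>) A)"

end

theory Submission
  imports Defs
begin

text \<open>
  Write \<open>R\<close> for the coordinate ring of the product and \<open>S\<close> for that of \<open>Y\<close>. By dominance, \<open>y\<^sub>j \<mapsto> f\<^sub>j t\<close>
  embeds \<open>S\<close> into \<open>R[t]\<close>, so an identity between forms on \<open>Y\<close> holds as soon as it holds after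
  substituting \<open>f\<close> (\<open>form_mem_PY_iff\<close>). By definition, the rows of the \<open>i\<close>-th Jacobian dual matrix
  span over \<open>K[y]\<close> all vectors of polynomials in \<open>y\<close> which, after this substitution, are orthogonal
  to the vector \<open>x\<^sub>i\<close> of coordinates of the \<open>i\<close>-th factor.

  Since \<open>x\<^sub>i\<close> is a nonzero vector in the kernel, the matrix has rank at most \<open>r\<^sub>i\<close>
  (\<open>indep_rows_card_le\<close>). If the rank is \<open>r\<^sub>i\<close>, the kernel is a line; by Cramer's rule it is also
  spanned by the signed maximal minors of \<open>r\<^sub>i\<close> independent rows, so these minors become proportional
  to \<open>x\<^sub>i\<close> after substituting \<open>f\<close> (\<open>maximal_minors_invert\<close>). Conversely, a tuple \<open>g\<^sub>i\<close> of forms on \<open>Y\<close>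
  that becomes proportional to \<open>x\<^sub>i\<close> gives, for an entry \<open>g\<^sub>i\<^sub>p\<close> that does not vanish on \<open>Y\<close>, the \<open>r\<^sub>i\<close> independent rows
  \<open>g\<^sub>i\<^sub>p x\<^sub>i\<^sub>l - g\<^sub>i\<^sub>l x\<^sub>i\<^sub>p\<close> with \<open>l \<noteq> p\<close>, and therefore rank \<open>r\<^sub>i\<close> (\<open>inverts_imp_indep_rows\<close>). Finally, such
  tuples for all \<open>i\<close> already form an inverse of the map: the remaining conditions, that they map \<open>Y\<close>
  to the product and are also inverse on the other side, are identities between forms on \<open>Y\<close>
  (\<open>inverts_imp_inverse_map\<close>). For the same reason the inverse is unique up to proportionality
  (\<open>inverts_unique\<close>). The statement on the block diagonal matrix follows, since ranks of diagonal
  blocks add up and each of them is at most \<open>r\<^sub>i\<close>.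

  All this uses that \<open>R\<close> is a domain, whereas only the product scheme is assumed to be integral
  (\<open>prime_prod_ideal\<close>). The point is that a nonzero coordinate of one factor is a nonzerodivisor on
  \<open>R\<close>, because a tensor product of algebras over a field is free over each factor
  (\<open>nonzerodivisor_prod_ideal\<close>).

  Ranks over the field of fractions of \<open>S\<close> are computed with polynomials modulo the prime ideal of
  \<open>Y\<close>, after clearing denominators (\<open>rank_S_eq_rank_mod\<close>).
\<close>

section \<open>Polynomials and their evaluation\<close>

abbreviation "keys \<equiv> Poly_Mapping.keys"
abbreviation "lookup \<equiv> Poly_Mapping.lookup"
abbreviation "single \<equiv> Poly_Mapping.single"

lemma mpoly_eq_sum_monomials:
  fixes p :: "'a \<Rightarrow>\<^sub>0 'b::comm_monoid_add"
  shows "p = (\<Sum>u\<in>keys p. single u (lookup p u))"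
proof (rule poly_mapping_eqI)
  fix w
  show "lookup p w =
      lookup (\<Sum>u\<in>keys p. single u (lookup p u)) w"
    by (cases "w \<in> keys p")
      (auto simp: lookup_sum lookup_single when_def in_keys_iff)
qed

lemma mpoly_monomial_induct [case_names zero monomial add]:
  fixes p :: "'a \<Rightarrow>\<^sub>0 'b::comm_monoid_add"
  assumes "P 0" "\<And>u c. u \<in> keys p \<Longrightarrow> P (single u c)"
    and "\<And>p q. P p \<Longrightarrow> P q \<Longrightarrow> P (p + q)"
  shows "P p"
proof -
  have "A \<subseteq> keys p \<Longrightarrow>
      P (\<Sum>u\<in>A. single u (lookup p u))" if "finite A" for A
    using that by (induction A) (auto intro: assms)
  from this[of "keys p"] show ?thesis
    using mpoly_eq_sum_monomials[of p] by simp
qed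

definition mon_eval :: "(pvar \<Rightarrow> 'b::comm_ring_1) \<Rightarrow> (pvar \<Rightarrow>\<^sub>0 nat) \<Rightarrow> 'b" where
  "mon_eval \<sigma> u = (\<Prod>v\<in>keys u. \<sigma> v ^ lookup u v)"

lemma mon_eval_superset:
  "finite A \<Longrightarrow> keys u \<subseteq> A \<Longrightarrow> mon_eval \<sigma> u = (\<Prod>v\<in>A. \<sigma> v ^ lookup u v)"
  unfolding mon_eval_def by (rule prod.mono_neutral_left) (auto simp: in_keys_iff)

lemma mon_eval_zero [simp]: "mon_eval \<sigma> 0 = 1"
  by (simp add: mon_eval_def)

lemma mon_eval_add: "mon_eval \<sigma> (u + v) = mon_eval \<sigma> u * mon_eval \<sigma> v"
proof -
  let ?A = "keys u \<union> keys v"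
  have "keys (u + v) \<subseteq> ?A" by (rule keys_add)
  then show ?thesis
    by (simp add: mon_eval_superset[of ?A] lookup_add power_add prod.distrib)
qed

lemma mon_eval_single [simp]: "mon_eval \<sigma> (single v n) = \<sigma> v ^ n"
  by (cases "n = 0") (simp_all add: mon_eval_def)

lemma mp_eval_superset:
  assumes "comm_ring_hom \<phi>" "finite A" "keys p \<subseteq> A"
  shows "mp_eval \<phi> \<sigma> p = (\<Sum>u\<in>A. \<phi> (lookup p u) * mon_eval \<sigma> u)"
proof -
  interpret comm_ring_hom \<phi> by fact
  show ?thesis
    unfolding mp_eval_def mon_eval_def[symmetric]
    by (rule sum.mono_neutral_left) (use assms in \<open>auto simp: in_keys_iff\<close>)
qed

lemma mp_eval_single:
  assumes "comm_ring_hom \<phi>"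
  shows "mp_eval \<phi> \<sigma> (single u c) = \<phi> c * mon_eval \<sigma> u"
  by (subst mp_eval_superset[OF assms, of "{u}"]) (auto simp: lookup_single when_def split: if_splits)

lemma mp_eval_add:
  assumes "comm_ring_hom \<phi>"
  shows "mp_eval \<phi> \<sigma> (p + q) = mp_eval \<phi> \<sigma> p + mp_eval \<phi> \<sigma> q"
proof -
  interpret comm_ring_hom \<phi> by fact
  let ?A = "keys p \<union> keys q"
  have "keys (p + q) \<subseteq> ?A" by (rule keys_add)
  then show ?thesis
    by (simp add: mp_eval_superset[OF assms, of ?A] lookup_add hom_add distrib_right sum.distrib)
qed

lemma mp_eval_hom:
  assumes "comm_ring_hom \<phi>"
  shows "comm_ring_hom (mp_eval \<phi> \<sigma>)"
proof -
  interpret \<phi>: comm_ring_hom \<phi> by fact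
  have zero: "mp_eval \<phi> \<sigma> 0 = 0"
    by (simp add: mp_eval_def)
  have "mp_eval \<phi> \<sigma> (p * q) = mp_eval \<phi> \<sigma> p * mp_eval \<phi> \<sigma> q" for p q
  proof (induction p rule: mpoly_monomial_induct)
    case (monomial u c)
    show ?case
    proof (induction q rule: mpoly_monomial_induct)
      case (monomial v d)
      then show ?case
        by (simp add: mult_single mp_eval_single[OF assms] \<phi>.hom_mult mon_eval_add ac_simps)
    qed (simp_all add: zero mp_eval_add[OF assms] algebra_simps)
  qed (simp_all add: zero mp_eval_add[OF assms] algebra_simps)
  moreover have "mp_eval \<phi> \<sigma> 1 = 1"
    using mp_eval_single[OF assms, of \<sigma> 0 1] by simp
  ultimately show ?thesis
    by unfold_locales (simp_all add: zero mp_eval_add[OF assms])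
qed

lemma Const_hom: "comm_ring_hom Const"
  by unfold_locales (simp_all add: Const_def single_add mult_single)

lemma mp_eval_Const [simp]:
  assumes "comm_ring_hom \<phi>" shows "mp_eval \<phi> \<sigma> (Const c) = \<phi> c"
  by (simp add: Const_def mp_eval_single[OF assms])

lemma mp_eval_Var [simp]:
  assumes "comm_ring_hom \<phi>" shows "mp_eval \<phi> \<sigma> (Var v) = \<sigma> v"
proof -
  interpret comm_ring_hom \<phi> by fact
  show ?thesis by (simp add: Var_def mp_eval_single[OF assms])
qed

lemma single_eq_Const_mult: "single u c = Const c * single u 1"
  by (simp add: Const_def mult_single)

lemma hom_mp_eval:
  assumes "comm_ring_hom H" "comm_ring_hom \<phi>"
  shows "H (mp_eval \<phi> \<sigma> p) = mp_eval (H \<circ> \<phi>) (H \<circ> \<sigma>) p"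
proof -
  interpret H: comm_ring_hom H by fact
  show ?thesis
    unfolding mp_eval_def by (simp add: H.hom_sum H.hom_mult H.hom_prod H.hom_power)
qed

lemma mp_eval_cong:
  assumes "\<And>v. v \<in> vars p \<Longrightarrow> \<sigma> v = \<tau> v"
  shows "mp_eval \<phi> \<sigma> p = mp_eval \<phi> \<tau> p"
  unfolding mp_eval_def
  by (intro sum.cong refl arg_cong2[where f = "(*)"] prod.cong arg_cong2[where f = "(^)"] assms)
    (auto simp: vars_def)

lemma mon_eval_Var: "mon_eval Var u = single u (1::'k::comm_ring_1)"
proof -
  have pow: "Var v ^ n = single (single v n) (1::'k)" for v n
    by (induction n) (simp_all add: Var_def mult_single single_add[symmetric])
  have "(\<Prod>v\<in>A. single (single v (lookup u v)) (1::'k)) =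
      single (\<Sum>v\<in>A. single v (lookup u v)) 1" if "finite A" for A
    using that by induction (simp_all add: mult_single)
  from this[of "keys u"] show ?thesis
    unfolding mon_eval_def pow using mpoly_eq_sum_monomials[of u] by simp
qed

lemma mp_eval_Const_Var: "mp_eval Const Var p = p"
  using mpoly_eq_sum_monomials[of p]
  by (simp add: mp_eval_def mon_eval_def[symmetric] mon_eval_Var single_eq_Const_mult[symmetric])

lemma vars_subset_iff: "vars p \<subseteq> V \<longleftrightarrow> (\<forall>u\<in>keys p. keys u \<subseteq> V)"
  by (auto simp: vars_def)

lemma vars_zero [simp]: "vars 0 = {}"
  and vars_one [simp]: "vars (1::'k::comm_ring_1 mpoly) = {}"
  and vars_Const [simp]: "vars (Const c) = {}"
  and vars_Var [simp]: "vars (Var v :: 'k mpoly) = {v}"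
  and vars_uminus [simp]: "vars (- q :: 'k mpoly) = vars q"
  by (auto simp: vars_def Const_def Var_def in_keys_iff split: if_splits)

lemma vars_single_subset: "keys u \<subseteq> V \<Longrightarrow> vars (single u c) \<subseteq> V"
  by (auto simp: vars_def split: if_splits)

lemma vars_add_subset: "vars p \<subseteq> V \<Longrightarrow> vars q \<subseteq> V \<Longrightarrow> vars (p + q) \<subseteq> V"
  using keys_add[of p q] unfolding vars_subset_iff by blast

lemma vars_mult_subset:
  fixes p q :: "'k::comm_ring_1 mpoly"
  assumes "vars p \<subseteq> V" "vars q \<subseteq> V" shows "vars (p * q) \<subseteq> V"
  unfolding vars_subset_iff
proof
  fix w assume "w \<in> keys (p * q)"
  then obtain u v where "u \<in> keys p" "v \<in> keys q" "w = u + v"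
    using keys_mult[of p q] by blast
  then show "keys w \<subseteq> V"
    using assms keys_add[of u v] unfolding vars_subset_iff by blast
qed

lemma vars_diff_subset:
  fixes p q :: "'k::comm_ring_1 mpoly"
  shows "vars p \<subseteq> V \<Longrightarrow> vars q \<subseteq> V \<Longrightarrow> vars (p - q) \<subseteq> V"
  using vars_add_subset[of p V "- q"] by simp

lemma vars_sum_subset: "(\<And>a. a \<in> A \<Longrightarrow> vars (p a) \<subseteq> V) \<Longrightarrow> vars (sum p A) \<subseteq> V"
  by (induction A rule: infinite_finite_induct) (auto simp: vars_add_subset)

lemma vars_prod_subset:
  fixes p :: "'a \<Rightarrow> 'k::comm_ring_1 mpoly"
  shows "(\<And>a. a \<in> A \<Longrightarrow> vars (p a) \<subseteq> V) \<Longrightarrow> vars (prod p A) \<subseteq> V"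
  by (induction A rule: infinite_finite_induct) (auto simp: vars_mult_subset)

lemma vars_power_subset:
  fixes p :: "'k::comm_ring_1 mpoly"
  shows "vars p \<subseteq> V \<Longrightarrow> vars (p ^ n) \<subseteq> V"
  by (induction n) (auto simp: vars_mult_subset)

lemma vars_mp_eval_subset:
  assumes "\<And>v. v \<in> vars p \<Longrightarrow> vars (\<sigma> v) \<subseteq> V"
  shows "vars (mp_eval Const \<sigma> p) \<subseteq> V"
proof -
  have "vars (\<sigma> v) \<subseteq> V" if "u \<in> keys p" "v \<in> keys u" for u v
    using that assms[of v] by (auto simp: vars_def)
  then show ?thesis
    unfolding mp_eval_def
    by (intro vars_sum_subset vars_mult_subset vars_prod_subset vars_power_subset) auto
qed

section \<open>Degrees\<close>

text \<open>
  The multi-degree of a monomial as a finitely supported function: the value at \<open>0\<close> is the degree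
  in the variables \<open>y\<close> and the value at \<open>i + 1\<close> is the degree in the block \<open>i\<close> of variables \<open>x\<close>.
  Finitely supported functions into the naturals form a cancellative monoid with a compatible
  linear order, which is what the argument by leading components below uses.
\<close>

fun block :: "pvar \<Rightarrow> nat" where
  "block (XVar i j) = Suc i"
| "block (YVar j) = 0"

definition bdeg :: "(pvar \<Rightarrow>\<^sub>0 nat) \<Rightarrow> nat \<Rightarrow>\<^sub>0 nat" where
  "bdeg u = (\<Sum>v\<in>keys u. single (block v) (lookup u v))"

definition bdeg_pair :: "(nat \<Rightarrow>\<^sub>0 nat) \<Rightarrow> (nat \<Rightarrow> nat) \<times> nat" where
  "bdeg_pair d = (\<lambda>i. lookup d (Suc i), lookup d 0)"

lemma bdeg_pair_inject: "bdeg_pair d = bdeg_pair e \<longleftrightarrow> d = e"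
proof
  assume eq: "bdeg_pair d = bdeg_pair e"
  show "d = e"
  proof (rule poly_mapping_eqI)
    fix n
    show "lookup d n = lookup e n"
      using eq by (cases n) (auto simp: bdeg_pair_def fun_eq_iff)
  qed
qed simp

lemma mdeg_eq_bdeg_pair: "mdeg u = bdeg_pair (bdeg u)"
proof -
  have "xdeg u i = lookup (bdeg u) (Suc i)" for i
    unfolding xdeg_def bdeg_def lookup_sum
    by (rule sum.cong) (auto simp: lookup_single when_def split: pvar.split)
  moreover have "ydeg u = lookup (bdeg u) 0"
    unfolding ydeg_def bdeg_def lookup_sum
    by (rule sum.cong) (auto simp: lookup_single when_def split: pvar.split)
  ultimately show ?thesis by (simp add: mdeg_def bdeg_pair_def fun_eq_iff)
qed

lemma bdeg_superset:
  "finite A \<Longrightarrow> keys u \<subseteq> A \<Longrightarrow>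
    bdeg u = (\<Sum>v\<in>A. single (block v) (lookup u v))"
  unfolding bdeg_def by (rule sum.mono_neutral_left) (auto simp: in_keys_iff)

lemma bdeg_add: "bdeg (u + v) = bdeg u + bdeg v"
proof -
  let ?A = "keys u \<union> keys v"
  have "keys (u + v) \<subseteq> ?A" by (rule keys_add)
  then show ?thesis
    by (simp add: bdeg_superset[of ?A] lookup_add single_add sum.distrib)
qed

lemma bdeg_zero [simp]: "bdeg 0 = 0"
  by (simp add: bdeg_def)

lemma bdeg_single [simp]: "bdeg (single v n) = single (block v) n"
  by (cases "n = 0") (simp_all add: bdeg_def)

definition homog :: "(nat \<Rightarrow>\<^sub>0 nat) \<Rightarrow> 'k::comm_ring_1 mpoly \<Rightarrow> bool" where
  "homog d p \<longleftrightarrow> (\<forall>u\<in>keys p. bdeg u = d)"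

lemma homogeneous_bdeg_pair: "homogeneous (bdeg_pair d) p = homog d p"
  by (simp add: homogeneous_def homog_def mdeg_eq_bdeg_pair bdeg_pair_inject)

text \<open>
  The case distinction is needed because the zero polynomial is homogeneous of every degree, also of
  those that are not finitely supported.
\<close>

lemma homogeneous_imp_homog:
  assumes "homogeneous \<delta> p"
  obtains d where "homog d p" "p \<noteq> 0 \<Longrightarrow> \<delta> = bdeg_pair d"
proof (cases "p = 0")
  case True
  then show ?thesis using that[of 0] by (simp add: homog_def)
next
  case False
  then obtain u where "u \<in> keys p"
    by (metis all_not_in_conv keys_eq_empty)
  then have "\<delta> = bdeg_pair (bdeg u)"
    using assms by (simp add: homogeneous_def mdeg_eq_bdeg_pair)
  then show ?thesis
    using that[of "bdeg u"] assms homogeneous_bdeg_pair by blast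
qed

lemma homog_zero [simp]: "homog d 0"
  by (simp add: homog_def)

lemma homog_one: "homog 0 1"
  by (simp add: homog_def)

lemma homog_Const: "homog 0 (Const c)"
  by (simp add: homog_def Const_def)

lemma homog_Var: "homog (single (block v) 1) (Var v)"
  by (simp add: homog_def Var_def)

lemma homog_single: "bdeg u = d \<Longrightarrow> homog d (single u c)"
  by (simp add: homog_def)

lemma homog_add: "homog d p \<Longrightarrow> homog d q \<Longrightarrow> homog d (p + q)"
  using keys_add[of p q] by (auto simp: homog_def)

lemma homog_uminus: "homog d p \<Longrightarrow> homog d (- p)"
  by (simp add: homog_def in_keys_iff)

lemma homog_diff: "homog d p \<Longrightarrow> homog d q \<Longrightarrow> homog d (p - q)"
  using homog_add[of d p "- q"] homog_uminus[of d q] by simp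

lemma homog_mult: "homog d p \<Longrightarrow> homog e q \<Longrightarrow> homog (d + e) (p * q)"
  using keys_mult[of p q] by (auto simp: homog_def bdeg_add)

lemma homog_sum: "(\<And>a. a \<in> A \<Longrightarrow> homog d (p a)) \<Longrightarrow> homog d (sum p A)"
  by (induction A rule: infinite_finite_induct) (auto simp: homog_add)

lemma homog_prod: "(\<And>a. a \<in> A \<Longrightarrow> homog (d a) (p a)) \<Longrightarrow> homog (sum d A) (prod p A)"
  by (induction A rule: infinite_finite_induct) (auto simp: homog_mult homog_one)

lemma homog_power: "homog d p \<Longrightarrow> homog (\<Sum>_<n. d) (p ^ n)"
  using homog_prod[of "{..<n}" "\<lambda>_. d" "\<lambda>_. p"] by simp

definition component :: "(nat \<Rightarrow>\<^sub>0 nat) \<Rightarrow> 'k::comm_ring_1 mpoly \<Rightarrow> 'k mpoly" where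
  "component d p = (\<Sum>u\<in>{u\<in>keys p. bdeg u = d}. single u (lookup p u))"

lemma hom_component_bdeg_pair: "hom_component (bdeg_pair d) p = component d p"
  by (simp add: hom_component_def component_def mdeg_eq_bdeg_pair bdeg_pair_inject)

lemma hom_component_cases: "hom_component \<delta> p = 0 \<or> (\<exists>d. hom_component \<delta> p = component d p)"
proof (cases "\<exists>d. \<delta> = bdeg_pair d")
  case False
  then have "{u \<in> keys p. mdeg u = \<delta>} = {}"
    by (auto simp: mdeg_eq_bdeg_pair)
  then show ?thesis unfolding hom_component_def by (simp only: sum.empty simp_thms)
qed (auto simp: hom_component_bdeg_pair)

lemma lookup_component: "lookup (component d p) u = (if bdeg u = d then lookup p u else 0)"
proof -
  have "(\<Sum>w\<in>{w \<in> keys p. bdeg w = d}. if w = u then lookup p w else 0) =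
      (if bdeg u = d then lookup p u else 0)"
    by (subst sum.delta) (auto simp: in_keys_iff)
  then show ?thesis
    unfolding component_def lookup_sum lookup_single when_def .
qed

lemma homog_component: "homog d (component d p)"
  by (auto simp: homog_def in_keys_iff lookup_component split: if_splits)

lemma component_homog: "homog e p \<Longrightarrow> component d p = (if d = e then p else 0)"
  by (rule poly_mapping_eqI) (auto simp: lookup_component homog_def in_keys_iff)

lemma component_zero [simp]: "component d 0 = 0"
  by (simp add: component_def)

lemma component_add: "component d (p + q) = component d p + component d q"
  by (rule poly_mapping_eqI) (simp add: lookup_component lookup_add)

lemma component_sum: "component d (sum p A) = (\<Sum>a\<in>A. component d (p a))"
  by (induction A rule: infinite_finite_induct) (simp_all add: component_add)

lemma vars_component_subset: "vars p \<subseteq> V \<Longrightarrow> vars (component d p) \<subseteq> V"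
  by (auto simp: vars_subset_iff in_keys_iff lookup_component split: if_splits)

lemma sum_component:
  assumes "finite D" "bdeg ` keys p \<subseteq> D"
  shows "(\<Sum>d\<in>D. component d p) = p"
proof (rule poly_mapping_eqI)
  fix u
  have "(\<Sum>d\<in>D. if bdeg u = d then lookup p u else 0) = lookup p u"
    using assms by (cases "u \<in> keys p") (auto simp: in_keys_iff)
  then show "lookup (\<Sum>d\<in>D. component d p) u = lookup p u"
    by (simp add: lookup_sum lookup_component)
qed

lemma component_mult:
  fixes p q :: "'k::comm_ring_1 mpoly"
  assumes "finite D" "bdeg ` keys p \<subseteq> D" "finite E" "bdeg ` keys q \<subseteq> E"
  shows "component c (p * q) = (\<Sum>d\<in>D. \<Sum>e\<in>E. if c = d + e then component d p * component e q else 0)"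
proof -
  have "p * q = (\<Sum>d\<in>D. \<Sum>e\<in>E. component d p * component e q)"
    using sum_component[OF assms(1,2)] sum_component[OF assms(3,4)] by (metis sum_product)
  then have "component c (p * q) = (\<Sum>d\<in>D. \<Sum>e\<in>E. component c (component d p * component e q))"
    by (simp add: component_sum)
  also have "\<dots> = (\<Sum>d\<in>D. \<Sum>e\<in>E. if c = d + e then component d p * component e q else 0)"
    by (intro sum.cong refl) (auto simp: component_homog[OF homog_mult[OF homog_component homog_component]])
  finally show ?thesis .
qed

section \<open>Ideals of the polynomial rings\<close>

lemma poly_ring_simps [simp]:
  "p \<in> carrier (poly_ring V) \<longleftrightarrow> vars p \<subseteq> V"
  "p \<otimes>\<^bsub>poly_ring V\<^esub> q = p * q" "p \<oplus>\<^bsub>poly_ring V\<^esub> q = p + q"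
  "\<one>\<^bsub>poly_ring V\<^esub> = 1" "\<zero>\<^bsub>poly_ring V\<^esub> = 0"
  by (simp_all add: poly_ring_def)

lemma cring_poly_ring: "cring (poly_ring V :: 'k::comm_ring_1 mpoly ring)"
proof (rule cringI)
  let ?R = "poly_ring V :: 'k mpoly ring"
  show "abelian_group ?R"
  proof (rule abelian_groupI)
    fix p assume "p \<in> carrier ?R"
    then show "\<exists>q\<in>carrier ?R. q \<oplus>\<^bsub>?R\<^esub> p = \<zero>\<^bsub>?R\<^esub>"
      by (intro bexI[of _ "- p"]) simp_all
  qed (auto simp: vars_add_subset algebra_simps)
  show "Group.comm_monoid ?R"
    by (rule comm_monoidI) (auto simp: vars_mult_subset algebra_simps)
qed (simp add: algebra_simps)

lemma ideal_poly_ring_iff: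
  "ideal I (poly_ring V) \<longleftrightarrow> I \<subseteq> {p. vars p \<subseteq> V} \<and> 0 \<in> I \<and> (\<forall>p\<in>I. \<forall>q\<in>I. p + q \<in> I) \<and>
     (\<forall>p\<in>I. \<forall>q. vars q \<subseteq> V \<longrightarrow> q * p \<in> I)" (is "?L \<longleftrightarrow> ?R")
proof
  assume ?L
  then interpret ideal I "poly_ring V" .
  show ?R
    using subsetD[OF a_subset] additive_subgroup.zero_closed[OF is_additive_subgroup]
      additive_subgroup.a_closed[OF is_additive_subgroup] I_l_closed by auto
next
  assume R: ?R
  interpret cring "poly_ring V" by (rule cring_poly_ring)
  show ?L
  proof (rule idealI)
    show "subgroup I (add_monoid (poly_ring V))"
    proof (rule subgroup.intro)
      fix p assume p: "p \<in> I"
      then have "vars p \<subseteq> V" using R by auto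
      then have "inv\<^bsub>add_monoid (poly_ring V)\<^esub> p = - p"
        using minus_equality[of "- p" p] by (simp add: a_inv_def)
      moreover have "(- 1) * p \<in> I" using R p by (metis vars_uminus vars_one empty_subsetI)
      ultimately show "inv\<^bsub>add_monoid (poly_ring V)\<^esub> p \<in> I" by simp
    qed (use R in auto)
  qed (use R ring_axioms in \<open>auto simp: mult.commute\<close>)
qed

lemma ideal_polyD:
  assumes "ideal I (poly_ring V)"
  shows "p \<in> I \<Longrightarrow> vars p \<subseteq> V" "0 \<in> I" "p \<in> I \<Longrightarrow> q \<in> I \<Longrightarrow> p + q \<in> I"
    "p \<in> I \<Longrightarrow> vars q \<subseteq> V \<Longrightarrow> q * p \<in> I" "p \<in> I \<Longrightarrow> vars q \<subseteq> V \<Longrightarrow> p * q \<in> I"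
    "p \<in> I \<Longrightarrow> - p \<in> I" "p \<in> I \<Longrightarrow> q \<in> I \<Longrightarrow> p - q \<in> I"
proof -
  note R = assms[unfolded ideal_poly_ring_iff]
  show "p \<in> I \<Longrightarrow> vars p \<subseteq> V" "0 \<in> I" "p \<in> I \<Longrightarrow> q \<in> I \<Longrightarrow> p + q \<in> I"
    "p \<in> I \<Longrightarrow> vars q \<subseteq> V \<Longrightarrow> q * p \<in> I" "p \<in> I \<Longrightarrow> vars q \<subseteq> V \<Longrightarrow> p * q \<in> I"
    using R by (auto simp: mult.commute)
  show m: "p \<in> I \<Longrightarrow> - p \<in> I" for p
  proof -
    assume "p \<in> I"
    then have "(- 1) * p \<in> I"
      using R by (metis vars_uminus vars_one empty_subsetI)
    then show "- p \<in> I" by simp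
  qed
  show "p \<in> I \<Longrightarrow> q \<in> I \<Longrightarrow> p - q \<in> I"
    using R m[of q] by (metis add_uminus_conv_diff)
qed

lemma ideal_poly_sum:
  assumes "ideal I (poly_ring V)" "\<And>a. a \<in> A \<Longrightarrow> p a \<in> I"
  shows "sum p A \<in> I"
  using assms(2)
  by (induction A rule: infinite_finite_induct) (auto intro: ideal_polyD[OF assms(1)])

lemma primeideal_poly_ring_iff:
  "primeideal I (poly_ring V) \<longleftrightarrow> ideal I (poly_ring V) \<and> 1 \<notin> I \<and>
     (\<forall>p q. vars p \<subseteq> V \<and> vars q \<subseteq> V \<and> p * q \<in> I \<longrightarrow> p \<in> I \<or> q \<in> I)" (is "?L \<longleftrightarrow> ?R")
proof
  assume ?L
  then interpret primeideal I "poly_ring V" .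
  have "1 \<notin> I"
    using I_notcarr one_imp_carrier by auto
  then show ?R using I_prime is_ideal by auto
next
  assume ?R
  then show ?L
    by (intro primeidealI cring_poly_ring) auto
qed

lemma primeideal_polyD:
  assumes "primeideal I (poly_ring V)"
  shows "ideal I (poly_ring V)" "1 \<notin> I"
    "vars p \<subseteq> V \<Longrightarrow> vars q \<subseteq> V \<Longrightarrow> p * q \<in> I \<Longrightarrow> p \<in> I \<or> q \<in> I"
  using assms unfolding primeideal_poly_ring_iff by auto

lemma primeideal_poly_prod:
  assumes "primeideal I (poly_ring V)" "\<And>a. a \<in> A \<Longrightarrow> vars (p a) \<subseteq> V \<and> p a \<notin> I"
  shows "prod p A \<notin> I"
  using assms(2)
proof (induction A rule: infinite_finite_induct)
  case (insert a A)
  then show ?case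
    using primeideal_polyD(3)[OF assms(1), of "p a" "prod p A"] vars_prod_subset[of A p V] by auto
qed (simp_all add: primeideal_polyD[OF assms(1)])

lemma homogeneous_ideal_iff:
  "homogeneous_ideal I V \<longleftrightarrow> ideal I (poly_ring V) \<and> (\<forall>p\<in>I. \<forall>d. component d p \<in> I)"
proof (intro iffI conjI ballI allI; (elim conjE)?)
  fix p d
  assume "homogeneous_ideal I V" "p \<in> I"
  then show "component d p \<in> I"
    unfolding homogeneous_ideal_def by (metis hom_component_bdeg_pair)
next
  assume I: "ideal I (poly_ring V)" and "\<forall>p\<in>I. \<forall>d. component d p \<in> I"
  then have "hom_component \<delta> p \<in> I" if "p \<in> I" for p \<delta>
    using hom_component_cases[of \<delta> p] ideal_polyD(2)[OF I] that by auto
  then show "homogeneous_ideal I V" using I by (simp add: homogeneous_ideal_def)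
qed (simp add: homogeneous_ideal_def)

text \<open>
  Leading components: if neither factor lies in \<open>I\<close>, take in each the component of largest degree
  that is not in \<open>I\<close>. Their product is, modulo \<open>I\<close>, a component of the product.
\<close>

lemma homogeneous_prime_test:
  assumes I: "homogeneous_ideal I V" and "1 \<notin> I"
    and test: "\<And>a b d e. vars a \<subseteq> V \<Longrightarrow> vars b \<subseteq> V \<Longrightarrow> homog d a \<Longrightarrow> homog e b \<Longrightarrow> a * b \<in> I \<Longrightarrow>
      a \<in> I \<or> b \<in> I"
  shows "primeideal I (poly_ring V)"
proof -
  have id: "ideal I (poly_ring V)" using I by (simp add: homogeneous_ideal_def)
  have comp: "component d p \<in> I" if "p \<in> I" for p d
    using I that by (simp add: homogeneous_ideal_iff)
  have "p \<in> I \<or> q \<in> I" if "vars p \<subseteq> V" "vars q \<subseteq> V" "p * q \<in> I" for p q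
  proof (rule ccontr)
    assume "\<not> (p \<in> I \<or> q \<in> I)"
    then have notin: "p \<notin> I" "q \<notin> I" by auto
    have top: "\<exists>d. component d p \<notin> I \<and> (\<forall>d'. component d' p \<notin> I \<longrightarrow> d' \<le> d)" if "p \<notin> I" for p
    proof -
      let ?D = "{d \<in> bdeg ` keys p. component d p \<notin> I}"
      have "?D \<noteq> {}"
        using sum_component[of "bdeg ` keys p" p] that
          ideal_poly_sum[OF id, of "bdeg ` keys p" "\<lambda>d. component d p"] by auto
      moreover have "component d p = 0" if "d \<notin> bdeg ` keys p" for d
        using that by (intro poly_mapping_eqI) (auto simp: lookup_component in_keys_iff)
      then have "d \<in> ?D" if "component d p \<notin> I" for d
        using that ideal_polyD(2)[OF id] by (metis (mono_tags, lifting) mem_Collect_eq)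
      moreover have "finite ?D" by auto
      ultimately have "Max ?D \<in> ?D" "\<forall>d'. component d' p \<notin> I \<longrightarrow> d' \<le> Max ?D"
        using Max_in[of ?D] Max_ge[of ?D] by blast+
      then show ?thesis by blast
    qed
    obtain d where d: "component d p \<notin> I" "\<And>d'. component d' p \<notin> I \<Longrightarrow> d' \<le> d"
      using top[OF notin(1)] by blast
    obtain e where e: "component e q \<notin> I" "\<And>e'. component e' q \<notin> I \<Longrightarrow> e' \<le> e"
      using top[OF notin(2)] by blast
    define D where "D = insert d (bdeg ` keys p)"
    define E where "E = insert e (bdeg ` keys q)"
    have fin: "finite D" "finite E" by (auto simp: D_def E_def)
    have v: "vars (component d' p) \<subseteq> V" "vars (component d' q) \<subseteq> V" for d'
      using \<open>vars p \<subseteq> V\<close> \<open>vars q \<subseteq> V\<close> by (simp_all add: vars_component_subset)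
    let ?t = "\<lambda>(d', e'). if d + e = d' + e' then component d' p * component e' q else 0"
    have "component (d + e) (p * q) = (\<Sum>z\<in>D \<times> E. ?t z)"
      by (subst component_mult[of D p E q]) (auto simp: D_def E_def sum.cartesian_product)
    also have "\<dots> = ?t (d, e) + (\<Sum>z\<in>D \<times> E - {(d, e)}. ?t z)"
      using fin by (intro sum.remove) (auto simp: D_def E_def)
    finally have eq: "component d p * component e q =
        component (d + e) (p * q) - (\<Sum>z\<in>D \<times> E - {(d, e)}. ?t z)" by simp
    have "?t z \<in> I" if "z \<in> D \<times> E - {(d, e)}" for z
    proof -
      obtain d' e' where z: "z = (d', e')" by force
      show ?thesis
      proof (cases "d + e = d' + e'")
        case True
        have "component d' p \<in> I \<or> component e' q \<in> I"
        proof (rule ccontr)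
          assume "\<not> ?thesis"
          then have "d' \<le> d" "e' \<le> e" using d(2) e(2) by auto
          with True that z show False
            by (metis Diff_iff add_left_imp_eq add_less_le_mono insertI1 not_less_iff_gr_or_eq order_le_less)
        qed
        then show ?thesis using z v True ideal_polyD(4,5)[OF id] by auto
      qed (use z ideal_polyD(2)[OF id] in auto)
    qed
    then have "component d p * component e q \<in> I"
      unfolding eq using comp[OF \<open>p * q \<in> I\<close>] by (intro ideal_polyD(7)[OF id] ideal_poly_sum[OF id])
    with test[OF v homog_component homog_component, of d e] d(1) e(1) show False by blast
  qed
  then show ?thesis using id \<open>1 \<notin> I\<close> by (auto simp: primeideal_poly_ring_iff)
qed

lemma homogeneous_ideal_add_principal:
  fixes M :: "'k::comm_ring_1 mpoly set"
  assumes "homogeneous_ideal M V" "vars a \<subseteq> V" "homog e a"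
  shows "homogeneous_ideal {x + q * a |x q. x \<in> M \<and> vars q \<subseteq> V} V" (is "homogeneous_ideal ?N V")
  unfolding homogeneous_ideal_iff ideal_poly_ring_iff
proof (intro conjI ballI allI impI)
  have id: "ideal M (poly_ring V)" using assms by (simp add: homogeneous_ideal_def)
  note idD = ideal_polyD[OF id]
  show "?N \<subseteq> {p. vars p \<subseteq> V}"
  proof
    fix p assume "p \<in> ?N"
    then obtain x q where "p = x + q * a" "x \<in> M" "vars q \<subseteq> V" by blast
    then show "p \<in> {p. vars p \<subseteq> V}"
      using idD(1)[of x] assms(2) by (simp add: vars_add_subset vars_mult_subset)
  qed
  show "0 \<in> ?N" using idD(2) by (intro CollectI exI[of _ 0]) simp
  fix p assume "p \<in> ?N"
  then obtain x q where p: "p = x + q * a" and x: "x \<in> M" "vars q \<subseteq> V" by blast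
  {
    fix p' assume "p' \<in> ?N"
    then obtain x' q' where p': "p' = x' + q' * a" and x': "x' \<in> M" "vars q' \<subseteq> V" by blast
    have "p + p' = (x + x') + (q + q') * a" by (simp add: p p' algebra_simps)
    then show "p + p' \<in> ?N" using x x' idD(3) vars_add_subset by blast
  next
    fix q' :: "'k mpoly" assume "vars q' \<subseteq> V"
    then have "q' * x \<in> M" "vars (q' * q) \<subseteq> V" using x idD(4) vars_mult_subset by blast+
    moreover have "q' * p = q' * x + (q' * q) * a" by (simp add: p algebra_simps)
    ultimately show "q' * p \<in> ?N" by blast
  next
    fix d
    let ?D = "bdeg ` keys q"
    have "component d (q * a) = (\<Sum>d'\<in>?D. \<Sum>e'\<in>{e}. if d = d' + e' then component d' q * component e' a else 0)"
      by (rule component_mult) (use assms(3) in \<open>auto simp: homog_def\<close>)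
    also have "\<dots> = (\<Sum>d'\<in>?D. if d = d' + e then component d' q else 0) * a"
      using assms(3) by (auto simp: sum_distrib_right component_homog intro!: sum.cong)
    finally have "component d p = component d x + (\<Sum>d'\<in>?D. if d = d' + e then component d' q else 0) * a"
      by (simp add: p component_add)
    moreover have "component d x \<in> M" using assms(1) x(1) by (simp add: homogeneous_ideal_iff)
    moreover have "vars (\<Sum>d'\<in>?D. if d = d' + e then component d' q else 0) \<subseteq> V"
      using x(2) by (intro vars_sum_subset) (simp add: vars_component_subset)
    ultimately show "component d p \<in> ?N" by blast
  }
qed

text \<open>
  Krull's theorem in graded form: by Zorn's lemma there is a largest homogeneous ideal that contains
  \<open>A\<close> and no power of \<open>w\<close>, and it passes the test for primality on homogeneous elements.
\<close>

lemma exists_homogeneous_prime_avoiding: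
  assumes A: "homogeneous_ideal A V" and w: "vars w \<subseteq> V" "\<And>n. w ^ n \<notin> A"
  obtains P where "primeideal P (poly_ring V)" "homogeneous_ideal P V" "A \<subseteq> P" "w \<notin> P"
proof -
  define S where "S = {M. homogeneous_ideal M V \<and> A \<subseteq> M \<and> (\<forall>n. w ^ n \<notin> M)}"
  have "S \<noteq> {}" using assms by (auto simp: S_def)
  moreover have "\<Union> C \<in> S" if "C \<noteq> {}" "subset.chain S C" for C
  proof -
    have C: "homogeneous_ideal M V" "A \<subseteq> M" "\<And>n. w ^ n \<notin> M" if "M \<in> C" for M
      using that \<open>subset.chain S C\<close> by (auto simp: subset_chain_def S_def)
    have id: "ideal M (poly_ring V)" if "M \<in> C" for M
      using C(1)[OF that] by (simp add: homogeneous_ideal_def)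
    have "homogeneous_ideal (\<Union> C) V"
      unfolding homogeneous_ideal_iff ideal_poly_ring_iff
    proof (intro conjI ballI allI impI)
      show "\<Union> C \<subseteq> {p. vars p \<subseteq> V}" using ideal_polyD(1)[OF id] by blast
      show "0 \<in> \<Union> C" using \<open>C \<noteq> {}\<close> ideal_polyD(2)[OF id] by blast
      fix p assume "p \<in> \<Union> C"
      then obtain M where M: "M \<in> C" "p \<in> M" by blast
      {
        fix q assume "q \<in> \<Union> C"
        then obtain N where N: "N \<in> C" "q \<in> N" by blast
        have "M \<subseteq> N \<or> N \<subseteq> M" using M N \<open>subset.chain S C\<close> by (auto simp: subset_chain_def)
        then show "p + q \<in> \<Union> C" using M N ideal_polyD(3)[OF id] by blast
      }
      show "q * p \<in> \<Union> C" if "vars q \<subseteq> V" for q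
        using M that ideal_polyD(4)[OF id] by blast
      show "component d p \<in> \<Union> C" for d
        using M C(1)[OF M(1)] by (auto simp: homogeneous_ideal_iff)
    qed
    moreover have "A \<subseteq> \<Union> C" using C(2) \<open>C \<noteq> {}\<close> by blast
    ultimately show ?thesis using C(3) by (auto simp: S_def)
  qed
  ultimately obtain M where M: "M \<in> S" "\<And>X. X \<in> S \<Longrightarrow> M \<subseteq> X \<Longrightarrow> X = M"
    using subset_Zorn_nonempty[of S] by (metis (no_types, lifting))
  have hM: "homogeneous_ideal M V" and id: "ideal M (poly_ring V)"
    using M by (auto simp: S_def homogeneous_ideal_def)
  have power: "\<exists>n x q. w ^ n = x + q * a \<and> x \<in> M \<and> vars q \<subseteq> V"
    if "vars a \<subseteq> V" "homog e a" "a \<notin> M" for a e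
  proof -
    define N where "N = {x + q * a |x q. x \<in> M \<and> vars q \<subseteq> V}"
    have "x \<in> N" if "x \<in> M" for x
      using that unfolding N_def by (intro CollectI exI[of _ x] exI[of _ 0]) simp
    then have "M \<subseteq> N" by blast
    moreover have "a \<in> N"
      using ideal_polyD(2)[OF id] unfolding N_def by (intro CollectI exI[of _ 0] exI[of _ 1]) simp
    ultimately have "N \<notin> S" using M(2)[of N] that(3) by (metis (no_types, lifting))
    moreover have "homogeneous_ideal N V"
      using hM that unfolding N_def by (intro homogeneous_ideal_add_principal)
    moreover have "A \<subseteq> M" using M(1) by (simp add: S_def)
    then have "A \<subseteq> N" using \<open>M \<subseteq> N\<close> by (rule order_trans)
    ultimately have "\<exists>n. w ^ n \<in> N" unfolding S_def by blast
    then show ?thesis unfolding N_def by blast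
  qed
  have "primeideal M (poly_ring V)"
  proof (rule homogeneous_prime_test[OF hM])
    show "1 \<notin> M" using M(1) power_0[of w] unfolding S_def by (metis (mono_tags, lifting) mem_Collect_eq)
    fix a b d e
    assume ab: "vars a \<subseteq> V" "vars b \<subseteq> V" "homog d a" "homog e b" "a * b \<in> M"
    show "a \<in> M \<or> b \<in> M"
    proof (rule ccontr)
      assume "\<not> (a \<in> M \<or> b \<in> M)"
      then obtain n x q k y q' where
        nx: "w ^ n = x + q * a" "x \<in> M" "vars q \<subseteq> V" and
        ky: "w ^ k = y + q' * b" "y \<in> M" "vars q' \<subseteq> V"
        using power[OF ab(1,3)] power[OF ab(2,4)] by blast
      have "w ^ (n + k) = y * w ^ n + (q' * b) * x + (q * q') * (a * b)"
        by (simp add: power_add nx(1) ky(1) algebra_simps)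
      moreover have "vars (w ^ n) \<subseteq> V" "vars (q' * b) \<subseteq> V" "vars (q * q') \<subseteq> V"
        using nx(3) ky(3) ab(1,2) vars_power_subset[OF w(1), of n] by (simp_all add: vars_mult_subset)
      ultimately have "w ^ (n + k) \<in> M"
        using nx(2) ky(2) ab(5) by (simp add: ideal_polyD(3,4,5)[OF id] del: mult.assoc)
      then show False using M(1) by (auto simp: S_def)
    qed
  qed
  moreover have "w \<notin> M" using M(1) power_one_right[of w] unfolding S_def
    by (metis (mono_tags, lifting) mem_Collect_eq)
  ultimately show ?thesis using that hM M(1) by (auto simp: S_def)
qed

text \<open>
  The elements of the ideal all of whose components lie in it form an ideal, and this contains the
  generators.
\<close>

lemma homogeneous_genideal:
  assumes G: "G \<subseteq> {p. vars p \<subseteq> V}" "\<And>g d. g \<in> G \<Longrightarrow> component d g \<in> G"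
  shows "homogeneous_ideal (Idl\<^bsub>poly_ring V\<^esub> G) V"
proof -
  interpret cring "poly_ring V" by (rule cring_poly_ring)
  let ?J = "Idl\<^bsub>poly_ring V\<^esub> G"
  have G': "G \<subseteq> carrier (poly_ring V)" using G(1) by auto
  have id: "ideal ?J (poly_ring V)" by (rule genideal_ideal[OF G'])
  note idD = ideal_polyD[OF id]
  let ?T = "{p \<in> ?J. \<forall>d. component d p \<in> ?J}"
  have "ideal ?T (poly_ring V)"
    unfolding ideal_poly_ring_iff
  proof (intro conjI ballI allI impI)
    show "?T \<subseteq> {p. vars p \<subseteq> V}" "0 \<in> ?T" using idD(1,2) by auto
    fix p assume p: "p \<in> ?T"
    show "p + q \<in> ?T" if "q \<in> ?T" for q
      using p that idD(3) by (auto simp: component_add)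
    show "q * p \<in> ?T" if "vars q \<subseteq> V" for q
    proof -
      have "component d (q * p) \<in> ?J" for d
        unfolding component_mult[OF finite_imageI[OF finite_keys, of bdeg q] order_refl finite_imageI[OF finite_keys, of bdeg p] order_refl]
        using p that idD(2) by (intro ideal_poly_sum[OF id]) (simp add: idD(4) vars_component_subset)
      then show ?thesis using p that idD(4) by auto
    qed
  qed
  moreover have "G \<subseteq> ?T"
    using genideal_self[OF G'] G(2) by blast
  ultimately have "?J \<subseteq> ?T" by (rule genideal_minimal)
  then show ?thesis using id by (auto simp: homogeneous_ideal_iff)
qed

section \<open>The coordinate ring of the product\<close>

definition restrict_mon :: "pvar set \<Rightarrow> (pvar \<Rightarrow>\<^sub>0 nat) \<Rightarrow> pvar \<Rightarrow>\<^sub>0 nat" where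
  "restrict_mon V u = (\<Sum>v\<in>keys u \<inter> V. single v (lookup u v))"

lemma lookup_restrict_mon:
  "lookup (restrict_mon V u) v = (if v \<in> V then lookup u v else 0)"
proof -
  have "(\<Sum>w\<in>keys u \<inter> V. if w = v then lookup u w else 0) =
      (if v \<in> V then lookup u v else 0)"
    by (subst sum.delta) (auto simp: in_keys_iff)
  then show ?thesis
    unfolding restrict_mon_def lookup_sum lookup_single when_def .
qed

lemma restrict_mon_add: "restrict_mon V (u + v) = restrict_mon V u + restrict_mon V v"
  by (rule poly_mapping_eqI) (simp add: lookup_restrict_mon lookup_add)

lemma restrict_mon_split: "restrict_mon V u + restrict_mon (- V) u = u"
  by (rule poly_mapping_eqI) (simp add: lookup_restrict_mon lookup_add)

lemma keys_restrict_mon: "keys (restrict_mon V u) = keys u \<inter> V"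
  by (auto simp: in_keys_iff lookup_restrict_mon split: if_splits)

lemma restrict_mon_id: "keys u \<subseteq> V \<Longrightarrow> restrict_mon V u = u"
  by (rule poly_mapping_eqI) (auto simp: in_keys_iff lookup_restrict_mon)

lemma restrict_mon_disjoint: "keys u \<inter> V = {} \<Longrightarrow> restrict_mon V u = 0"
  by (rule poly_mapping_eqI) (auto simp: in_keys_iff lookup_restrict_mon)

text \<open>
  A scalar function \<open>\<rho>\<close> on the monomials in the variables outside \<open>V\<close>, extended linearly over the
  polynomial ring in the variables \<open>V\<close>.
\<close>

definition slice :: "pvar set \<Rightarrow> ((pvar \<Rightarrow>\<^sub>0 nat) \<Rightarrow> 'k::comm_ring_1) \<Rightarrow> 'k mpoly \<Rightarrow> 'k mpoly" where
  "slice V \<rho> p = (\<Sum>u\<in>keys p.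
     single (restrict_mon V u) (lookup p u * \<rho> (restrict_mon (- V) u)))"

lemma slice_superset:
  assumes "finite A" "keys p \<subseteq> A"
  shows "slice V \<rho> p = (\<Sum>u\<in>A.
     single (restrict_mon V u) (lookup p u * \<rho> (restrict_mon (- V) u)))"
  unfolding slice_def by (rule sum.mono_neutral_left) (use assms in \<open>auto simp: in_keys_iff\<close>)

lemma slice_zero [simp]: "slice V \<rho> 0 = 0"
  by (simp add: slice_def)

lemma slice_add: "slice V \<rho> (p + q) = slice V \<rho> p + slice V \<rho> q"
proof -
  let ?A = "keys p \<union> keys q"
  have "keys (p + q) \<subseteq> ?A" by (rule keys_add)
  then show ?thesis
    by (simp add: slice_superset[of ?A] lookup_add distrib_right single_add sum.distrib)
qed

lemma slice_single:
  "slice V \<rho> (single u c) = single (restrict_mon V u) (c * \<rho> (restrict_mon (- V) u))"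
  by (subst slice_superset[of "{u}"]) (auto split: if_splits)

lemma vars_slice: "vars (slice V \<rho> p) \<subseteq> V"
  unfolding slice_def by (intro vars_sum_subset vars_single_subset) (simp add: keys_restrict_mon)

lemma slice_mult_left:
  assumes "vars q \<subseteq> V" shows "slice V \<rho> (q * p) = q * slice V \<rho> p"
proof (induction q rule: mpoly_monomial_induct)
  case (monomial u c)
  then have u: "keys u \<subseteq> V" using assms by (auto simp: vars_def)
  then have "restrict_mon V u = u" "restrict_mon (- V) u = 0"
    by (auto simp: restrict_mon_id intro: restrict_mon_disjoint)
  then show ?case
    by (induction p rule: mpoly_monomial_induct)
      (simp_all add: mult_single slice_single restrict_mon_add slice_add algebra_simps)
qed (simp_all add: slice_add distrib_right)

lemma generators_subset_carrier:
  assumes "\<And>l. l < m \<Longrightarrow> \<aa> l \<subseteq> {p. vars p \<subseteq> xvars_of r l}"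
  shows "(\<Union>l<m. \<aa> l) \<subseteq> carrier (poly_ring (xvars m r))"
proof
  fix g assume "g \<in> (\<Union>l<m. \<aa> l)"
  then obtain l where "l < m" "g \<in> \<aa> l" by blast
  then have "vars g \<subseteq> xvars_of r l" using assms[of l] by blast
  then show "g \<in> carrier (poly_ring (xvars m r))" using \<open>l < m\<close> by (auto simp: xvars_def)
qed

lemma subset_prod_ideal:
  fixes \<aa> :: "nat \<Rightarrow> 'k::comm_ring_1 mpoly set"
  assumes "\<And>l. l < m \<Longrightarrow> \<aa> l \<subseteq> {p. vars p \<subseteq> xvars_of r l}" "i < m"
  shows "\<aa> i \<subseteq> prod_ideal m r \<aa>"
proof -
  interpret R: cring "poly_ring (xvars m r) :: 'k mpoly ring" by (rule cring_poly_ring)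
  show ?thesis
    using R.genideal_self[OF generators_subset_carrier] assms unfolding prod_ideal_def by blast
qed

text \<open>
  A nonzero element of a factor \<open>A\<^sub>i\<close> is a nonzerodivisor on the tensor product, because the
  tensor product is free over \<open>A\<^sub>i\<close>: a basis of the other factors over the field is a basis over
  \<open>A\<^sub>i\<close>. Here the other factors are represented by the polynomials in the other variables modulo
  \<open>W\<close>, a basis is a set of polynomials in these variables that extends a basis of \<open>W\<close> to one of
  all of them, and \<open>slice\<close> with the coordinate functions of the basis computes the coefficients.
\<close>

lemma nonzerodivisor_prod_ideal:
  fixes \<aa> :: "nat \<Rightarrow> 'k::field mpoly set"
  assumes prime: "\<And>i. i < m \<Longrightarrow> primeideal (\<aa> i) (poly_ring (xvars_of r i))"
    and i: "i < m" and x: "vars x \<subseteq> xvars_of r i" "x \<notin> \<aa> i"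
    and p: "vars p \<subseteq> xvars m r" and xp: "x * p \<in> prod_ideal m r \<aa>"
  shows "p \<in> prod_ideal m r \<aa>"
proof -
  define V where "V = xvars m r"
  define U where "U = xvars_of r i"
  define J where "J = prod_ideal m r \<aa>"
  interpret R: cring "poly_ring V :: 'k mpoly ring" by (rule cring_poly_ring)
  interpret vs: vector_space "\<lambda>c (p::'k mpoly). Const c * p"
    by unfold_locales
      (simp_all add: distrib_left distrib_right Const_def single_add mult_single mult.assoc[symmetric])
  have "U \<subseteq> V" using i by (auto simp: U_def V_def xvars_def)
  have id\<aa>: "ideal (\<aa> l) (poly_ring (xvars_of r l))" if "l < m" for l
    using prime[OF that] by (rule primeideal_polyD)
  have v\<aa>: "\<aa> l \<subseteq> {p. vars p \<subseteq> xvars_of r l}" if "l < m" for l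
    using ideal_polyD(1)[OF id\<aa>[OF that]] by blast
  have gens: "(\<Union>l<m. \<aa> l) \<subseteq> carrier (poly_ring V)"
    unfolding V_def using v\<aa> by (rule generators_subset_carrier)
  have idJ: "ideal J (poly_ring V)"
    unfolding J_def prod_ideal_def V_def[symmetric] by (rule R.genideal_ideal[OF gens])
  have \<aa>J: "\<aa> l \<subseteq> J" if "l < m" for l
    unfolding J_def using v\<aa> that by (rule subset_prod_ideal)
  define W where "W = {q \<in> J. vars q \<subseteq> V - U}"
  obtain B0 where B0: "B0 \<subseteq> W" "vs.independent B0" "W \<subseteq> vs.span B0"
    using vs.maximal_independent_subset[of W] by blast
  have "B0 \<subseteq> {q. vars q \<subseteq> V - U}" using B0(1) by (auto simp: W_def)
  then obtain B where B: "B0 \<subseteq> B" "B \<subseteq> {q. vars q \<subseteq> V - U}" "vs.independent B"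
      "{q. vars q \<subseteq> V - U} \<subseteq> vs.span B"
    by (rule vs.maximal_independent_subset_extend[OF _ B0(2)])
  define \<rho> where "\<rho> b u = vs.representation B (single u 1) b" for b u
  have mon_span: "single u 1 \<in> vs.span B" if "keys u \<subseteq> V - U" for u
    using B(4) vars_single_subset[OF that, of 1] by blast
  have rep: "slice U (\<rho> b) q = Const (vs.representation B q b)" if q: "vars q \<subseteq> V - U" for q b
  proof -
    have keys: "keys u \<subseteq> V - U" if "u \<in> keys q" for u
      using that q by (auto simp: vars_def)
    have "restrict_mon U u = 0" "restrict_mon (- U) u = u" if "u \<in> keys q" for u
      using keys[OF that] by (blast intro: restrict_mon_disjoint restrict_mon_id)+
    then have "slice U (\<rho> b) q = (\<Sum>u\<in>keys q. Const (lookup q u * \<rho> b u))"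
      by (simp add: slice_def Const_def)
    also have "\<dots> = Const (\<Sum>u\<in>keys q. lookup q u * \<rho> b u)"
      unfolding Const_def by (induction rule: finite_induct[OF finite_keys]) (simp_all add: single_add)
    also have "(\<Sum>u\<in>keys q. lookup q u * \<rho> b u) = vs.representation B
        (\<Sum>u\<in>keys q. Const (lookup q u) * single u 1) b"
      using keys B(3) mon_span
      by (subst vs.representation_sum) (auto intro!: vs.span_scale sum.cong simp: \<rho>_def vs.representation_scale)
    also have "(\<Sum>u\<in>keys q. Const (lookup q u) * single u 1) = q"
      using mpoly_eq_sum_monomials[of q] by (simp add: single_eq_Const_mult[symmetric])
    finally show ?thesis .
  qed
  have idW: "slice U (\<rho> b) q = 0" if "q \<in> W" "b \<notin> B0" for q b
  proof -
    have "q \<in> vs.span B0" using that B0 by blast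
    then have "vs.representation B q = vs.representation B0 q"
      by (rule vs.representation_extend[OF B(3) _ B(1)])
    moreover have "vs.representation B0 q b = 0"
      using vs.representation_ne_zero[of B0 q b] that by blast
    ultimately show ?thesis using rep[of q b] that by (simp add: W_def Const_def)
  qed
  \<comment> \<open>It suffices to consider multiples of generators of \<open>J\<close>. For a generator from the factor \<open>i\<close> the
    coefficients are multiples of it; for one from another factor the multiples by monomials in the
    other variables lie in \<open>W\<close> and have no coordinates outside \<open>B0\<close>.\<close>
  have slice_J: "slice U (\<rho> b) q \<in> \<aa> i" if "q \<in> J" "b \<notin> B0" for q b
  proof -
    let ?T = "{p. vars p \<subseteq> V \<and> (\<forall>q. vars q \<subseteq> V \<longrightarrow> slice U (\<rho> b) (q * p) \<in> \<aa> i)}"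
    have "ideal ?T (poly_ring V)"
      unfolding ideal_poly_ring_iff
      using ideal_polyD[OF id\<aa>[OF i]]
      by (auto simp: vars_add_subset vars_mult_subset distrib_left slice_add mult.assoc[symmetric])
    moreover have "g \<in> ?T" if g: "l < m" "g \<in> \<aa> l" for l g
    proof -
      have "slice U (\<rho> b) (q * g) \<in> \<aa> i" if q: "vars q \<subseteq> V" for q
      proof (cases "l = i")
        case True
        then have "vars g \<subseteq> U" using g ideal_polyD(1)[OF id\<aa>] by (auto simp: U_def)
        then have "slice U (\<rho> b) (q * g) = slice U (\<rho> b) q * g"
          using slice_mult_left[of g U "\<rho> b" q] by (simp add: mult.commute)
        then show ?thesis
          using ideal_polyD(4)[OF id\<aa>[OF i], of g "slice U (\<rho> b) q"] g True vars_slice[of U "\<rho> b" q]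
          by (simp add: U_def)
      next
        case False
        have "vars g \<subseteq> xvars_of r l" using g ideal_polyD(1)[OF id\<aa>] by blast
        moreover have "xvars_of r l \<subseteq> V - U"
          using False g(1) by (auto simp: V_def U_def xvars_def xvars_of_def)
        ultimately have gv: "vars g \<subseteq> V - U" by blast
        have "slice U (\<rho> b) (q * g) = 0"
        proof (induction q rule: mpoly_monomial_induct)
          case (monomial u c)
          let ?u = "restrict_mon U u" and ?w = "restrict_mon (- U) u"
          have "keys u \<subseteq> V" using q monomial by (auto simp: vars_def)
          then have keys: "keys ?w \<subseteq> V - U" by (auto simp: keys_restrict_mon)
          have "single u c = single ?u c * single ?w 1"
            by (simp add: mult_single restrict_mon_split)
          then have slice: "slice U (\<rho> b) (single u c * g) =
              single ?u c * slice U (\<rho> b) (single ?w 1 * g)"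
            by (simp add: mult.assoc slice_mult_left vars_single_subset keys_restrict_mon)
          have "vars (single ?w 1 * g) \<subseteq> V - U"
            using keys gv by (intro vars_mult_subset vars_single_subset)
          moreover have "single ?w 1 * g \<in> J"
            using keys g \<aa>J by (intro ideal_polyD(4)[OF idJ] vars_single_subset) auto
          ultimately have "single ?w 1 * g \<in> W" by (simp add: W_def)
          then have "slice U (\<rho> b) (single ?w 1 * g) = 0"
            by (rule idW) fact
          with slice show ?case by simp
        qed (simp_all add: slice_add distrib_right)
        then show ?thesis using ideal_polyD(2)[OF id\<aa>[OF i]] by simp
      qed
      moreover have "g \<in> carrier (poly_ring V)" using gens g by blast
      ultimately show ?thesis by simp
    qed
    then have "(\<Union>l<m. \<aa> l) \<subseteq> ?T" by blast
    ultimately have "J \<subseteq> ?T"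
      unfolding J_def prod_ideal_def V_def[symmetric] by (rule R.genideal_minimal)
    then have "slice U (\<rho> b) (1 * q) \<in> \<aa> i" using \<open>q \<in> J\<close> by (auto simp del: mult_1)
    then show ?thesis by simp
  qed
  have coeff: "slice U (\<rho> b) p \<in> \<aa> i" if "b \<notin> B0" for b
  proof -
    have "x * slice U (\<rho> b) p \<in> \<aa> i"
      using slice_J[OF xp[folded J_def] that] slice_mult_left[of x U "\<rho> b" p] x(1) by (simp add: U_def)
    then show ?thesis
      using primeideal_polyD(3)[OF prime[OF i], of x "slice U (\<rho> b) p"] x vars_slice[of U "\<rho> b" p]
      by (auto simp: U_def)
  qed
  let ?K = "keys p"
  define F where "F = (\<Union>u\<in>?K. {b. \<rho> b (restrict_mon (- U) u) \<noteq> 0})"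
  have finF: "finite F"
    unfolding F_def \<rho>_def by (intro finite_UN_I finite_keys vs.finite_representation)
  have FB: "F \<subseteq> B"
    unfolding F_def \<rho>_def using vs.representation_ne_zero by blast
  have expand: "single (restrict_mon (- U) u) 1 = (\<Sum>b\<in>F. Const (\<rho> b (restrict_mon (- U) u)) * b)"
    if u: "u \<in> ?K" for u
  proof -
    have "keys u \<subseteq> V" using p u by (auto simp: vars_def V_def)
    then have "keys (restrict_mon (- U) u) \<subseteq> V - U"
      by (auto simp: keys_restrict_mon)
    then have "single (restrict_mon (- U) u) 1 =
        (\<Sum>b | \<rho> b (restrict_mon (- U) u) \<noteq> 0. Const (\<rho> b (restrict_mon (- U) u)) * b)"
      using vs.sum_nonzero_representation_eq[OF B(3) mon_span] by (simp add: \<rho>_def)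
    also have "\<dots> = (\<Sum>b\<in>F. Const (\<rho> b (restrict_mon (- U) u)) * b)"
      by (rule sum.mono_neutral_left[OF finF]) (use u in \<open>auto simp: F_def Const_def\<close>)
    finally show ?thesis .
  qed
  have "p = (\<Sum>u\<in>?K. single (restrict_mon U u) (lookup p u) *
      single (restrict_mon (- U) u) 1)"
    using mpoly_eq_sum_monomials[of p] by (simp add: mult_single restrict_mon_split)
  also have "\<dots> = (\<Sum>u\<in>?K. \<Sum>b\<in>F. single (restrict_mon U u) (lookup p u) *
      (Const (\<rho> b (restrict_mon (- U) u)) * b))"
    by (rule sum.cong) (simp_all add: expand sum_distrib_left)
  also have "\<dots> = (\<Sum>b\<in>F. slice U (\<rho> b) p * b)"
    unfolding slice_def sum_distrib_right
    by (subst sum.swap) (simp add: Const_def mult_single mult.assoc[symmetric])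
  finally have p_eq: "p = (\<Sum>b\<in>F. slice U (\<rho> b) p * b)" .
  have "slice U (\<rho> b) p * b \<in> J" if "b \<in> F" for b
  proof (cases "b \<in> B0")
    case True
    then show ?thesis
      using B0(1) vars_slice[of U "\<rho> b" p] \<open>U \<subseteq> V\<close> by (auto simp: W_def intro!: ideal_polyD(4)[OF idJ])
  next
    case False
    then show ?thesis
      using coeff[OF False] \<aa>J[OF i] FB B(2) that by (auto intro!: ideal_polyD(5)[OF idJ])
  qed
  then have "(\<Sum>b\<in>F. slice U (\<rho> b) p * b) \<in> J"
    by (rule ideal_poly_sum[OF idJ])
  then show ?thesis using p_eq by (simp add: J_def)
qed

lemma Var_power_eq: "Var v ^ n = single (single v n) (1::'k::comm_ring_1)"
  using mon_eval_single[of Var v n] mon_eval_Var[of "single v n", where 'k = 'k] by simp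

lemma homog_Var_power:
  "homog (single (block v) n) (Var v ^ n)"
  unfolding Var_power_eq by (rule homog_single) simp

lemma homogeneous_ideal_prod_ideal:
  assumes "\<And>i. i < m \<Longrightarrow> homogeneous_ideal (\<aa> i) (xvars_of r i)"
  shows "homogeneous_ideal (prod_ideal m r \<aa>) (xvars m r)"
  unfolding prod_ideal_def
proof (rule homogeneous_genideal)
  have "(\<Union>i<m. \<aa> i) \<subseteq> carrier (poly_ring (xvars m r))"
  proof (rule generators_subset_carrier)
    fix l assume "l < m"
    then show "\<aa> l \<subseteq> {p. vars p \<subseteq> xvars_of r l}"
      using assms[of l] ideal_polyD(1) unfolding homogeneous_ideal_def by blast
  qed
  then show "(\<Union>i<m. \<aa> i) \<subseteq> {p. vars p \<subseteq> xvars m r}" by (simp add: poly_ring_def)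
  show "component d g \<in> (\<Union>i<m. \<aa> i)" if "g \<in> (\<Union>i<m. \<aa> i)" for g d
    using that assms by (auto simp: homogeneous_ideal_iff)
qed

lemma bdeg_xvars_support:
  assumes "keys u \<subseteq> xvars m r"
  shows "bdeg u = (\<Sum>i<m. single (Suc i) (lookup (bdeg u) (Suc i)))"
proof (rule poly_mapping_eqI)
  fix n
  have "\<exists>i<m. n = Suc i" if "lookup (bdeg u) n \<noteq> 0"
  proof -
    from that obtain v where "v \<in> keys u"
        "lookup (single (block v) (lookup u v)) n \<noteq> 0"
      unfolding bdeg_def lookup_sum by (rule sum.not_neutral_contains_not_neutral)
    then have "v \<in> keys u" "block v = n"
      by (auto simp: lookup_single when_def split: if_splits)
    then show ?thesis using assms by (auto simp: xvars_def xvars_of_def)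
  qed
  then show "lookup (bdeg u) n = lookup
      (\<Sum>i<m. single (Suc i) (lookup (bdeg u) (Suc i))) n"
    by (cases n) (auto simp: lookup_sum lookup_single when_def)
qed

text \<open>
  Integrality of the product as a scheme is a statement on its coordinate ring up to torsion for the
  irrelevant ideals of the factors. There is no such torsion, since nonzero coordinates are
  nonzerodivisors; so the coordinate ring itself is a domain.
\<close>

lemma prime_prod_ideal:
  fixes \<aa> :: "nat \<Rightarrow> 'k::field mpoly set"
  assumes var: "\<And>i. i < m \<Longrightarrow> integral_projective_variety (xvars_of r i) (\<aa> i)"
    and int: "integral_scheme m r (prod_ideal m r \<aa>)"
  shows "primeideal (prod_ideal m r \<aa>) (poly_ring (xvars m r))"
    and "\<forall>i<m. \<exists>j\<le>r i. Var (XVar i j) \<notin> prod_ideal m r \<aa>"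
proof -
  define V where "V = xvars m r"
  define J where "J = prod_ideal m r \<aa>"
  define MP where "MP = multiproj m r J"
  have hJ: "homogeneous_ideal J V"
    unfolding J_def V_def using var
    by (intro homogeneous_ideal_prod_ideal) (simp add: integral_projective_variety_def)
  then have idJ: "ideal J (poly_ring V)" by (simp add: homogeneous_ideal_def)
  obtain P0 where P0: "P0 \<in> MP"
    using int unfolding integral_scheme_def irreducible_scheme_def J_def MP_def by blast
  have MP_D: "primeideal P (poly_ring V)" "homogeneous_ideal P V" "J \<subseteq> P"
      "i < m \<Longrightarrow> \<exists>j\<le>r i. Var (XVar i j) \<notin> P" if "P \<in> MP" for P i
    using that unfolding MP_def multiproj_def V_def by auto
  show "\<forall>i<m. \<exists>j\<le>r i. Var (XVar i j) \<notin> prod_ideal m r \<aa>"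
    using MP_D(3,4)[OF P0] unfolding J_def by blast
  then obtain jj where jj: "jj i \<le> r i" "Var (XVar i (jj i)) \<notin> J" if "i < m" for i
    unfolding J_def by metis
  have xV: "vars (Var (XVar i j) :: 'k mpoly) \<subseteq> V" if "i < m" "j \<le> r i" for i j
    using that by (auto simp: V_def xvars_def xvars_of_def)
  have \<aa>J: "\<aa> i \<subseteq> J" if "i < m" for i
    unfolding J_def
  proof (rule subset_prod_ideal[OF _ that])
    fix l assume "l < m"
    then have "ideal (\<aa> l) (poly_ring (xvars_of r l))"
      using var by (simp add: integral_projective_variety_def homogeneous_ideal_def)
    then show "\<aa> l \<subseteq> {p. vars p \<subseteq> xvars_of r l}" using ideal_polyD(1) by blast
  qed
  \<comment> \<open>A nonzerodivisor, and a homogeneous prime over \<open>J\<close> that does not contain it is a point.\<close>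
  define X :: "'k mpoly" where "X = (\<Prod>i<m. Var (XVar i (jj i)))"
  have XV: "vars X \<subseteq> V" unfolding X_def using xV jj(1) by (intro vars_prod_subset) simp
  have cancel1: "p \<in> J" if "i < m" "vars p \<subseteq> V" "Var (XVar i (jj i)) * p \<in> J" for i p
    unfolding J_def
  proof (rule nonzerodivisor_prod_ideal)
    show "primeideal (\<aa> i) (poly_ring (xvars_of r i))" if "i < m" for i
      using var[OF that] by (simp add: integral_projective_variety_def)
    show "Var (XVar i (jj i)) \<notin> \<aa> i" using jj(2) \<aa>J that(1) by blast
    show "vars (Var (XVar i (jj i)) :: 'k mpoly) \<subseteq> xvars_of r i"
      using jj(1) that(1) by (auto simp: xvars_of_def)
  qed (use that in \<open>auto simp: J_def V_def\<close>)
  have "(\<Prod>i\<in>A. Var (XVar i (jj i))) * p \<in> J \<Longrightarrow> p \<in> J" if "A \<subseteq> {..<m}" "vars p \<subseteq> V" for A p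
    using finite_subset[OF that(1) finite_lessThan] that
  proof (induction A)
    case (insert i A)
    have "vars (\<Prod>i\<in>A. Var (XVar i (jj i)) :: 'k mpoly) \<subseteq> V"
      using insert.prems xV jj(1) by (intro vars_prod_subset) auto
    then show ?case
      using insert cancel1[of i "(\<Prod>i\<in>A. Var (XVar i (jj i))) * p"]
      by (simp add: mult.assoc vars_mult_subset)
  qed simp
  then have cancelX: "X * p \<in> J \<Longrightarrow> p \<in> J" if "vars p \<subseteq> V" for p
    using that unfolding X_def by blast
  have cancel: "X ^ n * p \<in> J \<Longrightarrow> p \<in> J" if "vars p \<subseteq> V" for n p
  proof (induction n)
    case (Suc n)
    then show ?case
      using cancelX[of "X ^ n * p"] that XV by (simp add: mult.assoc vars_mult_subset vars_power_subset)
  qed simp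
  have XP: "P \<in> MP" if "primeideal P (poly_ring V)" "homogeneous_ideal P V" "J \<subseteq> P" "X \<notin> P" for P
  proof -
    have id: "ideal P (poly_ring V)" using that(1) by (rule primeideal_polyD)
    have "Var (XVar i (jj i)) \<notin> P" if "i < m" for i
    proof
      assume *: "Var (XVar i (jj i)) \<in> P"
      have "X = Var (XVar i (jj i)) * (\<Prod>l\<in>{..<m} - {i}. Var (XVar l (jj l)))"
        unfolding X_def using that by (intro prod.remove) auto
      also have "vars (\<Prod>l\<in>{..<m} - {i}. Var (XVar l (jj l)) :: 'k mpoly) \<subseteq> V"
        using xV jj(1) by (intro vars_prod_subset) auto
      then have "Var (XVar i (jj i)) * (\<Prod>l\<in>{..<m} - {i}. Var (XVar l (jj l))) \<in> P"
        using * by (intro ideal_polyD(5)[OF id])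
      finally show False using \<open>X \<notin> P\<close> by simp
    qed
    then show ?thesis using that jj(1) unfolding MP_def multiproj_def V_def by auto
  qed
  have irrelevant: "\<exists>n. X ^ n \<in> A"
    if A: "homogeneous_ideal A V" "J \<subseteq> A" "\<And>P. P \<in> MP \<Longrightarrow> \<not> A \<subseteq> P" for A
  proof (rule ccontr)
    assume "\<nexists>n. X ^ n \<in> A"
    then obtain P where "primeideal P (poly_ring V)" "homogeneous_ideal P V" "A \<subseteq> P" "X \<notin> P"
      using exists_homogeneous_prime_avoiding[OF A(1) XV] by metis
    then show False using XP A(2,3) by blast
  qed
  \<comment> \<open>A form \<open>u\<close> that vanishes at all points is nilpotent, since otherwise some point would avoid
    the powers of \<open>u X\<close>. As the local rings are reduced, \<open>u\<close> is zero in all of them, so no point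
    contains the annihilator of \<open>u\<close>. Hence this contains a power of \<open>X\<close>.\<close>
  have vanishing: "u \<in> J" if u: "vars u \<subseteq> V" "homog d u" "\<And>P. P \<in> MP \<Longrightarrow> u \<in> P" for u d
  proof (cases "u = 0")
    case True
    then show ?thesis using ideal_polyD(2)[OF idJ] by simp
  next
    case False
    have "\<exists>n. (u * X) ^ n \<in> J"
    proof (rule ccontr)
      assume "\<nexists>n. (u * X) ^ n \<in> J"
      then obtain P where P: "primeideal P (poly_ring V)" "homogeneous_ideal P V" "J \<subseteq> P" "u * X \<notin> P"
        using exists_homogeneous_prime_avoiding[OF hJ vars_mult_subset[OF u(1) XV]] by metis
      note id = primeideal_polyD(1)[OF P(1)]
      have "X \<notin> P" "u \<notin> P"
        using P(4) ideal_polyD(4)[OF id _ u(1), of X] ideal_polyD(5)[OF id _ XV, of u] by blast+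
      then show False using u(3) XP[OF P(1-3)] by blast
    qed
    then obtain n where "(u * X) ^ n \<in> J" by blast
    then have un: "u ^ n \<in> J"
      using cancel[of "u ^ n" n] vars_power_subset[OF u(1)] by (simp add: power_mult_distrib mult.commute)
    define A where "A = {w. vars w \<subseteq> V \<and> w * u \<in> J}"
    have "homogeneous_ideal A V"
      unfolding homogeneous_ideal_iff ideal_poly_ring_iff
    proof (intro conjI ballI allI impI)
      fix p assume p: "p \<in> A"
      show "p + q \<in> A" if "q \<in> A" for q
        using p that by (simp add: A_def distrib_right vars_add_subset ideal_polyD[OF idJ])
      show "q * p \<in> A" if "vars q \<subseteq> V" for q
        using p that by (simp add: A_def mult.assoc vars_mult_subset ideal_polyD[OF idJ])
      show "component c p \<in> A" for c
      proof -
        let ?D = "insert c (bdeg ` keys p)"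
        have "component (c + d) (p * u) =
            (\<Sum>d'\<in>?D. \<Sum>e'\<in>{d}. if c + d = d' + e' then component d' p * component e' u else 0)"
          by (rule component_mult) (use u(2) in \<open>auto simp: homog_def\<close>)
        also have "\<dots> = (\<Sum>d'\<in>?D. if d' = c then component d' p * u else 0)"
          using component_homog[OF u(2)] by (intro sum.cong) auto
        also have "\<dots> = component c p * u" by (subst sum.delta) auto
        finally have "component c p * u = component (c + d) (p * u)" by simp
        then show ?thesis using p hJ by (simp add: A_def homogeneous_ideal_iff vars_component_subset)
      qed
    qed (auto simp: A_def ideal_polyD[OF idJ])
    moreover have "J \<subseteq> A"
    proof
      fix p assume "p \<in> J"
      then show "p \<in> A"
        using ideal_polyD(1)[OF idJ] ideal_polyD(5)[OF idJ _ u(1)] by (simp add: A_def)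
    qed
    moreover have "\<not> A \<subseteq> P" if P: "P \<in> MP" for P
    proof -
      obtain j where j: "j i \<le> r i" "Var (XVar i (j i)) \<notin> P" if "i < m" for i
        using MP_D(4)[OF P] by metis
      define t :: "'k mpoly" where "t = (\<Prod>i<m. Var (XVar i (j i)) ^ lookup d (Suc i))"
      have xp: "Var (XVar i (j i)) ^ e \<notin> P" if "i < m" for i e
        using primeideal_poly_prod[OF MP_D(1)[OF P], of "{..<e}" "\<lambda>_. Var (XVar i (j i))"] j[OF that]
          xV[OF that, of "j i"] by simp
      have "t \<notin> P"
        unfolding t_def using xp xV j
        by (intro primeideal_poly_prod[OF MP_D(1)[OF P]]) (simp add: vars_power_subset)
      moreover have tV: "vars t \<subseteq> V"
        unfolding t_def using xV j by (intro vars_prod_subset) (simp add: vars_power_subset)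
      moreover have "homog d t"
      proof -
        obtain w where "w \<in> keys u" using False keys_eq_empty by blast
        then have "bdeg w = d" "keys w \<subseteq> xvars m r"
          using u(1,2) by (auto simp: homog_def vars_def V_def)
        then have d: "d = (\<Sum>i<m. single (Suc i) (lookup d (Suc i)))"
          using bdeg_xvars_support by blast
        have "homog (\<Sum>i<m. single (block (XVar i (j i))) (lookup d (Suc i))) t"
          unfolding t_def by (intro homog_prod homog_Var_power)
        then show ?thesis using d by simp
      qed
      moreover have "zero_at m r J P (u ^ n)"
        unfolding zero_at_def
      proof (intro bexI conjI exI)
        show "homogeneous (bdeg_pair 0) (1 :: 'k mpoly)"
          by (simp add: homogeneous_bdeg_pair homog_one)
        show "1 \<notin> P" using MP_D(1)[OF P] by (rule primeideal_polyD)
      qed (use un in simp_all)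
      ultimately have "zero_at m r J P u"
        using int P u(1,2) unfolding integral_scheme_def reduced_scheme_def J_def[symmetric] MP_def V_def
        by (metis homogeneous_bdeg_pair poly_ring_simps(1))
      then obtain w where "vars w \<subseteq> V" "w \<notin> P" "w * u \<in> J"
        unfolding zero_at_def V_def by auto
      then have "w \<in> A" by (simp add: A_def)
      then show ?thesis using \<open>w \<notin> P\<close> by blast
    qed
    ultimately obtain n where "X ^ n \<in> A" using irrelevant by blast
    then show ?thesis using cancel[OF u(1)] by (auto simp: A_def)
  qed
  show "primeideal (prod_ideal m r \<aa>) (poly_ring (xvars m r))"
    unfolding J_def[symmetric] V_def[symmetric]
  proof (rule homogeneous_prime_test[OF hJ])
    show "1 \<notin> J" using MP_D(1,3)[OF P0] primeideal_polyD(2) by blast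
    fix a b d e
    assume ab: "vars a \<subseteq> V" "vars b \<subseteq> V" "homog d a" "homog e b" "a * b \<in> J"
    show "a \<in> J \<or> b \<in> J"
    proof (rule ccontr)
      assume "\<not> (a \<in> J \<or> b \<in> J)"
      then have "\<exists>P\<in>MP. a \<notin> P" "\<exists>P\<in>MP. b \<notin> P"
        using vanishing[OF ab(1,3)] vanishing[OF ab(2,4)] by blast+
      moreover have "homogeneous (bdeg_pair d) a" "homogeneous (bdeg_pair e) b"
        using ab by (simp_all add: homogeneous_bdeg_pair)
      moreover have "\<forall>u\<in>carrier (poly_ring V). \<forall>v\<in>carrier (poly_ring V). \<forall>\<delta> \<epsilon>.
          homogeneous \<delta> u \<and> homogeneous \<epsilon> v \<and> (\<exists>P\<in>MP. u \<notin> P) \<and> (\<exists>P\<in>MP. v \<notin> P) \<longrightarrow>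
          (\<exists>P\<in>MP. u \<notin> P \<and> v \<notin> P)"
        using int unfolding integral_scheme_def irreducible_scheme_def J_def MP_def V_def by blast
      ultimately have "\<exists>P\<in>MP. a \<notin> P \<and> b \<notin> P"
        using ab(1,2) by (meson poly_ring_simps(1))
      then obtain P where P: "P \<in> MP" "a \<notin> P" "b \<notin> P" by blast
      have "a * b \<in> P" using ab(5) MP_D(3)[OF P(1)] by blast
      then show False using primeideal_polyD(3)[OF MP_D(1)[OF P(1)] ab(1,2)] P(2,3) by blast
    qed
  qed
qed

section \<open>Linear algebra modulo a prime ideal\<close>

text \<open>
  Ideals of the whole ring of a type, in contrast to ideals of the polynomial rings in some of the
  variables: computations modulo them do not have to keep track of the variables that occur.
\<close>

locale full_ideal =
  fixes P :: "'a::comm_ring_1 set"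
  assumes zero_mem: "0 \<in> P"
    and add_mem: "p \<in> P \<Longrightarrow> q \<in> P \<Longrightarrow> p + q \<in> P"
    and mult_mem: "p \<in> P \<Longrightarrow> q * p \<in> P"
begin

lemma mult_mem': "p \<in> P \<Longrightarrow> p * q \<in> P"
  using mult_mem[of p q] by (simp add: mult.commute)

lemma uminus_mem: "p \<in> P \<Longrightarrow> - p \<in> P"
  using mult_mem[of p "- 1"] by simp

lemma diff_mem: "p \<in> P \<Longrightarrow> q \<in> P \<Longrightarrow> p - q \<in> P"
  using add_mem[of p "- q"] uminus_mem[of q] by simp

lemma diff_mem_iff: "p - q \<in> P \<Longrightarrow> p \<in> P \<longleftrightarrow> q \<in> P"
  using add_mem[of "p - q" q] diff_mem[of p "p - q"] by auto

lemma sum_mem: "(\<And>a. a \<in> A \<Longrightarrow> p a \<in> P) \<Longrightarrow> sum p A \<in> P"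
  by (induction A rule: infinite_finite_induct) (auto simp: zero_mem add_mem)

lemma sum_diff_mem: "(\<And>a. a \<in> A \<Longrightarrow> p a - q a \<in> P) \<Longrightarrow> sum p A - sum q A \<in> P"
  using sum_mem[of A "\<lambda>a. p a - q a"] by (simp add: sum_subtractf)

lemma mult_diff_mem:
  assumes "p - p' \<in> P" "q - q' \<in> P" shows "p * q - p' * q' \<in> P"
proof -
  have "p * q - p' * q' = (p - p') * q + p' * (q - q')" by (simp add: algebra_simps)
  then show ?thesis using assms by (simp add: add_mem mult_mem mult_mem')
qed

lemma prod_diff_mem: "(\<And>a. a \<in> A \<Longrightarrow> p a - q a \<in> P) \<Longrightarrow> prod p A - prod q A \<in> P"
  by (induction A rule: infinite_finite_induct) (auto simp: zero_mem mult_diff_mem)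

lemma power_diff_mem: "p - q \<in> P \<Longrightarrow> p ^ n - q ^ n \<in> P"
  using prod_diff_mem[of "{..<n}" "\<lambda>_. p" "\<lambda>_. q"] by simp

end

locale full_prime = full_ideal P for P :: "'a::comm_ring_1 set" +
  assumes one_not_mem: "1 \<notin> P"
    and prime: "p * q \<in> P \<Longrightarrow> p \<in> P \<or> q \<in> P"
begin

lemma prod_not_mem: "(\<And>a. a \<in> A \<Longrightarrow> p a \<notin> P) \<Longrightarrow> prod p A \<notin> P"
  by (induction A rule: infinite_finite_induct) (auto simp: one_not_mem dest: prime)

lemma power_not_mem: "p \<notin> P \<Longrightarrow> p ^ n \<notin> P"
  using prod_not_mem[of "{..<n}" "\<lambda>_. p"] by simp

end

text \<open>
  The rows \<open>v a\<close>, \<open>a \<in> I\<close>, with columns indexed by \<open>B\<close>, are linearly independent over the quotient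
  by \<open>P\<close>; for a prime \<open>P\<close> this is independence over the fraction field of the quotient.
\<close>

definition indep_mod :: "'a::comm_ring_1 set \<Rightarrow> 'b set \<Rightarrow> 'i set \<Rightarrow> ('i \<Rightarrow> 'b \<Rightarrow> 'a) \<Rightarrow> bool" where
  "indep_mod P B I v \<longleftrightarrow> (\<forall>c. (\<forall>b\<in>B. (\<Sum>a\<in>I. c a * v a b) \<in> P) \<longrightarrow> (\<forall>a\<in>I. c a \<in> P))"

lemma indep_modD:
  "indep_mod P B I v \<Longrightarrow> (\<And>b. b \<in> B \<Longrightarrow> (\<Sum>a\<in>I. c a * v a b) \<in> P) \<Longrightarrow> a \<in> I \<Longrightarrow> c a \<in> P"
  by (auto simp: indep_mod_def)

lemma indep_mod_empty [simp]: "indep_mod P B {} v"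
  by (simp add: indep_mod_def)

lemma indep_mod_cong:
  "(\<And>a b. a \<in> I \<Longrightarrow> b \<in> B \<Longrightarrow> v a b = w a b) \<Longrightarrow> indep_mod P B I v \<longleftrightarrow> indep_mod P B I w"
  by (simp add: indep_mod_def cong: sum.cong)

lemma indep_mod_reindex_rows:
  assumes "bij_betw f I I'"
  shows "indep_mod P B I' v \<longleftrightarrow> indep_mod P B I (\<lambda>a. v (f a))"
proof -
  have sum: "(\<Sum>a\<in>I'. c a * v a b) = (\<Sum>a\<in>I. c (f a) * v (f a) b)" for c b
    by (rule sum.reindex_bij_betw[OF assms, symmetric])
  have inj: "inj_on f I" and img: "f ` I = I'" using assms by (auto simp: bij_betw_def)
  show ?thesis
  proof
    assume L: "indep_mod P B I' v"
    show "indep_mod P B I (\<lambda>a. v (f a))"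
      unfolding indep_mod_def
    proof (intro allI impI ballI)
      fix c a
      assume c: "\<forall>b\<in>B. (\<Sum>a\<in>I. c a * v (f a) b) \<in> P" and a: "a \<in> I"
      have "(\<Sum>a\<in>I. c (inv_into I f (f a)) * v (f a) b) = (\<Sum>a\<in>I. c a * v (f a) b)" for b
        using inj by (intro sum.cong) auto
      then have "c (inv_into I f (f a)) \<in> P"
        using c a img
        by (intro indep_modD[OF L, of "\<lambda>a. c (inv_into I f a)"]) (auto simp: sum)
      then show "c a \<in> P" using inj a by simp
    qed
  next
    assume R: "indep_mod P B I (\<lambda>a. v (f a))"
    show "indep_mod P B I' v"
      unfolding indep_mod_def
    proof (intro allI impI ballI)
      fix c a' assume c: "\<forall>b\<in>B. (\<Sum>a\<in>I'. c a * v a b) \<in> P" and "a' \<in> I'"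
      then obtain a where a: "a \<in> I" "a' = f a" using img by blast
      have "c (f a) \<in> P"
        using c a(1) by (intro indep_modD[OF R, of "\<lambda>a. c (f a)"]) (simp_all add: sum)
      then show "c a' \<in> P" using a(2) by simp
    qed
  qed
qed

context full_ideal
begin

lemma indep_mod_subset:
  assumes "indep_mod P B I v" "J \<subseteq> I" "finite I"
  shows "indep_mod P B J v"
  unfolding indep_mod_def
proof (intro allI impI ballI)
  fix c a assume c: "\<forall>b\<in>B. (\<Sum>a\<in>J. c a * v a b) \<in> P" and a: "a \<in> J"
  have "(\<Sum>a\<in>I. (if a \<in> J then c a else 0) * v a b) = (\<Sum>a\<in>J. c a * v a b)" for b
    using assms(2,3) by (intro sum.mono_neutral_cong_right) auto
  then have "(if a \<in> J then c a else 0) \<in> P"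
    using c a assms(2) by (intro indep_modD[OF assms(1), of "\<lambda>a. if a \<in> J then c a else 0"]) auto
  then show "c a \<in> P" using a by simp
qed

end

text \<open>The cofactors of a column eliminate all unknowns but one from a linear system.\<close>

lemma cofactor_expand_mult:
  fixes A :: "'a::comm_ring_1 mat"
  assumes A: "A \<in> carrier_mat n n" and k: "k < n"
  shows "(\<Sum>a<n. cofactor A a k * (\<Sum>b<n. A $$ (a, b) * x b)) = det A * x k"
proof -
  have "(\<Sum>a<n. cofactor A a k * (\<Sum>b<n. A $$ (a, b) * x b)) =
      (\<Sum>b<n. (\<Sum>a<n. cofactor A a k * A $$ (a, b)) * x b)"
    unfolding sum_distrib_left sum_distrib_right by (subst sum.swap) (simp add: mult.assoc)
  also have "\<dots> = (\<Sum>b<n. (if k = b then det A else 0) * x b)"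
  proof (intro sum.cong refl arg_cong2[where f = "(*)"])
    fix b assume "b \<in> {..<n}"
    then have "(adj_mat A * A) $$ (k, b) = (\<Sum>a<n. cofactor A a k * A $$ (a, b))"
      using A k by (simp add: adj_mat_def scalar_prod_def atLeast0LessThan)
    then show "(\<Sum>a<n. cofactor A a k * A $$ (a, b)) = (if k = b then det A else 0)"
      using adj_mat(3)[OF A] k \<open>b \<in> {..<n}\<close> by (auto split: if_splits)
  qed
  also have "\<dots> = det A * x k" using k by (simp add: if_distrib[of "\<lambda>z. z * _"] cong: if_cong)
  finally show ?thesis .
qed

lemma (in full_ideal) det_mult_mem:
  assumes "\<And>a. a < n \<Longrightarrow> (\<Sum>b<n. v a b * x b) \<in> P" "k < n"
  shows "det (mat n n (\<lambda>(a, b). v a b)) * x k \<in> P"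
proof -
  let ?A = "mat n n (\<lambda>(a, b). v a b)"
  have "(\<Sum>a<n. cofactor ?A a k * (\<Sum>b<n. ?A $$ (a, b) * x b)) \<in> P"
  proof (rule sum_mem, rule mult_mem)
    fix a assume "a \<in> {..<n}"
    moreover from this have "(\<Sum>b<n. ?A $$ (a, b) * x b) = (\<Sum>b<n. v a b * x b)"
      by (intro sum.cong) auto
    ultimately show "(\<Sum>b<n. ?A $$ (a, b) * x b) \<in> P" using assms(1)[of a] by simp
  qed
  then show ?thesis using cofactor_expand_mult[of ?A n k x] assms(2) by simp
qed

text \<open>
  Bordering: given a nonzero minor on the first \<open>t\<close> rows, the minors that add one more row and an
  arbitrary column are, expanded along this column, the values of a linear combination of the rows
  whose last coefficient is the given minor. So they do not all vanish.
\<close>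

lemma (in full_prime) indep_mod_imp_minor:
  fixes v :: "nat \<Rightarrow> 'b \<Rightarrow> 'a"
  assumes "indep_mod P B {..<t} v"
  shows "\<exists>\<sigma>. (\<forall>c<t. \<sigma> c \<in> B) \<and> det (mat t t (\<lambda>(a, c). v a (\<sigma> c))) \<notin> P"
  using assms
proof (induction t)
  case 0
  have "det (mat 0 0 f) = (1::'a)" for f by (rule det_dim_zero) simp
  then show ?case using one_not_mem by simp
next
  case (Suc t)
  then have "indep_mod P B {..<t} v"
    by (rule_tac indep_mod_subset) auto
  then obtain \<sigma> where \<sigma>: "\<And>c. c < t \<Longrightarrow> \<sigma> c \<in> B"
      and minor: "det (mat t t (\<lambda>(a, c). v a (\<sigma> c))) \<notin> P"
    using Suc.IH by blast
  define M where "M b = mat (Suc t) (Suc t) (\<lambda>(a, c). v a (if c < t then \<sigma> c else b))" for b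
  define coeff where "coeff a = cofactor (M undefined) a t" for a
  have coeff: "cofactor (M b) a t = coeff a" if "a < Suc t" for a b
  proof -
    have "mat_delete (M b) a t = mat_delete (M undefined) a t"
      by (rule eq_matI) (use that in \<open>auto simp: M_def mat_delete_def\<close>)
    then show ?thesis by (simp add: coeff_def cofactor_def)
  qed
  have det: "det (M b) = (\<Sum>a\<in>{..<Suc t}. coeff a * v a b)" for b
    by (subst laplace_expansion_column[of _ "Suc t" t])
      (auto simp: M_def coeff[unfolded M_def] mult.commute intro!: sum.cong)
  have "mat_delete (M undefined) t t = mat t t (\<lambda>(a, c). v a (\<sigma> c))"
    by (rule eq_matI) (auto simp: M_def mat_delete_def)
  then have "coeff t \<notin> P" using minor by (simp add: coeff_def cofactor_def mult_2[symmetric])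
  then have "\<not> (\<forall>b\<in>B. det (M b) \<in> P)"
    unfolding det using indep_modD[OF Suc.prems, of coeff t] by blast
  then obtain b where b: "b \<in> B" "det (M b) \<notin> P" by blast
  show ?case
    using b \<sigma> by (intro exI[of _ "\<lambda>c. if c < t then \<sigma> c else b"]) (auto simp: M_def)
qed

lemma det_columns_not_inj:
  fixes v :: "nat \<Rightarrow> 'b \<Rightarrow> 'a::comm_ring_1"
  assumes "\<not> inj_on \<sigma> {..<t}"
  shows "det (mat t t (\<lambda>(a, c). v a (\<sigma> c))) = 0"
proof -
  obtain c c' where c: "c < t" "c' < t" "c \<noteq> c'" "\<sigma> c = \<sigma> c'"
    using assms by (auto simp: inj_on_def)
  show ?thesis
    by (rule det_identical_columns[of _ t c c']) (use c in auto)
qed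

text \<open>A nonzero minor has distinct columns.\<close>

lemma (in full_prime) indep_mod_card_le:
  assumes "indep_mod P B I v" "finite B" "finite I"
  shows "card I \<le> card B"
proof -
  obtain f where f: "bij_betw f {..<card I} I"
    using ex_bij_betw_nat_finite[OF assms(3)] by (auto simp: atLeast0LessThan)
  obtain \<sigma> where \<sigma>: "\<And>c. c < card I \<Longrightarrow> \<sigma> c \<in> B"
      "det (mat (card I) (card I) (\<lambda>(a, c). v (f a) (\<sigma> c))) \<notin> P"
    using indep_mod_imp_minor assms(1) indep_mod_reindex_rows[OF f] by metis
  then have "inj_on \<sigma> {..<card I}"
    using det_columns_not_inj[of \<sigma> "card I" "\<lambda>a. v (f a)"] zero_mem by metis
  then show ?thesis using card_inj_on_le[of \<sigma> "{..<card I}" B] \<sigma>(1) assms(2) by auto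
qed

text \<open>
  Steinitz: independent combinations of given rows are no more than the size of some independent
  set of these rows. Take the set \<open>I\<close> of largest size. Up to a common denominator, all given rows,
  hence all combinations, are combinations of the rows in \<open>I\<close>; the coefficients of independent
  combinations are independent.
\<close>

lemma (in full_prime) indep_mod_combinations:
  assumes fin: "finite K" "finite L"
    and w: "\<And>p b. p \<in> L \<Longrightarrow> b \<in> B \<Longrightarrow> w p b = (\<Sum>a\<in>K. q p a * v a b)"
    and indep: "indep_mod P B L w"
  obtains I where "I \<subseteq> K" "indep_mod P B I v" "card L \<le> card I"
proof -
  define S where "S = {I. I \<subseteq> K \<and> indep_mod P B I v}"
  have "finite S" unfolding S_def using fin(1) by (auto intro: finite_subset[of _ "Pow K"])
  moreover have "{} \<in> S" by (simp add: S_def)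
  ultimately have "Max (card ` S) \<in> card ` S" by (intro Max_in) auto
  then obtain I where "I \<in> S" and cardI: "card I = Max (card ` S)" by auto
  have max: "card I' \<le> card I" if "I' \<in> S" for I'
    unfolding cardI using that \<open>finite S\<close> by (intro Max_ge) auto
  have I: "I \<subseteq> K" "indep_mod P B I v" using \<open>I \<in> S\<close> by (simp_all add: S_def)
  have finI: "finite I" using I fin(1) finite_subset by blast
  define comb where "comb a D c \<longleftrightarrow> D \<notin> P \<and> (\<forall>b\<in>B. D * v a b - (\<Sum>i\<in>I. c i * v i b) \<in> P)" for a D c
  have ex: "\<exists>D c. comb a D c" if a: "a \<in> K" for a
  proof (cases "a \<in> I")
    case True
    then show ?thesis
      using finI one_not_mem zero_mem unfolding comb_def
      by (intro exI[of _ 1] exI[of _ "\<lambda>i. if i = a then 1 else 0"])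
        (simp add: if_distrib[of "\<lambda>z. z * _"] cong: if_cong)
  next
    case False
    then have "\<not> indep_mod P B (insert a I) v"
      using max[of "insert a I"] I(1) a finI by (auto simp: S_def)
    then obtain c where c: "\<And>b. b \<in> B \<Longrightarrow> (\<Sum>i\<in>insert a I. c i * v i b) \<in> P" "\<exists>i\<in>insert a I. c i \<notin> P"
      unfolding indep_mod_def by blast
    have sum: "(\<Sum>i\<in>insert a I. c i * v i b) = c a * v a b - (\<Sum>i\<in>I. - c i * v i b)" for b
      using False finI by (simp add: sum_negf)
    have "c a \<notin> P"
    proof
      assume ca: "c a \<in> P"
      have "(\<Sum>i\<in>I. c i * v i b) \<in> P" if "b \<in> B" for b
        using diff_mem[OF c(1)[OF that] mult_mem'[OF ca, of "v a b"]] False finI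
        by simp
      then have "c i \<in> P" if "i \<in> I" for i using that by (rule indep_modD[OF I(2)])
      then show False using ca c(2) by blast
    qed
    then have "comb a (c a) (\<lambda>i. - c i)" using c(1) unfolding sum comb_def by blast
    then show ?thesis by blast
  qed
  obtain D c where Dc: "\<And>a. a \<in> K \<Longrightarrow> comb a (D a) (c a)"
    using ex by metis
  have D: "\<And>a. a \<in> K \<Longrightarrow> D a \<notin> P"
    and c: "\<And>a b. a \<in> K \<Longrightarrow> b \<in> B \<Longrightarrow> D a * v a b - (\<Sum>i\<in>I. c a i * v i b) \<in> P"
    using Dc unfolding comb_def by blast+
  \<comment> \<open>The common denominator \<open>D'\<close>, and \<open>d\<close> for the coefficients of the combinations after clearing it.\<close>
  define E where "E a = (\<Prod>a'\<in>K - {a}. D a')" for a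
  define D' where "D' = (\<Prod>a\<in>K. D a)"
  have E: "D' = D a * E a" if "a \<in> K" for a
    unfolding D'_def E_def using that fin(1) by (rule prod.remove[OF _ , rotated])
  have "D' \<notin> P" unfolding D'_def using D by (rule prod_not_mem)
  define d where "d p i = (\<Sum>a\<in>K. q p a * E a * c a i)" for p i
  have comb': "D' * w p b - (\<Sum>i\<in>I. d p i * v i b) \<in> P" if "p \<in> L" "b \<in> B" for p b
  proof -
    have "D' * w p b = (\<Sum>a\<in>K. q p a * E a * (D a * v a b))"
      unfolding w[OF that] sum_distrib_left
      by (intro sum.cong refl) (simp add: E mult_ac)
    moreover have "(\<Sum>i\<in>I. d p i * v i b) = (\<Sum>a\<in>K. q p a * E a * (\<Sum>i\<in>I. c a i * v i b))"
      unfolding d_def sum_distrib_left sum_distrib_right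
      by (subst sum.swap) (simp add: mult.assoc)
    ultimately show ?thesis
      using c[OF _ that(2)]
      by (simp only:) (intro sum_diff_mem, simp add: right_diff_distrib[symmetric] mult_mem)
  qed
  have "indep_mod P I L d"
    unfolding indep_mod_def
  proof (intro allI impI ballI)
    fix z p assume z: "\<forall>i\<in>I. (\<Sum>p\<in>L. z p * d p i) \<in> P" and p: "p \<in> L"
    have "(\<Sum>p\<in>L. (z p * D') * w p b) \<in> P" if b: "b \<in> B" for b
    proof -
      have "(\<Sum>p\<in>L. z p * (D' * w p b)) - (\<Sum>p\<in>L. z p * (\<Sum>i\<in>I. d p i * v i b)) \<in> P"
        using comb'[OF _ b] by (intro sum_diff_mem) (simp add: right_diff_distrib[symmetric] mult_mem)
      moreover have "(\<Sum>p\<in>L. z p * (\<Sum>i\<in>I. d p i * v i b)) = (\<Sum>i\<in>I. (\<Sum>p\<in>L. z p * d p i) * v i b)"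
        unfolding sum_distrib_left sum_distrib_right by (subst sum.swap) (simp add: mult.assoc)
      moreover have "(\<Sum>i\<in>I. (\<Sum>p\<in>L. z p * d p i) * v i b) \<in> P"
        by (rule sum_mem, rule mult_mem') (use z in blast)
      ultimately show ?thesis using diff_mem_iff by (simp add: mult.assoc)
    qed
    then have "z p * D' \<in> P" using p by (rule indep_modD[OF indep])
    then show "z p \<in> P" using \<open>D' \<notin> P\<close> prime by blast
  qed
  then have "card L \<le> card I" using indep_mod_card_le finI fin(2) by blast
  then show ?thesis using that I by blast
qed

section \<open>Signed maximal minors\<close>

definition maximal_minor :: "nat \<Rightarrow> (nat \<Rightarrow> nat \<Rightarrow> 'a::comm_ring_1) \<Rightarrow> nat \<Rightarrow> 'a" where
  "maximal_minor n v j = (- 1) ^ j * det (mat n n (\<lambda>(a, c). v a (if c < j then c else Suc c)))"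

text \<open>
  The matrix with the unit row at \<open>j\<close> on top of the rows \<open>v\<close>. Its cofactors along the first row are
  the signed maximal minors of \<open>v\<close>, and its determinant is the \<open>j\<close>-th of them.
\<close>

definition unit_row_mat :: "nat \<Rightarrow> nat \<Rightarrow> (nat \<Rightarrow> nat \<Rightarrow> 'a::comm_ring_1) \<Rightarrow> 'a mat" where
  "unit_row_mat n j v = mat (Suc n) (Suc n)
     (\<lambda>(a, b). if a = 0 then (if b = j then 1 else 0) else v (a - 1) b)"

lemma cofactor_unit_row_mat:
  assumes "l \<le> n" shows "cofactor (unit_row_mat n j v) 0 l = maximal_minor n v l"
proof -
  have "mat_delete (unit_row_mat n j v) 0 l = mat n n (\<lambda>(a, c). v a (if c < l then c else Suc c))"
    by (rule eq_matI) (use assms in \<open>auto simp: mat_delete_def unit_row_mat_def\<close>)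
  then show ?thesis by (simp add: cofactor_def maximal_minor_def)
qed

lemma det_unit_row_mat:
  assumes "j \<le> n" shows "det (unit_row_mat n j v) = maximal_minor n v j"
proof -
  have "det (unit_row_mat n j v) =
      (\<Sum>b<Suc n. unit_row_mat n j v $$ (0, b) * cofactor (unit_row_mat n j v) 0 b)"
    by (rule laplace_expansion_row) (simp_all add: unit_row_mat_def)
  also have "\<dots> = (\<Sum>b<Suc n. if b = j then maximal_minor n v b else 0)"
    by (rule sum.cong) (auto simp: cofactor_unit_row_mat, auto simp: unit_row_mat_def)
  also have "\<dots> = maximal_minor n v j" using assms by simp
  finally show ?thesis .
qed

text \<open>
  Cramer's rule for the square matrix with the unit row at \<open>j\<close> on top: applied to \<open>x\<close> it gives \<open>x j\<close>
  in the first row and, modulo \<open>P\<close>, zero in the others.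
\<close>

lemma (in full_ideal) maximal_minor_proportional:
  assumes x: "\<And>a. a < n \<Longrightarrow> (\<Sum>b\<le>n. v a b * x b) \<in> P" and "j \<le> n" "l \<le> n"
  shows "maximal_minor n v j * x l - maximal_minor n v l * x j \<in> P"
proof -
  let ?M = "unit_row_mat n j v"
  let ?s = "\<lambda>a. cofactor ?M a l * (\<Sum>b<Suc n. ?M $$ (a, b) * x b)"
  have "det ?M * x l = (\<Sum>a<Suc n. ?s a)"
    by (rule cofactor_expand_mult[symmetric]) (use assms in \<open>simp_all add: unit_row_mat_def\<close>)
  also have "\<dots> = ?s 0 + (\<Sum>a<n. ?s (Suc a))"
    by (rule sum.lessThan_Suc_shift)
  also have "(\<Sum>b<Suc n. ?M $$ (0, b) * x b) = (\<Sum>b<Suc n. if b = j then x b else 0)"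
    by (rule sum.cong) (auto simp: unit_row_mat_def)
  also have "\<dots> = x j" using \<open>j \<le> n\<close> by simp
  finally have "maximal_minor n v j * x l - maximal_minor n v l * x j = (\<Sum>a<n. ?s (Suc a))"
    using assms by (simp add: det_unit_row_mat cofactor_unit_row_mat)
  also have "?s (Suc a) \<in> P" if "a < n" for a
  proof -
    have "(\<Sum>b<Suc n. ?M $$ (Suc a, b) * x b) = (\<Sum>b\<le>n. v a b * x b)"
      by (rule sum.cong) (use that in \<open>auto simp: unit_row_mat_def\<close>)
    then show ?thesis using x[OF that] by (simp only: mult_mem)
  qed
  then have "(\<Sum>a<n. ?s (Suc a)) \<in> P" by (intro sum_mem) simp
  finally show ?thesis .
qed

text \<open>
  Multiplying the matrix with the unit row at \<open>j\<close> by the matrix that selects the columns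
  \<open>j, \<sigma> 0, \<sigma> 1, \<dots>\<close> gives a matrix with first row \<open>1, 0, 0, \<dots>\<close>, whose determinant is the minor on
  the columns \<open>\<sigma>\<close>. So these columns need not be brought into increasing order.
\<close>

lemma minor_eq_maximal_minor_mult:
  assumes \<sigma>: "\<And>c. c < n \<Longrightarrow> \<sigma> c \<le> n \<and> \<sigma> c \<noteq> j" and j: "j \<le> n"
  shows "\<exists>e. det (mat n n (\<lambda>(a, c). v a (\<sigma> c))) = maximal_minor n v j * e"
proof -
  let ?M = "unit_row_mat n j v"
  define \<tau> where "\<tau> c = (if c = 0 then j else \<sigma> (c - 1))" for c
  define Q where "Q = mat (Suc n) (Suc n) (\<lambda>(b, c). if b = \<tau> c then 1 else (0::'a))"
  have M: "?M \<in> carrier_mat (Suc n) (Suc n)" and Q: "Q \<in> carrier_mat (Suc n) (Suc n)"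
    by (simp_all add: unit_row_mat_def Q_def)
  have \<tau>: "\<tau> c < Suc n" if "c < Suc n" for c
    using that \<sigma>[of "c - 1"] j by (auto simp: \<tau>_def less_Suc_eq_le)
  have entry: "(?M * Q) $$ (a, c) = ?M $$ (a, \<tau> c)" if "a < Suc n" "c < Suc n" for a c
  proof -
    have "(?M * Q) $$ (a, c) = (\<Sum>b\<in>{..<Suc n}. ?M $$ (a, b) * Q $$ (b, c))"
      using that M Q by (simp add: scalar_prod_def atLeast0LessThan del: sum.lessThan_Suc)
    also have "\<dots> = (\<Sum>b<Suc n. if b = \<tau> c then ?M $$ (a, b) else 0)"
      using that(2) by (intro sum.cong) (auto simp: Q_def)
    also have "\<dots> = ?M $$ (a, \<tau> c)"
      using \<tau>[OF that(2)] by (subst sum.delta) auto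
    finally show ?thesis .
  qed
  have MQ: "?M * Q \<in> carrier_mat (Suc n) (Suc n)" using M Q by simp
  have "det (?M * Q) = (\<Sum>b<Suc n. (?M * Q) $$ (0, b) * cofactor (?M * Q) 0 b)"
    by (rule laplace_expansion_row[OF MQ]) simp
  also have "\<dots> = (\<Sum>b<Suc n. if b = 0 then cofactor (?M * Q) 0 0 else 0)"
  proof (rule sum.cong[OF refl])
    fix b assume b: "b \<in> {..<Suc n}"
    have "?M $$ (0, \<tau> b) = (if b = 0 then 1 else 0)"
    proof -
      have "\<tau> b = j \<longleftrightarrow> b = 0" using \<sigma>[of "b - 1"] b by (cases b) (auto simp: \<tau>_def)
      then show ?thesis using \<tau>[of b] b by (simp add: unit_row_mat_def)
    qed
    then show "(?M * Q) $$ (0, b) * cofactor (?M * Q) 0 b = (if b = 0 then cofactor (?M * Q) 0 0 else 0)"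
      using b by (simp add: entry del: index_mult_mat)
  qed
  also have "\<dots> = cofactor (?M * Q) 0 0" by (subst sum.delta) auto
  also have "mat_delete (?M * Q) 0 0 = mat n n (\<lambda>(a, c). v a (\<sigma> c))"
  proof (rule eq_matI)
    fix a c assume "a < dim_row (mat n n (\<lambda>(a, c). v a (\<sigma> c)))" "c < dim_col (mat n n (\<lambda>(a, c). v a (\<sigma> c)))"
    then have ac: "a < n" "c < n" by simp_all
    then have "mat_delete (?M * Q) 0 0 $$ (a, c) = (?M * Q) $$ (Suc a, Suc c)"
      using carrier_matD[OF M] carrier_matD[OF Q] by (simp add: mat_delete_def del: index_mult_mat(1))
    also have "\<dots> = ?M $$ (Suc a, \<tau> (Suc c))" using ac by (intro entry) simp_all
    also have "\<dots> = v a (\<sigma> c)" using ac \<tau>[of "Suc c"] by (simp add: unit_row_mat_def) (simp add: \<tau>_def)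
    finally show "mat_delete (?M * Q) 0 0 $$ (a, c) = mat n n (\<lambda>(a, c). v a (\<sigma> c)) $$ (a, c)"
      using ac by simp
  qed (use MQ in auto)
  then have "cofactor (?M * Q) 0 0 = det (mat n n (\<lambda>(a, c). v a (\<sigma> c)))"
    by (simp add: cofactor_def)
  finally have "det (mat n n (\<lambda>(a, c). v a (\<sigma> c))) = det ?M * det Q"
    using det_mult[OF M Q] by simp
  then show ?thesis using det_unit_row_mat[OF j, of v] by metis
qed

lemma (in full_prime) indep_mod_imp_maximal_minor:
  assumes "indep_mod P {..n} {..<n} v"
  shows "\<exists>j\<le>n. maximal_minor n v j \<notin> P"
proof -
  obtain \<sigma> where \<sigma>: "\<And>c. c < n \<Longrightarrow> \<sigma> c \<in> {..n}" "det (mat n n (\<lambda>(a, c). v a (\<sigma> c))) \<notin> P"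
    using indep_mod_imp_minor[OF assms] by blast
  have "card (\<sigma> ` {..<n}) < card {..n}"
    using card_image_le[of "{..<n}" \<sigma>] by simp
  then have "\<not> {..n} \<subseteq> \<sigma> ` {..<n}" using card_mono[of "\<sigma> ` {..<n}" "{..n}"] by auto
  then obtain j where j: "j \<le> n" "j \<notin> \<sigma> ` {..<n}" by auto
  have "\<exists>e. det (mat n n (\<lambda>(a, c). v a (\<sigma> c))) = maximal_minor n v j * e"
    using \<sigma>(1) j by (intro minor_eq_maximal_minor_mult) auto
  then have "maximal_minor n v j \<notin> P" using \<sigma>(2) mult_mem' by metis
  then show ?thesis using j(1) by blast
qed

section \<open>Fractions\<close>

lemma rows_independentD:
  "rows_independent F A I \<Longrightarrow> c \<in> I \<rightarrow> carrier F \<Longrightarrow>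
    (\<And>b. b < dim_col A \<Longrightarrow> (\<Oplus>\<^bsub>F\<^esub>a\<in>I. c a \<otimes>\<^bsub>F\<^esub> A $$ (a, b)) = \<zero>\<^bsub>F\<^esub>) \<Longrightarrow> a \<in> I \<Longrightarrow> c a = \<zero>\<^bsub>F\<^esub>"
  by (simp add: rows_independent_def)

context "domain"
begin

abbreviation (input) nonzero where "nonzero \<equiv> carrier R - {\<zero>}"

lemma equiv_frac_rel: "equiv (carrier R \<times> nonzero) (frac_rel R)"
proof (rule equivI)
  show "sym (frac_rel R)" "frac_rel R \<subseteq> (carrier R \<times> nonzero) \<times> (carrier R \<times> nonzero)"
      "refl_on (carrier R \<times> nonzero) (frac_rel R)"
    by (auto simp: frac_rel_def refl_on_def sym_def)
  show "trans (frac_rel R)"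
  proof (rule transI, clarify)
    fix a b c d e f
    assume "((a, b), (c, d)) \<in> frac_rel R" "((c, d), (e, f)) \<in> frac_rel R"
    then have car: "a \<in> carrier R" "b \<in> nonzero" "c \<in> carrier R" "d \<in> nonzero" "e \<in> carrier R" "f \<in> nonzero"
      and eq: "a \<otimes> d = c \<otimes> b" "c \<otimes> f = e \<otimes> d"
      by (auto simp: frac_rel_def)
    have "(a \<otimes> f) \<otimes> d = (a \<otimes> d) \<otimes> f" using car by (simp add: m_ac)
    also have "\<dots> = (c \<otimes> f) \<otimes> b" unfolding eq(1) using car by (simp add: m_ac)
    also have "\<dots> = (e \<otimes> b) \<otimes> d" unfolding eq(2) using car by (simp add: m_ac)
    finally have "a \<otimes> f = e \<otimes> b" using car by (simp add: m_rcancel)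
    then show "((a, b), (e, f)) \<in> frac_rel R" using car by (simp add: frac_rel_def)
  qed
qed

lemma mem_frac_iff:
  "x \<in> frac R a b \<longleftrightarrow> (\<exists>a' b'. x = (a', b') \<and> a \<in> carrier R \<and> b \<in> nonzero \<and> a' \<in> carrier R \<and>
     b' \<in> nonzero \<and> a \<otimes> b' = a' \<otimes> b)"
  by (cases x) (auto simp: frac_def frac_rel_def)

lemma frac_eq_iff:
  assumes "a \<in> carrier R" "b \<in> nonzero" "c \<in> carrier R" "d \<in> nonzero"
  shows "frac R a b = frac R c d \<longleftrightarrow> a \<otimes> d = c \<otimes> b"
  unfolding frac_def
  using eq_equiv_class_iff[OF equiv_frac_rel, of "(a, b)" "(c, d)"] assms by (auto simp: frac_rel_def)

lemma frac_closed: "a \<in> carrier R \<Longrightarrow> b \<in> nonzero \<Longrightarrow> frac R a b \<in> carrier (frac_field R)"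
  by (simp add: frac_def frac_field_def quotientI)

lemma frac_cases:
  assumes "x \<in> carrier (frac_field R)"
  obtains a b where "a \<in> carrier R" "b \<in> nonzero" "x = frac R a b"
  using assms by (auto simp: frac_def frac_field_def elim!: quotientE)

lemma UN_frac_constant:
  assumes "a \<in> carrier R" "b \<in> nonzero" "c \<in> carrier R" "d \<in> nonzero"
    and "\<And>a' b' c' d'. (a', b') \<in> frac R a b \<Longrightarrow> (c', d') \<in> frac R c d \<Longrightarrow> f a' b' c' d' = X"
  shows "(\<Union>(a, b)\<in>frac R a b. \<Union>(c, d)\<in>frac R c d. f a b c d) = X"
proof -
  have "(a, b) \<in> frac R a b" "(c, d) \<in> frac R c d" using assms(1-4) by (auto simp: mem_frac_iff)
  then show ?thesis using assms(5) by (intro equalityI subsetI) (auto, blast)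
qed

lemma frac_mult:
  assumes "a \<in> carrier R" "b \<in> nonzero" "c \<in> carrier R" "d \<in> nonzero"
  shows "frac R a b \<otimes>\<^bsub>frac_field R\<^esub> frac R c d = frac R (a \<otimes> c) (b \<otimes> d)"
proof -
  have "(\<Union>(a, b)\<in>frac R a b. \<Union>(c, d)\<in>frac R c d. frac R (a \<otimes> c) (b \<otimes> d)) = frac R (a \<otimes> c) (b \<otimes> d)"
  proof (rule UN_frac_constant[OF assms])
    fix a' b' c' d' assume "(a', b') \<in> frac R a b" "(c', d') \<in> frac R c d"
    then have *: "a' \<in> carrier R" "b' \<in> nonzero" "c' \<in> carrier R" "d' \<in> nonzero"
      and eq: "a \<otimes> b' = a' \<otimes> b" "c \<otimes> d' = c' \<otimes> d"
      by (auto simp: mem_frac_iff)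
    have "(a' \<otimes> c') \<otimes> (b \<otimes> d) = (a' \<otimes> b) \<otimes> (c' \<otimes> d)" using * assms by (simp add: m_ac)
    also have "\<dots> = (a \<otimes> c) \<otimes> (b' \<otimes> d')" unfolding eq[symmetric] using * assms by (simp add: m_ac)
    finally show "frac R (a' \<otimes> c') (b' \<otimes> d') = frac R (a \<otimes> c) (b \<otimes> d)"
      using * assms by (subst frac_eq_iff) (auto simp: integral_iff)
  qed
  then show ?thesis by (simp add: frac_field_def)
qed

lemma frac_add:
  assumes "a \<in> carrier R" "b \<in> nonzero" "c \<in> carrier R" "d \<in> nonzero"
  shows "frac R a b \<oplus>\<^bsub>frac_field R\<^esub> frac R c d = frac R (a \<otimes> d \<oplus> c \<otimes> b) (b \<otimes> d)"
proof -
  have "(\<Union>(a, b)\<in>frac R a b. \<Union>(c, d)\<in>frac R c d. frac R (a \<otimes> d \<oplus> c \<otimes> b) (b \<otimes> d)) =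
      frac R (a \<otimes> d \<oplus> c \<otimes> b) (b \<otimes> d)"
  proof (rule UN_frac_constant[OF assms])
    fix a' b' c' d' assume "(a', b') \<in> frac R a b" "(c', d') \<in> frac R c d"
    then have *: "a' \<in> carrier R" "b' \<in> nonzero" "c' \<in> carrier R" "d' \<in> nonzero"
      and eq: "a \<otimes> b' = a' \<otimes> b" "c \<otimes> d' = c' \<otimes> d"
      by (auto simp: mem_frac_iff)
    have "(a' \<otimes> d' \<oplus> c' \<otimes> b') \<otimes> (b \<otimes> d) = (a' \<otimes> b) \<otimes> (d' \<otimes> d) \<oplus> (c' \<otimes> d) \<otimes> (b' \<otimes> b)"
      using * assms by (simp add: m_ac l_distr r_distr)
    also have "\<dots> = (a \<otimes> d \<oplus> c \<otimes> b) \<otimes> (b' \<otimes> d')"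
      unfolding eq[symmetric] using * assms by (simp add: m_ac l_distr r_distr)
    finally show "frac R (a' \<otimes> d' \<oplus> c' \<otimes> b') (b' \<otimes> d') = frac R (a \<otimes> d \<oplus> c \<otimes> b) (b \<otimes> d)"
      using * assms by (subst frac_eq_iff) (auto simp: integral_iff)
  qed
  then show ?thesis by (simp add: frac_field_def)
qed

lemma frac_zero_eq: "\<zero>\<^bsub>frac_field R\<^esub> = frac R \<zero> \<one>"
  by (simp add: frac_field_def)

lemma frac_eq_zero_iff:
  "a \<in> carrier R \<Longrightarrow> b \<in> nonzero \<Longrightarrow> frac R a b = \<zero>\<^bsub>frac_field R\<^esub> \<longleftrightarrow> a = \<zero>"
  by (simp add: frac_zero_eq frac_eq_iff)

lemma frac_field_abelian_monoid: "abelian_monoid (frac_field R)"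
proof (rule abelian_monoidI)
  fix x y z
  assume "x \<in> carrier (frac_field R)" "y \<in> carrier (frac_field R)" "z \<in> carrier (frac_field R)"
  then obtain a b c d e f where *: "a \<in> carrier R" "b \<in> nonzero" "c \<in> carrier R" "d \<in> nonzero"
      "e \<in> carrier R" "f \<in> nonzero" and "x = frac R a b" "y = frac R c d" "z = frac R e f"
    by (metis frac_cases)
  then show "(x \<oplus>\<^bsub>frac_field R\<^esub> y) \<oplus>\<^bsub>frac_field R\<^esub> z = x \<oplus>\<^bsub>frac_field R\<^esub> (y \<oplus>\<^bsub>frac_field R\<^esub> z)"
    by (simp add: frac_add integral_iff frac_eq_iff) (simp add: m_ac a_ac l_distr r_distr)
next
  fix x y
  assume "x \<in> carrier (frac_field R)" "y \<in> carrier (frac_field R)"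
  then obtain a b c d where *: "a \<in> carrier R" "b \<in> nonzero" "c \<in> carrier R" "d \<in> nonzero"
      and xy: "x = frac R a b" "y = frac R c d"
    by (metis frac_cases)
  show "x \<oplus>\<^bsub>frac_field R\<^esub> y \<in> carrier (frac_field R)"
    using * unfolding xy by (subst frac_add) (auto intro!: frac_closed simp: integral_iff)
  show "x \<oplus>\<^bsub>frac_field R\<^esub> y = y \<oplus>\<^bsub>frac_field R\<^esub> x"
    using * unfolding xy by (simp add: frac_add a_comm m_comm)
next
  show "\<zero>\<^bsub>frac_field R\<^esub> \<in> carrier (frac_field R)"
    unfolding frac_zero_eq by (rule frac_closed) auto
  fix x assume "x \<in> carrier (frac_field R)"
  then obtain a b where "a \<in> carrier R" "b \<in> nonzero" "x = frac R a b"
    by (metis frac_cases)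
  then show "\<zero>\<^bsub>frac_field R\<^esub> \<oplus>\<^bsub>frac_field R\<^esub> x = x"
    by (simp add: frac_zero_eq frac_add)
qed

lemma finsum_frac:
  assumes "finite I" "c \<in> I \<rightarrow> carrier R" "d \<in> nonzero"
  shows "(\<Oplus>\<^bsub>frac_field R\<^esub>a\<in>I. frac R (c a) d) = frac R (\<Oplus>a\<in>I. c a) d"
proof -
  interpret F: abelian_monoid "frac_field R" by (rule frac_field_abelian_monoid)
  show ?thesis
    using assms(1,2)
  proof (induction I)
    case empty
    then show ?case using assms(3) by (simp add: frac_zero_eq frac_eq_iff)
  next
    case (insert x I)
    have c: "c \<in> I \<rightarrow> carrier R" "c x \<in> carrier R" "finsum R c I \<in> carrier R"
      using insert.prems by (auto intro!: finsum_closed)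
    have "(\<Oplus>\<^bsub>frac_field R\<^esub>a\<in>insert x I. frac R (c a) d) =
        frac R (c x) d \<oplus>\<^bsub>frac_field R\<^esub> frac R (\<Oplus>a\<in>I. c a) d"
      using insert c assms(3) by (subst F.finsum_insert) (auto intro!: frac_closed)
    also have "\<dots> = frac R (c x \<oplus> (\<Oplus>a\<in>I. c a)) d"
      using c assms(3) by (simp add: frac_add frac_eq_iff integral_iff) (simp add: m_ac l_distr r_distr)
    finally show ?case using insert c by (simp add: finsum_insert)
  qed
qed

lemma common_denominator:
  assumes "finite I" "c \<in> I \<rightarrow> carrier (frac_field R)"
  shows "\<exists>n d. n \<in> I \<rightarrow> carrier R \<and> d \<in> nonzero \<and> (\<forall>a\<in>I. c a = frac R (n a) d)"
  using assms
proof (induction I)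
  case empty
  then show ?case by (intro exI[of _ "\<lambda>_. \<zero>"] exI[of _ \<one>]) simp
next
  case (insert x I)
  then obtain n d where n: "n \<in> I \<rightarrow> carrier R" "d \<in> nonzero" "\<And>a. a \<in> I \<Longrightarrow> c a = frac R (n a) d"
    by (auto simp: Pi_iff)
  obtain p q where p: "p \<in> carrier R" "q \<in> nonzero" "c x = frac R p q"
    using insert.prems frac_cases[of "c x"] by (metis PiE insertI1)
  let ?n = "\<lambda>a. if a = x then p \<otimes> d else n a \<otimes> q"
  have "c a = frac R (?n a) (d \<otimes> q)" if "a \<in> insert x I" for a
  proof (cases "a = x")
    case True
    then show ?thesis using n(2) p by (simp add: frac_eq_iff integral_iff m_ac)
  next
    case False
    then have "a \<in> I" "n a \<in> carrier R" using that n(1) by auto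
    then show ?thesis using n(2,3) p False by (simp add: frac_eq_iff integral_iff m_ac)
  qed
  moreover have "?n \<in> insert x I \<rightarrow> carrier R" "d \<otimes> q \<in> nonzero"
    using n(1,2) p by (auto simp: integral_iff Pi_iff)
  ultimately show ?case by blast
qed

text \<open>Independence over the field of fractions can be tested with coefficients in the domain.\<close>

lemma rows_independent_frac_field_iff:
  assumes A: "\<And>a b. a < dim_row A \<Longrightarrow> b < dim_col A \<Longrightarrow> A $$ (a, b) \<in> carrier R"
  shows "rows_independent (frac_field R) (map_mat (\<lambda>x. frac R x \<one>) A) I \<longleftrightarrow> rows_independent R A I"
proof (cases "I \<subseteq> {..<dim_row A}")
  case False
  then show ?thesis by (simp add: rows_independent_def)
next
  case True
  then have finI: "finite I" using finite_subset by blast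
  let ?A' = "map_mat (\<lambda>x. frac R x \<one>) A"
  have comb: "(\<Oplus>\<^bsub>frac_field R\<^esub>a\<in>I. frac R (n a) d \<otimes>\<^bsub>frac_field R\<^esub> ?A' $$ (a, b)) =
      \<zero>\<^bsub>frac_field R\<^esub> \<longleftrightarrow> (\<Oplus>a\<in>I. n a \<otimes> A $$ (a, b)) = \<zero>"
    if n: "n \<in> I \<rightarrow> carrier R" "d \<in> nonzero" and b: "b < dim_col A" for n d b
  proof -
    interpret F: abelian_monoid "frac_field R" by (rule frac_field_abelian_monoid)
    have car: "n a \<in> carrier R \<and> A $$ (a, b) \<in> carrier R" if "a \<in> I" for a
      using that n(1) A[of a b] b True by auto
    have "frac R (n a) d \<otimes>\<^bsub>frac_field R\<^esub> ?A' $$ (a, b) = frac R (n a \<otimes> A $$ (a, b)) d" if "a \<in> I" for a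
    proof -
      have "a < dim_row A" using that True by auto
      then show ?thesis using car[OF that] b n(2) by (simp add: frac_mult)
    qed
    then have "(\<Oplus>\<^bsub>frac_field R\<^esub>a\<in>I. frac R (n a) d \<otimes>\<^bsub>frac_field R\<^esub> ?A' $$ (a, b)) =
        (\<Oplus>\<^bsub>frac_field R\<^esub>a\<in>I. frac R (n a \<otimes> A $$ (a, b)) d)"
      using car n(2) by (intro F.finsum_cong') (auto intro!: frac_closed)
    also have "\<dots> = frac R (\<Oplus>a\<in>I. n a \<otimes> A $$ (a, b)) d"
      using car by (intro finsum_frac[OF finI _ n(2)]) auto
    finally show ?thesis
      using car n(2) by (simp add: frac_eq_zero_iff finsum_closed Pi_iff)
  qed
  show ?thesis
  proof
    assume L: "rows_independent (frac_field R) ?A' I"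
    show "rows_independent R A I"
      unfolding rows_independent_def
    proof (intro conjI ballI impI True)
      fix n a assume n: "n \<in> I \<rightarrow> carrier R"
        and zero: "\<forall>b<dim_col A. (\<Oplus>a\<in>I. n a \<otimes> A $$ (a, b)) = \<zero>" and a: "a \<in> I"
      have "frac R (n a) \<one> = \<zero>\<^bsub>frac_field R\<^esub>"
      proof (rule rows_independentD[OF L _ _ a])
        show "(\<lambda>a. frac R (n a) \<one>) \<in> I \<rightarrow> carrier (frac_field R)"
          using n by (auto intro!: frac_closed)
        show "(\<Oplus>\<^bsub>frac_field R\<^esub>a\<in>I. frac R (n a) \<one> \<otimes>\<^bsub>frac_field R\<^esub> ?A' $$ (a, b)) = \<zero>\<^bsub>frac_field R\<^esub>"
          if "b < dim_col ?A'" for b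
          using comb[OF n, of \<one>] zero that by simp
      qed
      then show "n a = \<zero>" using frac_eq_zero_iff[of "n a" \<one>] n a by auto
    qed
  next
    assume Rt: "rows_independent R A I"
    show "rows_independent (frac_field R) ?A' I"
      unfolding rows_independent_def
    proof (intro conjI ballI impI)
      show "I \<subseteq> {..<dim_row ?A'}" using True by simp
      fix c a assume c: "c \<in> I \<rightarrow> carrier (frac_field R)" and a: "a \<in> I"
        and zero: "\<forall>b<dim_col ?A'. (\<Oplus>\<^bsub>frac_field R\<^esub>a\<in>I. c a \<otimes>\<^bsub>frac_field R\<^esub> ?A' $$ (a, b)) = \<zero>\<^bsub>frac_field R\<^esub>"
      interpret F: abelian_monoid "frac_field R" by (rule frac_field_abelian_monoid)
      obtain n d where n: "n \<in> I \<rightarrow> carrier R" "d \<in> nonzero" and cn: "\<And>a. a \<in> I \<Longrightarrow> c a = frac R (n a) d"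
        using common_denominator[OF finI c] by blast
      have "(\<Oplus>a\<in>I. n a \<otimes> A $$ (a, b)) = \<zero>" if b: "b < dim_col A" for b
      proof -
        have "frac R (n a) d \<otimes>\<^bsub>frac_field R\<^esub> ?A' $$ (a, b) \<in> carrier (frac_field R)" if "a \<in> I" for a
        proof -
          have "a < dim_row A" "n a \<in> carrier R" using that True n(1) by auto
          then show ?thesis
            using n(2) b A[of a b] by (simp add: frac_mult frac_closed)
        qed
        then have "(\<Oplus>\<^bsub>frac_field R\<^esub>a\<in>I. c a \<otimes>\<^bsub>frac_field R\<^esub> ?A' $$ (a, b)) =
            (\<Oplus>\<^bsub>frac_field R\<^esub>a\<in>I. frac R (n a) d \<otimes>\<^bsub>frac_field R\<^esub> ?A' $$ (a, b))"
          by (intro F.finsum_cong') (auto simp: cn)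
        then show ?thesis using comb[OF n b] zero b by simp
      qed
      then have "n a = \<zero>" by (rule rows_independentD[OF Rt n(1) _ a])
      then show "c a = \<zero>\<^bsub>frac_field R\<^esub>" using cn[OF a] n(2) frac_eq_zero_iff[of \<zero> d] by simp
    qed
  qed
qed

end

section \<open>Rank over the coordinate ring\<close>

definition restrict_vars :: "pvar set \<Rightarrow> 'k::comm_ring_1 mpoly \<Rightarrow> 'k mpoly" where
  "restrict_vars V = mp_eval Const (\<lambda>v. if v \<in> V then Var v else 0)"

text \<open>
  The ideal of the whole polynomial ring generated by \<open>I\<close> and the variables outside \<open>V\<close>. It has the
  same trace on the polynomials in the variables \<open>V\<close> as \<open>I\<close>, and the same quotient.
\<close>

definition extend_ideal :: "pvar set \<Rightarrow> 'k::comm_ring_1 mpoly set \<Rightarrow> 'k mpoly set" where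
  "extend_ideal V I = {p. restrict_vars V p \<in> I}"

lemma restrict_vars_hom: "comm_ring_hom (restrict_vars V)"
  unfolding restrict_vars_def by (rule mp_eval_hom[OF Const_hom])

lemma vars_restrict_vars: "vars (restrict_vars V p) \<subseteq> V"
  unfolding restrict_vars_def by (rule vars_mp_eval_subset) auto

lemma restrict_vars_id:
  assumes "vars p \<subseteq> V" shows "restrict_vars V p = p"
proof -
  have "restrict_vars V p = mp_eval Const Var p"
    unfolding restrict_vars_def by (rule mp_eval_cong) (use assms in auto)
  then show ?thesis by (simp add: mp_eval_Const_Var)
qed

lemma mem_extend_ideal_iff: "vars p \<subseteq> V \<Longrightarrow> p \<in> extend_ideal V I \<longleftrightarrow> p \<in> I"
  by (simp add: extend_ideal_def restrict_vars_id)

lemma restrict_vars_congruent: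
  assumes "ideal I (poly_ring V)" shows "restrict_vars V p - p \<in> extend_ideal V I"
proof -
  interpret comm_ring_hom "restrict_vars V" by (rule restrict_vars_hom)
  show ?thesis
    using ideal_polyD(2)[OF assms] restrict_vars_id[OF vars_restrict_vars, of V p]
    by (simp add: extend_ideal_def hom_minus)
qed

lemma full_prime_extend_ideal:
  fixes I :: "'a::comm_ring_1 mpoly set"
  assumes "primeideal I (poly_ring V)"
  shows "full_prime (extend_ideal V I)"
proof -
  interpret comm_ring_hom "restrict_vars V" by (rule restrict_vars_hom)
  note prime = primeideal_polyD[OF assms]
  show ?thesis
  proof
    fix p q :: "'a mpoly"
    show "q * p \<in> extend_ideal V I" if "p \<in> extend_ideal V I"
      using that ideal_polyD(4)[OF prime(1) _ vars_restrict_vars] by (simp add: extend_ideal_def hom_mult)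
    show "p \<in> extend_ideal V I \<or> q \<in> extend_ideal V I" if "p * q \<in> extend_ideal V I"
      using that prime(3)[OF vars_restrict_vars vars_restrict_vars] by (simp add: extend_ideal_def hom_mult)
  qed (use prime(2) ideal_polyD(2,3)[OF prime(1)] in \<open>auto simp: extend_ideal_def hom_add\<close>)
qed

lemma finsum_poly_ring:
  assumes "finite I" "\<And>a. a \<in> I \<Longrightarrow> vars (p a) \<subseteq> V"
  shows "(\<Oplus>\<^bsub>poly_ring V\<^esub>a\<in>I. p a) = (\<Sum>a\<in>I. p a)"
proof -
  interpret cring "poly_ring V" by (rule cring_poly_ring)
  show ?thesis using assms
  proof (induction I)
    case (insert a I)
    then have "p \<in> I \<rightarrow> carrier (poly_ring V)" "p a \<in> carrier (poly_ring V)" by auto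
    then show ?case using insert by (simp add: finsum_insert)
  qed simp
qed

text \<open>
  On the right the coefficients range over all polynomials; restricting them to the variables \<open>V\<close>
  does not change them modulo the extended ideal.
\<close>

lemma rows_independent_quotient_iff:
  fixes \<bb> :: "'k::comm_ring_1 mpoly set"
  assumes prime: "primeideal \<bb> (poly_ring V)"
    and A: "\<And>a b. a < dim_row A \<Longrightarrow> b < dim_col A \<Longrightarrow> vars (A $$ (a, b)) \<subseteq> V"
  shows "rows_independent (poly_ring V Quot \<bb>) (map_mat (\<lambda>p. \<bb> +>\<^bsub>poly_ring V\<^esub> p) A) I \<longleftrightarrow>
    I \<subseteq> {..<dim_row A} \<and> indep_mod (extend_ideal V \<bb>) {..<dim_col A} I (\<lambda>a b. A $$ (a, b))"
proof (cases "I \<subseteq> {..<dim_row A}")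
  case False
  then show ?thesis by (simp add: rows_independent_def)
next
  case True
  then have finI: "finite I" using finite_subset by blast
  let ?R = "poly_ring V :: 'k mpoly ring" and ?Q = "poly_ring V Quot \<bb>"
  let ?\<pi> = "\<lambda>p. \<bb> +>\<^bsub>poly_ring V\<^esub> p"
  interpret primeideal \<bb> ?R by (rule prime)
  interpret \<pi>: ring_hom_cring ?R ?Q ?\<pi> by (rule rcos_ring_hom_cring)
  interpret full_prime "extend_ideal V \<bb>" by (rule full_prime_extend_ideal[OF prime])
  have zero_iff: "?\<pi> p = \<zero>\<^bsub>?Q\<^esub> \<longleftrightarrow> p \<in> extend_ideal V \<bb>" if "vars p \<subseteq> V" for p
    using that rcos_const_imp_mem[of p] a_rcos_const[of p]
    by (auto simp: FactRing_def mem_extend_ideal_iff)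
  have carrier: "carrier ?Q = ?\<pi> ` carrier ?R"
    by (auto simp: FactRing_def A_RCOSETS_def')
  have comb: "(\<Oplus>\<^bsub>?Q\<^esub>a\<in>I. ?\<pi> (n a) \<otimes>\<^bsub>?Q\<^esub> map_mat ?\<pi> A $$ (a, b)) = \<zero>\<^bsub>?Q\<^esub> \<longleftrightarrow>
      (\<Sum>a\<in>I. n a * A $$ (a, b)) \<in> extend_ideal V \<bb>"
    if n: "\<And>a. a \<in> I \<Longrightarrow> vars (n a) \<subseteq> V" and b: "b < dim_col A" for n b
  proof -
    have v: "vars (n a) \<subseteq> V" "vars (A $$ (a, b)) \<subseteq> V" "a < dim_row A" if "a \<in> I" for a
      using n[OF that] A[of a b] b subsetD[OF True that] by simp_all
    have "(\<Oplus>\<^bsub>?Q\<^esub>a\<in>I. ?\<pi> (n a) \<otimes>\<^bsub>?Q\<^esub> map_mat ?\<pi> A $$ (a, b)) = (\<Oplus>\<^bsub>?Q\<^esub>a\<in>I. ?\<pi> (n a * A $$ (a, b)))"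
    proof (rule \<pi>.S.finsum_cong')
      fix a assume "a \<in> I"
      then show "?\<pi> (n a) \<otimes>\<^bsub>?Q\<^esub> map_mat ?\<pi> A $$ (a, b) = ?\<pi> (n a * A $$ (a, b))"
        using v[of a] b \<pi>.hom_mult[of "n a" "A $$ (a, b)"] by simp
    next
      show "(\<lambda>a. ?\<pi> (n a * A $$ (a, b))) \<in> I \<rightarrow> carrier ?Q"
        using v by (intro Pi_I \<pi>.hom_closed) (simp add: vars_mult_subset)
    qed simp
    also have "\<dots> = ?\<pi> (\<Oplus>\<^bsub>?R\<^esub>a\<in>I. n a * A $$ (a, b))"
      using v by (intro \<pi>.hom_finsum[symmetric, unfolded comp_def]) (auto simp: vars_mult_subset)
    also have "(\<Oplus>\<^bsub>?R\<^esub>a\<in>I. n a * A $$ (a, b)) = (\<Sum>a\<in>I. n a * A $$ (a, b))"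
      using v by (intro finsum_poly_ring finI) (simp add: vars_mult_subset)
    finally show ?thesis using v by (simp add: zero_iff vars_sum_subset vars_mult_subset)
  qed
  show ?thesis
  proof (intro iffI conjI True; (elim conjE)?)
    assume L: "rows_independent ?Q (map_mat ?\<pi> A) I"
    show "indep_mod (extend_ideal V \<bb>) {..<dim_col A} I (\<lambda>a b. A $$ (a, b))"
      unfolding indep_mod_def
    proof (intro allI impI ballI)
      fix c a assume c: "\<forall>b\<in>{..<dim_col A}. (\<Sum>a\<in>I. c a * A $$ (a, b)) \<in> extend_ideal V \<bb>" and a: "a \<in> I"
      let ?n = "\<lambda>a. restrict_vars V (c a)"
      have cong: "?n a - c a \<in> extend_ideal V \<bb>" for a
        by (rule restrict_vars_congruent[OF is_ideal])
      have "(\<Sum>a\<in>I. ?n a * A $$ (a, b)) \<in> extend_ideal V \<bb>" if "b < dim_col A" for b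
      proof -
        have "(\<Sum>a\<in>I. ?n a * A $$ (a, b)) - (\<Sum>a\<in>I. c a * A $$ (a, b)) \<in> extend_ideal V \<bb>"
          by (intro sum_diff_mem mult_diff_mem cong) (simp add: zero_mem)
        moreover have "(\<Sum>a\<in>I. c a * A $$ (a, b)) \<in> extend_ideal V \<bb>" using c that by simp
        ultimately show ?thesis by (simp only: diff_mem_iff)
      qed
      then have "(\<Oplus>\<^bsub>?Q\<^esub>a\<in>I. ?\<pi> (?n a) \<otimes>\<^bsub>?Q\<^esub> map_mat ?\<pi> A $$ (a, b)) = \<zero>\<^bsub>?Q\<^esub>"
        if "b < dim_col (map_mat ?\<pi> A)" for b
        using comb[of ?n b, OF vars_restrict_vars] that by simp
      moreover have "(\<lambda>a. ?\<pi> (?n a)) \<in> I \<rightarrow> carrier ?Q"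
        unfolding carrier using vars_restrict_vars by (intro Pi_I imageI) simp
      ultimately have "?\<pi> (?n a) = \<zero>\<^bsub>?Q\<^esub>"
        using rows_independentD[OF L, of "\<lambda>a. ?\<pi> (?n a)" a] a by blast
      then show "c a \<in> extend_ideal V \<bb>"
        using zero_iff[OF vars_restrict_vars, of "c a"] diff_mem_iff[OF cong, of a] by simp
    qed
  next
    assume Rt: "indep_mod (extend_ideal V \<bb>) {..<dim_col A} I (\<lambda>a b. A $$ (a, b))"
    show "rows_independent ?Q (map_mat ?\<pi> A) I"
      unfolding rows_independent_def
    proof (intro conjI ballI impI)
      show "I \<subseteq> {..<dim_row (map_mat ?\<pi> A)}" using True by simp
      fix c a assume c: "c \<in> I \<rightarrow> carrier ?Q" and a: "a \<in> I"
        and zero: "\<forall>b<dim_col (map_mat ?\<pi> A). (\<Oplus>\<^bsub>?Q\<^esub>a\<in>I. c a \<otimes>\<^bsub>?Q\<^esub> map_mat ?\<pi> A $$ (a, b)) = \<zero>\<^bsub>?Q\<^esub>"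
      have "\<forall>a\<in>I. \<exists>p. vars p \<subseteq> V \<and> c a = ?\<pi> p"
      proof
        fix a assume "a \<in> I"
        then have "c a \<in> ?\<pi> ` carrier ?R" using c unfolding carrier by blast
        then obtain p where "p \<in> carrier ?R" "c a = ?\<pi> p" by blast
        then show "\<exists>p. vars p \<subseteq> V \<and> c a = ?\<pi> p" by (intro exI[of _ p]) simp
      qed
      from bchoice[OF this] obtain n where
        n: "\<And>a. a \<in> I \<Longrightarrow> vars (n a) \<subseteq> V" "\<And>a. a \<in> I \<Longrightarrow> c a = ?\<pi> (n a)"
        by auto
      have "(\<Sum>a\<in>I. n a * A $$ (a, b)) \<in> extend_ideal V \<bb>" if b: "b < dim_col A" for b
      proof -
        have "?\<pi> (n a) \<otimes>\<^bsub>?Q\<^esub> map_mat ?\<pi> A $$ (a, b) \<in> carrier ?Q" if "a \<in> I" for a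
          using n(1)[OF that] A[of a b] b that True by (auto intro!: \<pi>.hom_closed)
        then have "(\<Oplus>\<^bsub>?Q\<^esub>a\<in>I. c a \<otimes>\<^bsub>?Q\<^esub> map_mat ?\<pi> A $$ (a, b)) =
            (\<Oplus>\<^bsub>?Q\<^esub>a\<in>I. ?\<pi> (n a) \<otimes>\<^bsub>?Q\<^esub> map_mat ?\<pi> A $$ (a, b))"
          by (intro \<pi>.S.finsum_cong') (auto simp: n(2))
        then show ?thesis using comb[of n, OF n(1) b] zero b by simp
      qed
      then have "n a \<in> extend_ideal V \<bb>" using a by (intro indep_modD[OF Rt, of n]) auto
      then show "c a = \<zero>\<^bsub>?Q\<^esub>" using zero_iff[OF n(1)[OF a]] n(2)[OF a] by simp
    qed
  qed
qed

definition rank_mod :: "'a::comm_ring_1 set \<Rightarrow> nat \<Rightarrow> nat \<Rightarrow> (nat \<Rightarrow> nat \<Rightarrow> 'a) \<Rightarrow> nat" where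
  "rank_mod P k n v = Max {card I |I. I \<subseteq> {..<k} \<and> indep_mod P {..<n} I v}"

lemma rank_S_eq_rank_mod:
  assumes prime: "primeideal \<bb> (poly_ring (yvars s))"
    and A: "\<And>a b. a < dim_row A \<Longrightarrow> b < dim_col A \<Longrightarrow> vars (A $$ (a, b)) \<subseteq> yvars s"
  shows "rank_S s \<bb> A =
    rank_mod (extend_ideal (yvars s) \<bb>) (dim_row A) (dim_col A) (\<lambda>a b. A $$ (a, b))"
proof -
  let ?V = "yvars s" let ?Q = "coord_ring s \<bb>"
  let ?\<pi> = "\<lambda>p. \<bb> +>\<^bsub>poly_ring ?V\<^esub> p"
  interpret \<bb>: primeideal \<bb> "poly_ring ?V" by (rule prime)
  interpret D: "domain" ?Q unfolding coord_ring_def by (rule \<bb>.quotient_is_domain)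
  have A': "map_mat ?\<pi> A $$ (a, b) \<in> carrier ?Q" if "a < dim_row A" "b < dim_col A" for a b
    using that A[OF that] by (auto simp: coord_ring_def FactRing_def A_RCOSETS_def')
  have "map_mat (\<lambda>p. frac ?Q (?\<pi> p) \<one>\<^bsub>?Q\<^esub>) A = map_mat (\<lambda>x. frac ?Q x \<one>\<^bsub>?Q\<^esub>) (map_mat ?\<pi> A)"
    by (rule eq_matI) auto
  then have "rows_independent (frac_field ?Q) (map_mat (\<lambda>p. frac ?Q (?\<pi> p) \<one>\<^bsub>?Q\<^esub>) A) I \<longleftrightarrow>
      rows_independent ?Q (map_mat ?\<pi> A) I" for I
    using D.rows_independent_frac_field_iff[of "map_mat ?\<pi> A" I] A' by simp
  also have "\<dots> I \<longleftrightarrow> I \<subseteq> {..<dim_row A} \<and> indep_mod (extend_ideal ?V \<bb>) {..<dim_col A} I (\<lambda>a b. A $$ (a, b))" for I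
    unfolding coord_ring_def using rows_independent_quotient_iff[OF prime A] by blast
  finally show ?thesis by (simp add: rank_S_def rank_over_def rank_mod_def)
qed

lemma finite_indep_cards: "finite {card I |I. I \<subseteq> {..<k::nat} \<and> Q I}"
  by (rule finite_subset[of _ "card ` Pow {..<k}"]) auto

lemma rank_mod_ge:
  assumes "I \<subseteq> {..<k}" "indep_mod P {..<n} I v" shows "card I \<le> rank_mod P k n v"
  unfolding rank_mod_def by (rule Max_ge[OF finite_indep_cards]) (use assms in blast)

lemma rank_mod_attained:
  obtains I where "I \<subseteq> {..<k}" "indep_mod P {..<n} I v" "card I = rank_mod P k n v"
proof -
  have "rank_mod P k n v \<in> {card I |I. I \<subseteq> {..<k} \<and> indep_mod P {..<n} I v}"
    unfolding rank_mod_def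
    by (rule Max_in[OF finite_indep_cards]) (use indep_mod_empty in blast)
  then show ?thesis using that by auto
qed

section \<open>Rank of block matrices\<close>

definition rank_mat_mod :: "'a::comm_ring_1 set \<Rightarrow> 'a mat \<Rightarrow> nat" where
  "rank_mat_mod P A = rank_mod P (dim_row A) (dim_col A) (\<lambda>a b. A $$ (a, b))"

text \<open>
  Rows of different blocks have no columns in common, so a set of rows is independent if and only if
  its parts in the two blocks are.
\<close>

lemma (in full_ideal) rank_mat_mod_four_block:
  fixes A B :: "'a mat"
  defines "M \<equiv> four_block_mat A (0\<^sub>m (dim_row A) (dim_col B)) (0\<^sub>m (dim_row B) (dim_col A)) B"
  shows "rank_mat_mod P M = rank_mat_mod P A + rank_mat_mod P B"
proof -
  let ?m = "\<lambda>a b. M $$ (a, b)" and ?ra = "dim_row A" and ?ca = "dim_col A"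
  have dim: "dim_row M = ?ra + dim_row B" "dim_col M = ?ca + dim_col B"
    by (simp_all add: M_def)
  have entry: "M $$ (a, b) = (if a < ?ra then if b < ?ca then A $$ (a, b) else 0
      else if b < ?ca then 0 else B $$ (a - ?ra, b - ?ca))"
    if "a < dim_row M" "b < dim_col M" for a b
    using that unfolding M_def by (subst index_mat_four_block) auto
  let ?colsM = "{..<dim_col M}"
  have upper: "indep_mod P ?colsM I ?m \<longleftrightarrow> indep_mod P {..<?ca} I (\<lambda>a b. A $$ (a, b))" if "I \<subseteq> {..<?ra}" for I
  proof -
    have "(\<Sum>a\<in>I. c a * M $$ (a, b)) = (if b < ?ca then \<Sum>a\<in>I. c a * A $$ (a, b) else 0)"
      if "b < dim_col M" for b and c :: "nat \<Rightarrow> 'a"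
    proof -
      have "(\<Sum>a\<in>I. c a * M $$ (a, b)) = (\<Sum>a\<in>I. if b < ?ca then c a * A $$ (a, b) else 0)"
        using that \<open>I \<subseteq> _\<close> by (intro sum.cong refl) (auto simp: entry dim subset_iff)
      then show ?thesis by simp
    qed
    then have "(\<forall>b\<in>?colsM. (\<Sum>a\<in>I. c a * M $$ (a, b)) \<in> P) \<longleftrightarrow>
        (\<forall>b\<in>{..<?ca}. (\<Sum>a\<in>I. c a * A $$ (a, b)) \<in> P)" for c :: "nat \<Rightarrow> 'a"
      using zero_mem by (auto simp: dim)
    then show ?thesis by (simp only: indep_mod_def)
  qed
  have lower: "indep_mod P ?colsM ((+) ?ra ` I) ?m \<longleftrightarrow> indep_mod P {..<dim_col B} I (\<lambda>a b. B $$ (a, b))"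
    if "I \<subseteq> {..<dim_row B}" for I
  proof -
    have "bij_betw ((+) ?ra) I ((+) ?ra ` I)" by (simp add: bij_betw_def)
    then have "indep_mod P ?colsM ((+) ?ra ` I) ?m \<longleftrightarrow> indep_mod P ?colsM I (\<lambda>a. ?m (?ra + a))"
      by (rule indep_mod_reindex_rows)
    also have sum: "(\<Sum>a\<in>I. c a * M $$ (?ra + a, b)) = (if b < ?ca then 0 else \<Sum>a\<in>I. c a * B $$ (a, b - ?ca))"
      if "b < dim_col M" for b and c :: "nat \<Rightarrow> 'a"
    proof -
      have "(\<Sum>a\<in>I. c a * M $$ (?ra + a, b)) = (\<Sum>a\<in>I. if b < ?ca then 0 else c a * B $$ (a, b - ?ca))"
        using that \<open>I \<subseteq> _\<close> by (intro sum.cong refl) (auto simp: entry dim subset_iff)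
      then show ?thesis by simp
    qed
    have "(\<forall>b\<in>?colsM. (\<Sum>a\<in>I. c a * M $$ (?ra + a, b)) \<in> P) \<longleftrightarrow>
        (\<forall>b\<in>{..<dim_col B}. (\<Sum>a\<in>I. c a * B $$ (a, b)) \<in> P)" for c :: "nat \<Rightarrow> 'a"
    proof (intro iffI ballI)
      fix b assume *: "\<forall>b\<in>?colsM. (\<Sum>a\<in>I. c a * M $$ (?ra + a, b)) \<in> P" and "b \<in> {..<dim_col B}"
      then have "?ca + b < dim_col M" by (simp add: dim)
      then show "(\<Sum>a\<in>I. c a * B $$ (a, b)) \<in> P"
        using *[rule_format, of "?ca + b"] sum[of "?ca + b" c] by simp
    next
      fix b assume "\<forall>b\<in>{..<dim_col B}. (\<Sum>a\<in>I. c a * B $$ (a, b)) \<in> P" and "b \<in> ?colsM"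
      then show "(\<Sum>a\<in>I. c a * M $$ (?ra + a, b)) \<in> P"
        using sum[of b c] zero_mem by (simp add: dim)
    qed
    then have "indep_mod P ?colsM I (\<lambda>a. ?m (?ra + a)) \<longleftrightarrow> indep_mod P {..<dim_col B} I (\<lambda>a b. B $$ (a, b))"
      by (simp only: indep_mod_def)
    finally show ?thesis .
  qed
  show ?thesis
  proof (rule antisym)
    obtain I where I: "I \<subseteq> {..<dim_row M}" "indep_mod P ?colsM I ?m" "card I = rank_mat_mod P M"
      unfolding rank_mat_mod_def by (rule rank_mod_attained)
    have finI: "finite I" using I(1) finite_subset by blast
    let ?I1 = "I \<inter> {..<?ra}" and ?I2 = "{a. ?ra + a \<in> I}"
    have split: "I = ?I1 \<union> (+) ?ra ` ?I2"
    proof (intro equalityI subsetI)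
      fix a assume "a \<in> I"
      then show "a \<in> ?I1 \<union> (+) ?ra ` ?I2"
        by (cases "a < ?ra") (auto intro!: image_eqI[of _ _ "a - ?ra"])
    qed auto
    have I2: "?I2 \<subseteq> {..<dim_row B}" using I(1) by (auto simp: dim)
    have "card I = card ?I1 + card ((+) ?ra ` ?I2)"
      using finI finite_subset[OF I2] by (subst split, intro card_Un_disjoint) auto
    also have "card ((+) ?ra ` ?I2) = card ?I2" by (rule card_image) simp
    also have "card ?I1 \<le> rank_mat_mod P A"
      unfolding rank_mat_mod_def
      using indep_mod_subset[OF I(2) _ finI, of ?I1] upper[of ?I1] by (intro rank_mod_ge) auto
    also have "card ?I2 \<le> rank_mat_mod P B"
      unfolding rank_mat_mod_def
      using indep_mod_subset[OF I(2) _ finI, of "(+) ?ra ` ?I2"] lower[OF I2] I2 by (intro rank_mod_ge) auto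
    finally show "rank_mat_mod P M \<le> rank_mat_mod P A + rank_mat_mod P B"
      using I(3) by simp
  next
    obtain I1 where I1: "I1 \<subseteq> {..<?ra}" "indep_mod P {..<?ca} I1 (\<lambda>a b. A $$ (a, b))"
        "card I1 = rank_mat_mod P A"
      unfolding rank_mat_mod_def by (rule rank_mod_attained)
    obtain I2 where I2: "I2 \<subseteq> {..<dim_row B}" "indep_mod P {..<dim_col B} I2 (\<lambda>a b. B $$ (a, b))"
        "card I2 = rank_mat_mod P B"
      unfolding rank_mat_mod_def by (rule rank_mod_attained)
    let ?J = "(+) ?ra ` I2"
    have fin: "finite I1" "finite ?J" using I1(1) I2(1) finite_subset by blast+
    have disj: "I1 \<inter> ?J = {}" using I1(1) by auto
    have J: "a < dim_row M \<and> \<not> a < ?ra" if "a \<in> ?J" for a using that I2(1) by (auto simp: dim)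
    have I1': "a < dim_row M \<and> a < ?ra" if "a \<in> I1" for a using that I1(1) by (auto simp: dim)
    have "indep_mod P ?colsM (I1 \<union> ?J) ?m"
      unfolding indep_mod_def
    proof (intro allI impI)
      fix c assume c: "\<forall>b\<in>?colsM. (\<Sum>a\<in>I1 \<union> ?J. c a * M $$ (a, b)) \<in> P"
      have sum: "(\<Sum>a\<in>I1 \<union> ?J. c a * M $$ (a, b)) = (\<Sum>a\<in>I1. c a * M $$ (a, b)) + (\<Sum>a\<in>?J. c a * M $$ (a, b))" for b
        using fin disj by (rule sum.union_disjoint)
      have "(\<Sum>a\<in>I1. c a * M $$ (a, b)) \<in> P" if b: "b \<in> ?colsM" for b
      proof (cases "b < ?ca")
        case True
        then have "(\<Sum>a\<in>?J. c a * M $$ (a, b)) = 0" using J b by (intro sum.neutral) (simp add: entry)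
        then show ?thesis using bspec[OF c b] by (simp add: sum)
      next
        case False
        then have "(\<Sum>a\<in>I1. c a * M $$ (a, b)) = 0" using I1' b by (intro sum.neutral) (simp add: entry)
        then show ?thesis using zero_mem by simp
      qed
      moreover have "(\<Sum>a\<in>?J. c a * M $$ (a, b)) \<in> P" if b: "b \<in> ?colsM" for b
        using diff_mem[OF bspec[OF c b] calculation[OF b]] by (simp add: sum)
      moreover have "indep_mod P ?colsM I1 ?m" "indep_mod P ?colsM ?J ?m"
        using upper[OF I1(1)] lower[OF I2(1)] I1(2) I2(2) by blast+
      ultimately show "\<forall>a\<in>I1 \<union> ?J. c a \<in> P"
        using indep_modD[of P ?colsM I1 ?m c] indep_modD[of P ?colsM ?J ?m c] by blast
    qed
    moreover have "I1 \<union> ?J \<subseteq> {..<dim_row M}" using J I1' by auto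
    ultimately have "card (I1 \<union> ?J) \<le> rank_mat_mod P M"
      unfolding rank_mat_mod_def by (intro rank_mod_ge)
    moreover have "card (I1 \<union> ?J) = card I1 + card I2"
      using card_Un_disjoint[OF fin disj] by (simp add: card_image)
    ultimately show "rank_mat_mod P A + rank_mat_mod P B \<le> rank_mat_mod P M"
      using I1(3) I2(3) by simp
  qed
qed

lemma (in full_ideal) rank_mat_mod_diag_block:
  "rank_mat_mod P (diag_block_mat As) = sum_list (map (rank_mat_mod P) As)"
proof (induction As)
  case Nil
  let ?Z = "diag_block_mat [] :: 'a mat"
  obtain I where "I \<subseteq> {..<dim_row ?Z}" "indep_mod P {..<dim_col ?Z} I (\<lambda>a b. ?Z $$ (a, b))"
      "card I = rank_mat_mod P ?Z"
    unfolding rank_mat_mod_def by (rule rank_mod_attained)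
  then show ?case by simp
next
  case (Cons A As)
  then show ?case
    using rank_mat_mod_four_block[of A "diag_block_mat As"] by (simp add: Let_def)
qed

section \<open>Determinants of polynomial matrices\<close>

text \<open>Each term of the Leibniz expansion contains one entry from every row.\<close>

lemma homog_det:
  assumes "\<And>a c. a < n \<Longrightarrow> c < n \<Longrightarrow> homog (e a) (v a c)"
  shows "homog (\<Sum>a<n. e a) (det (mat n n (\<lambda>(a, c). v a c)))"
proof -
  let ?A = "mat n n (\<lambda>(a, c). v a c)"
  have "homog (0 + (\<Sum>a<n. e a)) (signof p * (\<Prod>a = 0..<n. ?A $$ (a, p a)))" if "p permutes {0..<n}" for p
    unfolding atLeast0LessThan
  proof (rule homog_mult)
    show "homog 0 (signof p)"
      by (cases p rule: sign_cases) (simp_all add: homog_one homog_uminus)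
    show "homog (\<Sum>a<n. e a) (\<Prod>a<n. ?A $$ (a, p a))"
      using permutes_in_image[OF that] assms by (intro homog_prod) auto
  qed
  then show ?thesis
    by (subst det_def'[of _ n]) (auto intro!: homog_sum)
qed

lemma vars_det:
  fixes v :: "nat \<Rightarrow> nat \<Rightarrow> 'k::comm_ring_1 mpoly"
  assumes "\<And>a c. a < n \<Longrightarrow> c < n \<Longrightarrow> vars (v a c) \<subseteq> V"
  shows "vars (det (mat n n (\<lambda>(a, c). v a c))) \<subseteq> V"
proof -
  let ?A = "mat n n (\<lambda>(a, c). v a c)"
  have "vars (signof p * (\<Prod>a = 0..<n. ?A $$ (a, p a))) \<subseteq> V" if "p permutes {0..<n}" for p
  proof (rule vars_mult_subset)
    show "vars (\<Prod>a = 0..<n. ?A $$ (a, p a)) \<subseteq> V"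
      using permutes_in_image[OF that] assms by (intro vars_prod_subset) simp
    show "vars (signof p :: 'k mpoly) \<subseteq> V"
      by (cases p rule: sign_cases) simp_all
  qed
  then show ?thesis
    by (subst det_def'[of _ n]) (simp, intro vars_sum_subset, simp)
qed

lemma homog_maximal_minor:
  fixes v :: "nat \<Rightarrow> nat \<Rightarrow> 'k::comm_ring_1 mpoly"
  assumes "\<And>a b. a < n \<Longrightarrow> b \<le> n \<Longrightarrow> homog (e a) (v a b)"
  shows "homog (\<Sum>a<n. e a) (maximal_minor n v j)"
proof -
  have "homog (\<Sum>a<n. e a) (det (mat n n (\<lambda>(a, c). v a (if c < j then c else Suc c))))"
    using assms by (intro homog_det) simp
  moreover have "(- 1) ^ j = (1 :: 'k mpoly) \<or> (- 1) ^ j = (- 1 :: 'k mpoly)"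
    by (cases "even j") auto
  ultimately show ?thesis
    unfolding maximal_minor_def by (auto intro: homog_uminus)
qed

lemma vars_maximal_minor:
  fixes v :: "nat \<Rightarrow> nat \<Rightarrow> 'k::comm_ring_1 mpoly"
  assumes "\<And>a b. a < n \<Longrightarrow> b \<le> n \<Longrightarrow> vars (v a b) \<subseteq> V"
  shows "vars (maximal_minor n v j) \<subseteq> V"
  unfolding maximal_minor_def
  using assms by (intro vars_mult_subset vars_power_subset vars_det) simp_all

section \<open>Derivatives of forms that are linear in a block\<close>

lemma partial_deriv_superset:
  assumes "finite A" "keys p \<subseteq> A"
  shows "partial_deriv v p = (\<Sum>u\<in>A. single (u - single v 1)
    (of_nat (lookup u v) * lookup p u))"
  unfolding partial_deriv_def by (rule sum.mono_neutral_left) (use assms in \<open>auto simp: in_keys_iff\<close>)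

lemma partial_deriv_zero [simp]: "partial_deriv v 0 = 0"
  by (simp add: partial_deriv_def)

lemma partial_deriv_add: "partial_deriv v (p + q) = partial_deriv v p + partial_deriv v q"
proof -
  let ?A = "keys p \<union> keys q"
  have "keys (p + q) \<subseteq> ?A" by (rule keys_add)
  then show ?thesis
    by (simp add: partial_deriv_superset[of ?A] lookup_add distrib_left single_add sum.distrib)
qed

lemma partial_deriv_sum: "partial_deriv v (sum p A) = (\<Sum>a\<in>A. partial_deriv v (p a))"
  by (induction A rule: infinite_finite_induct) (simp_all add: partial_deriv_add)

lemma partial_deriv_single:
  "partial_deriv v (single u c) =
    single (u - single v 1) (of_nat (lookup u v) * c)"
  by (subst partial_deriv_superset[of "{u}"]) (auto split: if_splits)

lemma partial_deriv_mult_const: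
  fixes c g :: "'k::comm_ring_1 mpoly"
  assumes "v \<notin> vars c"
  shows "partial_deriv v (c * g) = c * partial_deriv v g"
proof (induction c rule: mpoly_monomial_induct)
  case (monomial u d)
  then have u: "lookup u v = 0" using assms by (auto simp: vars_def in_keys_iff)
  show ?case
  proof (induction g rule: mpoly_monomial_induct)
    case (monomial w d')
    show ?case
    proof (cases "lookup w v = 0")
      case True
      then show ?thesis by (simp add: mult_single partial_deriv_single lookup_add u)
    next
      case False
      then have "u + w - single v 1 = u + (w - single v 1)"
        by (intro poly_mapping_eqI) (auto simp: lookup_add lookup_minus lookup_single when_def)
      then show ?thesis by (simp add: mult_single partial_deriv_single lookup_add u algebra_simps)
    qed
  qed (simp_all add: partial_deriv_add distrib_left)
qed (simp_all add: partial_deriv_add distrib_right)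

lemma partial_deriv_Var: "partial_deriv v (Var w) = (if v = w then 1 else 0)"
  by (simp add: Var_def partial_deriv_single lookup_single when_def)

lemma xdeg_eq_bdeg: "xdeg u i = lookup (bdeg u) (Suc i)"
  using mdeg_eq_bdeg_pair[of u] by (simp add: mdeg_def bdeg_pair_def)

lemma lookup_bdeg_block_ge:
  "lookup u v \<le> lookup (bdeg u) (block v)"
proof (cases "v \<in> keys u")
  case True
  then have "lookup (bdeg u) (block v) = lookup u v +
      (\<Sum>w\<in>keys u - {v}. lookup (single (block w) (lookup u w)) (block v))"
    unfolding bdeg_def lookup_sum by (subst sum.remove[of _ v]) simp_all
  then show ?thesis by simp
qed (simp add: in_keys_iff)

lemma linear_monomial_cases:
  assumes keys: "keys u \<subseteq> xvars m r \<union> yvars s"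
    and deg: "xdeg u = (\<lambda>l. if l = i then 1 else 0)"
  obtains b w where "b \<le> r i" "keys w \<subseteq> yvars s" "u = single (XVar i b) 1 + w"
proof -
  have "lookup (bdeg u) (Suc i) \<noteq> 0"
    using deg xdeg_eq_bdeg[of u i] by simp
  then obtain v where v: "v \<in> keys u"
      "lookup (single (block v) (lookup u v)) (Suc i) \<noteq> 0"
    unfolding bdeg_def lookup_sum by (rule sum.not_neutral_contains_not_neutral)
  then have "block v = Suc i" by (auto simp: lookup_single when_def split: if_splits)
  then obtain b where b: "v = XVar i b" by (cases v) auto
  have "b \<le> r i" using v(1) keys b by (auto simp: xvars_def xvars_of_def yvars_def)
  define w where "w = u - single v 1"
  have uw: "u = single v 1 + w"
    unfolding w_def using v(1)
    by (intro poly_mapping_eqI) (auto simp: lookup_add lookup_minus lookup_single when_def in_keys_iff)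
  have "lookup (bdeg w) (Suc l) = 0" for l
  proof -
    have "lookup (bdeg u) (Suc l) = (if l = i then 1 else 0)"
      using deg xdeg_eq_bdeg[of u l] by simp
    then show ?thesis
      unfolding uw bdeg_add by (simp add: lookup_add b lookup_single when_def split: if_splits)
  qed
  then have noX: "lookup w (XVar l j) = 0" for l j
    using lookup_bdeg_block_ge[of w "XVar l j"] by simp
  have keysw: "keys w \<subseteq> xvars m r \<union> yvars s"
  proof
    fix x assume "x \<in> keys w"
    then have "x \<in> keys u" by (simp add: uw in_keys_iff lookup_add)
    then show "x \<in> xvars m r \<union> yvars s" using keys by blast
  qed
  have "keys w \<subseteq> yvars s"
  proof
    fix v assume v: "v \<in> keys w"
    have "v \<noteq> XVar l j" for l j using v noX[of l j] by (auto simp: in_keys_iff)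
    moreover have "v \<in> xvars m r \<union> yvars s" using v keysw by blast
    ultimately show "v \<in> yvars s" by (auto simp: xvars_def xvars_of_def)
  qed
  then show ?thesis using that \<open>b \<le> r i\<close> uw b by blast
qed

text \<open>
  Euler's identity. Each monomial contains exactly one variable of the block, to the first power, so
  that it holds in every characteristic.
\<close>

lemma linear_form_expansion:
  fixes p :: "'k::comm_ring_1 mpoly"
  assumes vars: "vars p \<subseteq> xvars m r \<union> yvars s"
    and deg: "\<And>u. u \<in> keys p \<Longrightarrow> xdeg u = (\<lambda>l. if l = i then 1 else 0)"
  shows "p = (\<Sum>b\<le>r i. partial_deriv (XVar i b) p * Var (XVar i b))"
    and "vars (partial_deriv (XVar i b) p) \<subseteq> yvars s"
proof -
  have mon: "single u c = (\<Sum>b\<le>r i. partial_deriv (XVar i b) (single u c) * Var (XVar i b)) \<and>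
      vars (partial_deriv (XVar i b) (single u c)) \<subseteq> yvars s"
    if u: "u \<in> keys p" for u c b
  proof -
    have "keys u \<subseteq> xvars m r \<union> yvars s" using vars u by (auto simp: vars_def)
    then obtain b0 w where w: "b0 \<le> r i" "keys w \<subseteq> yvars s"
        "u = single (XVar i b0) 1 + w"
      using deg[OF u] by (rule linear_monomial_cases)
    have "XVar i b \<notin> keys w" for b using w(2) by (auto simp: yvars_def)
    then have lookup: "lookup u (XVar i b) = (if b = b0 then 1 else 0)" for b
      by (simp add: w(3) lookup_add lookup_single when_def in_keys_iff)
    have deriv: "partial_deriv (XVar i b) (single u c) =
        (if b = b0 then single w c else 0)" for b
      by (auto simp: partial_deriv_single lookup) (simp add: w(3))
    have "(\<Sum>b\<le>r i. partial_deriv (XVar i b) (single u c) * Var (XVar i b)) =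
        (\<Sum>b\<le>r i. if b = b0 then single w c * Var (XVar i b0) else 0)"
      by (rule sum.cong) (auto simp: deriv)
    also have "\<dots> = single u c"
      using w(1) by (simp add: Var_def mult_single w(3) add.commute)
    finally show ?thesis using w(2) by (simp add: deriv vars_single_subset)
  qed
  show "p = (\<Sum>b\<le>r i. partial_deriv (XVar i b) p * Var (XVar i b))"
  proof (induction p rule: mpoly_monomial_induct)
    case (monomial u c)
    then show ?case using mon by blast
  next
    case (add p q)
    then show ?case
      by (simp add: partial_deriv_add distrib_right sum.distrib)
  qed simp
  show "vars (partial_deriv (XVar i b) p) \<subseteq> yvars s"
  proof (induction p rule: mpoly_monomial_induct)
    case (monomial u c)
    then show ?case using mon by blast
  qed (simp_all add: partial_deriv_add vars_add_subset)
qed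

lemma homog_partial_deriv:
  assumes "homog d p" shows "homog (d - single (block v) 1) (partial_deriv v p)"
proof (induction p rule: mpoly_monomial_induct)
  case (monomial u c)
  then have d: "bdeg u = d" using assms by (simp add: homog_def)
  show ?case
  proof (cases "lookup u v = 0")
    case False
    then have "u = single v 1 + (u - single v 1)"
      by (intro poly_mapping_eqI) (auto simp: lookup_add lookup_minus lookup_single when_def)
    then have "d = single (block v) 1 + bdeg (u - single v 1)"
      using d bdeg_add[of "single v 1" "u - single v 1"] by simp
    then show ?thesis by (simp add: partial_deriv_single homog_single)
  qed (simp add: partial_deriv_single)
qed (simp_all add: partial_deriv_add homog_add)

section \<open>The Rees algebra on forms\<close>

lemma subst_y_hom: "comm_ring_hom (subst_y f)"
  unfolding subst_y_def by (rule mp_eval_hom[OF Const_hom])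

lemma subst_x_hom: "comm_ring_hom (subst_x g)"
  unfolding subst_x_def by (rule mp_eval_hom[OF Const_hom])

text \<open>
  The power of the variable \<open>t\<close> of the Rees algebra counts the variables \<open>y\<close>, so that on forms the
  kernel is given by a single condition in the coordinate ring.
\<close>

lemma rees_map_homog:
  assumes "homog d p"
  shows "rees_map f p = Polynomial.monom (subst_y f p) (lookup d 0)"
proof -
  let ?\<sigma> = "\<lambda>v. case v of XVar i j \<Rightarrow> [:Var (XVar i j):] | YVar j \<Rightarrow> Polynomial.monom (f j) 1"
  let ?\<tau> = "\<lambda>v. case v of XVar i j \<Rightarrow> Var (XVar i j) | YVar j \<Rightarrow> f j"
  let ?n = "\<lambda>v. if block v = 0 then 1 else 0"
  have \<sigma>: "?\<sigma> v = Polynomial.monom (?\<tau> v) (?n v)" for v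
    by (cases v) (auto simp: monom_0)
  have pow: "Polynomial.monom q n ^ k = Polynomial.monom (q ^ k) (k * n)" for q :: "'a mpoly" and n k
    by (induction k) (simp_all add: mult_monom one_pCons monom_0)
  have prod: "(\<Prod>v\<in>A. Polynomial.monom (q v) (n v)) = Polynomial.monom (\<Prod>v\<in>A. q v) (\<Sum>v\<in>A. n v)"
    for A and q :: "pvar \<Rightarrow> 'a mpoly" and n
    by (induction A rule: infinite_finite_induct) (simp_all add: mult_monom one_pCons monom_0)
  have mon: "mon_eval ?\<sigma> u = Polynomial.monom (mon_eval ?\<tau> u) (lookup (bdeg u) 0)" for u
  proof -
    have "(\<Sum>v\<in>keys u. lookup u v * ?n v) = lookup (bdeg u) 0"
      unfolding bdeg_def lookup_sum by (rule sum.cong) (auto simp: lookup_single when_def)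
    then show ?thesis unfolding mon_eval_def \<sigma> pow prod by simp
  qed
  have "rees_map f p = (\<Sum>u\<in>keys p. [:Const (lookup p u):] * mon_eval ?\<sigma> u)"
    unfolding rees_map_def mp_eval_def mon_eval_def ..
  also have "\<dots> = (\<Sum>u\<in>keys p.
      Polynomial.monom (Const (lookup p u) * mon_eval ?\<tau> u) (lookup d 0))"
    using assms by (intro sum.cong) (auto simp: mon homog_def smult_monom)
  also have "\<dots> = Polynomial.monom (subst_y f p) (lookup d 0)"
    unfolding subst_y_def mp_eval_def mon_eval_def[symmetric]
    by (rule poly_eqI) (simp add: coeff_sum coeff_monom)
  finally show ?thesis .
qed

lemma mem_rees_ideal_homog_iff:
  assumes "homog d p" "0 \<in> prod_ideal m r \<aa>"
  shows "p \<in> rees_ideal m r s \<aa> f \<longleftrightarrow> vars p \<subseteq> xvars m r \<union> yvars s \<and> subst_y f p \<in> prod_ideal m r \<aa>"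
  using assms(2) unfolding rees_ideal_def by (auto simp: rees_map_homog[OF assms(1)] coeff_monom)

section \<open>Evaluation of forms\<close>

lemma mon_eval_block:
  assumes "finite N" "block ` keys u \<subseteq> N"
  shows "mon_eval (\<lambda>v. \<tau> (block v)) u = (\<Prod>n\<in>N. \<tau> n ^ lookup (bdeg u) n)"
proof -
  have "(\<Prod>n\<in>N. \<tau> n ^ lookup (bdeg u) n) =
      (\<Prod>v\<in>keys u. \<Prod>n\<in>N. \<tau> n ^ lookup (single (block v) (lookup u v)) n)"
    unfolding bdeg_def lookup_sum power_sum by (rule prod.swap)
  also have "\<dots> = mon_eval (\<lambda>v. \<tau> (block v)) u"
    unfolding mon_eval_def
  proof (rule prod.cong[OF refl])
    fix v assume "v \<in> keys u"
    then have "block v \<in> N" using assms(2) by blast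
    have "(\<Prod>n\<in>N. \<tau> n ^ lookup (single (block v) (lookup u v)) n) =
        (\<Prod>n\<in>N. if n = block v then \<tau> n ^ lookup u v else 1)"
      by (rule prod.cong) (auto simp: lookup_single when_def)
    then show "(\<Prod>n\<in>N. \<tau> n ^ lookup (single (block v) (lookup u v)) n) =
        \<tau> (block v) ^ lookup u v"
      using \<open>block v \<in> N\<close> assms(1) by simp
  qed
  finally show ?thesis by simp
qed

lemma mon_eval_mult: "mon_eval (\<lambda>v. \<sigma> v * \<tau> v) u = mon_eval \<sigma> u * mon_eval \<tau> u"
  by (simp add: mon_eval_def power_mult_distrib prod.distrib)

text \<open>Each monomial of degree \<open>c\<close> contains \<open>lookup c n\<close> variables of block \<open>n\<close>, with multiplicity.\<close>

lemma mp_eval_scale: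
  assumes "homog c p" "finite N" "block ` vars p \<subseteq> N"
  shows "mp_eval Const (\<lambda>v. \<tau> (block v) * \<sigma> v) p = (\<Prod>n\<in>N. \<tau> n ^ lookup c n) * mp_eval Const \<sigma> p"
  unfolding mp_eval_def mon_eval_def[symmetric] sum_distrib_left
proof (rule sum.cong[OF refl])
  fix u assume u: "u \<in> keys p"
  then have "block ` keys u \<subseteq> N" "bdeg u = c"
    using assms by (auto simp: vars_def homog_def)
  then show "Const (lookup p u) * mon_eval (\<lambda>v. \<tau> (block v) * \<sigma> v) u =
      (\<Prod>n\<in>N. \<tau> n ^ lookup c n) * (Const (lookup p u) * mon_eval \<sigma> u)"
    by (simp add: mon_eval_mult mon_eval_block[OF assms(2)] mult.left_commute)
qed

lemma (in full_ideal) mp_eval_diff_mem: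
  assumes "\<And>v. v \<in> vars p \<Longrightarrow> \<sigma> v - \<tau> v \<in> P"
  shows "mp_eval \<phi> \<sigma> p - mp_eval \<phi> \<tau> p \<in> P"
proof -
  have "mon_eval \<sigma> u - mon_eval \<tau> u \<in> P" if "u \<in> keys p" for u
    unfolding mon_eval_def using assms that by (intro prod_diff_mem power_diff_mem) (auto simp: vars_def)
  then show ?thesis
    unfolding mp_eval_def mon_eval_def[symmetric]
    by (intro sum_diff_mem mult_diff_mem) (simp_all add: zero_mem)
qed

text \<open>The degree of a form of degree \<open>c\<close> after substituting forms of degree \<open>E n\<close> for the variables of block \<open>n\<close>.\<close>

definition subst_degree :: "(nat \<Rightarrow> nat \<Rightarrow>\<^sub>0 nat) \<Rightarrow> (nat \<Rightarrow>\<^sub>0 nat) \<Rightarrow> nat \<Rightarrow>\<^sub>0 nat" where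
  "subst_degree E c = (\<Sum>n\<in>keys c. \<Sum>_<lookup c n. E n)"

lemma subst_degree_add: "subst_degree E (c + c') = subst_degree E c + subst_degree E c'"
proof -
  let ?A = "keys c \<union> keys c'"
  have superset: "subst_degree E d = (\<Sum>n\<in>?A. \<Sum>_<lookup d n. E n)"
    if "keys d \<subseteq> ?A" for d
    unfolding subst_degree_def
    by (rule sum.mono_neutral_left) (use that in \<open>auto simp: in_keys_iff\<close>)
  show ?thesis
    using keys_add[of c c'] by (simp add: superset lookup_add distrib_right sum.distrib)
qed

lemma subst_degree_sum: "subst_degree E (sum g A) = (\<Sum>a\<in>A. subst_degree E (g a))"
proof -
  have "subst_degree E 0 = 0" by (simp add: subst_degree_def)
  then show ?thesis
    by (induction A rule: infinite_finite_induct) (simp_all add: subst_degree_add)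
qed

lemma subst_degree_single: "subst_degree E (single n k) = (\<Sum>_<k. E n)"
  by (cases "k = 0") (simp_all add: subst_degree_def)

lemma homog_mp_eval:
  assumes p: "homog c p" and \<sigma>: "\<And>v. v \<in> vars p \<Longrightarrow> homog (E (block v)) (\<sigma> v)"
  shows "homog (subst_degree E c) (mp_eval Const \<sigma> p)"
proof -
  have "homog (subst_degree E c) (Const (lookup p u) * mon_eval \<sigma> u)"
    if u: "u \<in> keys p" for u
  proof -
    have "c = bdeg u" using p u by (simp add: homog_def)
    have "subst_degree E c = (\<Sum>v\<in>keys u. \<Sum>_<lookup u v. E (block v))"
      unfolding \<open>c = bdeg u\<close> bdeg_def subst_degree_sum subst_degree_single ..
    moreover have "homog (\<Sum>v\<in>keys u. \<Sum>_<lookup u v. E (block v)) (mon_eval \<sigma> u)"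
      unfolding mon_eval_def
    proof (rule homog_prod, rule homog_power, rule \<sigma>)
      show "v \<in> vars p" if "v \<in> keys u" for v using u that by (auto simp: vars_def)
    qed
    ultimately have "homog (subst_degree E c) (mon_eval \<sigma> u)" by (simp only:)
    then have "homog (0 + subst_degree E c) (Const (lookup p u) * mon_eval \<sigma> u)"
      by (intro homog_mult homog_Const)
    then show ?thesis by (simp only: add_0_left)
  qed
  then show ?thesis
    unfolding mp_eval_def mon_eval_def[symmetric] by (rule homog_sum)
qed

section \<open>Row selections\<close>

lemma bij_betw_pick:
  assumes "finite I" shows "bij_betw (pick I) {..<card I} I"
proof -
  have "I \<subseteq> pick I ` {..<card I}"
  proof
    fix i assume i: "i \<in> I"
    then have "card {a \<in> I. a < i} < card I"
      using assms by (intro psubset_card_mono) auto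
    then have "pick I (card {a \<in> I. a < i}) \<in> pick I ` {..<card I}" by (intro imageI) simp
    then show "i \<in> pick I ` {..<card I}" unfolding pick_card_in_set[OF i] .
  qed
  moreover have "card (pick I ` {..<card I}) \<le> card I"
    using card_image_le[of "{..<card I}" "pick I"] by simp
  ultimately have img: "pick I ` {..<card I} = I"
    using card_seteq[of "pick I ` {..<card I}" I] by simp
  then have "inj_on (pick I) {..<card I}"
    by (intro eq_card_imp_inj_on) simp_all
  then show ?thesis using img by (simp add: bij_betw_def)
qed

lemma pick_Compl_singleton: "pick (- {j}) c = (if c < j then c else Suc c)"
proof -
  let ?i = "if c < j then c else Suc c"
  have "{a \<in> - {j}. a < ?i} = (if c < j then {..<c} else {..<Suc c} - {j})" by auto
  then have "card {a \<in> - {j}. a < ?i} = c" by simp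
  moreover have "?i \<in> - {j}" by auto
  ultimately show ?thesis using pick_card_in_set[of ?i "- {j}"] by simp
qed

lemma signed_minor_eq_maximal_minor:
  fixes A :: "'a::comm_ring_1 mat"
  assumes A: "A \<in> carrier_mat k (Suc n)" and I: "I \<subseteq> {..<k}" "card I = n" and j: "j \<le> n"
  shows "signed_minor A I j = maximal_minor n (\<lambda>a b. A $$ (pick I a, b)) j"
proof -
  have "{i. i < k \<and> i \<in> I} = I" using I(1) by auto
  moreover have "card {c. c < Suc n \<and> c \<noteq> j} = n"
  proof -
    have "{c. c < Suc n \<and> c \<noteq> j} = {..<Suc n} - {j}" by auto
    then show ?thesis using j by simp
  qed
  ultimately have "submatrix A I (- {j}) =
      mat n n (\<lambda>(a, c). A $$ (pick I a, if c < j then c else Suc c))"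
    using A I(2) by (simp add: submatrix_def pick_Compl_singleton)
  then show ?thesis by (simp add: signed_minor_def maximal_minor_def)
qed

section \<open>Tuples inverting a rational map\<close>

lemma xvars_cases:
  assumes "v \<in> xvars m r" obtains i j where "i < m" "j \<le> r i" "v = XVar i j"
  using assms by (auto simp: xvars_def xvars_of_def)

lemma lookup_bdeg_yvars:
  assumes "keys u \<subseteq> yvars s" shows "lookup (bdeg u) (Suc l) = 0"
  unfolding bdeg_def lookup_sum
  by (rule sum.neutral) (use assms in \<open>auto simp: yvars_def lookup_single\<close>)

locale dominant_rational_map =
  fixes m s :: nat and r :: "nat \<Rightarrow> nat"
    and \<aa> :: "nat \<Rightarrow> 'k::field mpoly set" and \<bb> :: "'k mpoly set" and f :: "nat \<Rightarrow> 'k mpoly"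
  assumes factors: "\<And>i. i < m \<Longrightarrow> integral_projective_variety (xvars_of r i) (\<aa> i)"
    and product: "integral_scheme m r (prod_ideal m r \<aa>)"
    and target: "integral_projective_variety (yvars s) \<bb>"
    and rational: "rational_map m r s \<aa> \<bb> f"
    and dominant: "dominant m r s \<aa> \<bb> f"
begin

abbreviation "J \<equiv> prod_ideal m r \<aa>"
abbreviation "PX \<equiv> extend_ideal (xvars m r) J"
abbreviation "PY \<equiv> extend_ideal (yvars s) \<bb>"
abbreviation "F \<equiv> subst_y f"
abbreviation "x i j \<equiv> (Var (XVar i j) :: 'k mpoly)"

lemma prime_J: "primeideal J (poly_ring (xvars m r))"
  using prime_prod_ideal(1)[OF factors product] .

lemma prime_b: "primeideal \<bb> (poly_ring (yvars s))"
  using target by (simp add: integral_projective_variety_def)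

sublocale PX: full_prime PX
  by (rule full_prime_extend_ideal[OF prime_J])

sublocale PY: full_prime PY
  by (rule full_prime_extend_ideal[OF prime_b])

sublocale F: comm_ring_hom F
  by (rule subst_y_hom)

lemma vars_x: "i < m \<Longrightarrow> j \<le> r i \<Longrightarrow> vars (x i j) \<subseteq> xvars m r"
  by (auto simp: xvars_def xvars_of_def)

lemma coordinate_nonzero:
  assumes "i < m" obtains j where "j \<le> r i" "x i j \<notin> PX"
  using prime_prod_ideal(2)[OF factors product] assms mem_extend_ideal_iff[OF vars_x] by blast

lemma zero_mem_J: "0 \<in> J"
  using ideal_polyD(2)[OF primeideal_polyD(1)[OF prime_J]] .

lemma vars_f: "j \<le> s \<Longrightarrow> vars (f j) \<subseteq> xvars m r"
  using rational by (auto simp: rational_map_def)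

lemma f_nonzero: obtains j where "j \<le> s" "f j \<notin> PX"
  using rational mem_extend_ideal_iff[OF vars_f] by (auto simp: rational_map_def)

lemma homog_f: "\<exists>d. \<forall>j\<le>s. homog d (f j)"
proof -
  obtain \<delta> where \<delta>: "\<And>j. j \<le> s \<Longrightarrow> homogeneous \<delta> (f j)"
    using rational by (auto simp: rational_map_def)
  obtain j where j: "j \<le> s" "f j \<notin> PX" by (rule f_nonzero)
  then have "f j \<noteq> 0" using PX.zero_mem by metis
  with \<delta>[OF j(1)] obtain d where "\<delta> = bdeg_pair d" by (metis homogeneous_imp_homog)
  then show ?thesis using \<delta> homogeneous_bdeg_pair by blast
qed

lemma F_Const: "F (Const c) = Const c"
  unfolding subst_y_def by (rule mp_eval_Const[OF Const_hom])

lemma F_Var: "F (Var v) = (case v of XVar i j \<Rightarrow> Var (XVar i j) | YVar j \<Rightarrow> f j)"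
  unfolding subst_y_def by (rule mp_eval_Var[OF Const_hom])

lemma vars_F: "vars p \<subseteq> xvars m r \<union> yvars s \<Longrightarrow> vars (F p) \<subseteq> xvars m r"
  unfolding subst_y_def
proof (rule vars_mp_eval_subset)
  fix v assume "vars p \<subseteq> xvars m r \<union> yvars s" "v \<in> vars p"
  then have "v \<in> xvars m r \<union> yvars s" by blast
  then show "vars (case v of XVar i j \<Rightarrow> Var (XVar i j) | YVar j \<Rightarrow> f j) \<subseteq> xvars m r"
    using vars_f by (cases v) (auto simp: yvars_def xvars_def xvars_of_def)
qed

lemma vars_F_y: "vars p \<subseteq> yvars s \<Longrightarrow> vars (F p) \<subseteq> xvars m r"
  by (rule vars_F) blast

text \<open>
  Dominance: pulling back along \<open>f\<close> embeds the forms on \<open>Y\<close> into the functions on the product, so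
  identities on \<open>Y\<close> can be checked after substituting \<open>f\<close>.
\<close>

lemma form_mem_PY_iff:
  assumes "vars p \<subseteq> yvars s" "homog e p"
  shows "p \<in> PY \<longleftrightarrow> F p \<in> PX"
proof -
  have "p \<in> \<bb> \<longleftrightarrow> F p \<in> J"
    using assms rational dominant homogeneous_bdeg_pair[of e p]
    unfolding rational_map_def dominant_def by (metis poly_ring_simps(1))
  then show ?thesis
    using mem_extend_ideal_iff[OF assms(1)] mem_extend_ideal_iff[OF vars_F_y[OF assms(1)]] by blast
qed

text \<open>
  The tuple \<open>D\<close> of forms on \<open>Y\<close> defines a rational map to the projective space of the \<open>i\<close>-th factor
  whose composition with \<open>f\<close> is the projection to this factor.
\<close>

definition inverts :: "nat \<Rightarrow> (nat \<Rightarrow> 'k mpoly) \<Rightarrow> bool" where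
  "inverts i D \<longleftrightarrow> (\<forall>j\<le>r i. vars (D j) \<subseteq> yvars s) \<and> (\<exists>e. \<forall>j\<le>r i. homog e (D j)) \<and>
     (\<exists>j\<le>r i. D j \<notin> PY) \<and> (\<forall>j\<le>r i. \<forall>l\<le>r i. F (D j) * x i l - F (D l) * x i j \<in> PX)"

lemma inverts_cong: "(\<And>j. j \<le> r i \<Longrightarrow> D j = D' j) \<Longrightarrow> inverts i D \<longleftrightarrow> inverts i D'"
  unfolding inverts_def by (auto simp: cong: conj_cong)

lemma inverse_map_imp_inverts:
  assumes g: "inverse_map m r s \<aa> \<bb> f g" and i: "i < m"
  shows "inverts i (g i)"
proof -
  have "\<exists>e. \<forall>j\<le>r i. vars (g i j) \<subseteq> yvars s \<and> homogeneous (\<lambda>_. 0, e) (g i j)"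
    and nz: "\<exists>j\<le>r i. g i j \<notin> \<bb>"
    using g i unfolding inverse_map_def rational_map_tuple_def by simp_all
  then obtain e where e: "\<And>j. j \<le> r i \<Longrightarrow> vars (g i j) \<subseteq> yvars s \<and> homogeneous (\<lambda>_. 0, e) (g i j)"
    by blast
  have "bdeg_pair (single 0 e) = (\<lambda>_. 0, e)"
    by (simp add: bdeg_pair_def lookup_single)
  then have homog: "homog (single 0 e) (g i j)" if "j \<le> r i" for j
    using e[OF that] by (metis homogeneous_bdeg_pair)
  have "F (g i j) * x i l - F (g i l) * x i j \<in> PX" if "j \<le> r i" "l \<le> r i" for j l
  proof -
    have "F (g i j) * x i l - F (g i l) * x i j \<in> J"
      using g i that unfolding inverse_map_def same_rational_map_def by blast
    then show ?thesis
      using ideal_polyD(1)[OF primeideal_polyD(1)[OF prime_J]] mem_extend_ideal_iff by blast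
  qed
  moreover obtain j where j: "j \<le> r i" "g i j \<notin> \<bb>" using nz by blast
  then have "g i j \<notin> PY" using e[OF j(1)] mem_extend_ideal_iff[of "g i j" "yvars s"] by simp
  ultimately show ?thesis unfolding inverts_def using e homog j(1) by blast
qed

text \<open>Both tuples become proportional to the coordinates of the factor after substituting \<open>f\<close>.\<close>

lemma inverts_unique:
  assumes D: "inverts i D" and D': "inverts i D'" and i: "i < m"
  shows "same_rational_map \<bb> (r i) D D'"
  unfolding same_rational_map_def
proof (intro allI impI)
  fix j l assume jl: "j \<le> r i" "l \<le> r i"
  obtain q where q: "q \<le> r i" "x i q \<notin> PX" using coordinate_nonzero[OF i] .
  let ?X = "x i q"
  have P: "F (D a) * ?X - F (D q) * x i a \<in> PX" "F (D' a) * ?X - F (D' q) * x i a \<in> PX"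
    if "a \<le> r i" for a
    using D D' that q(1) unfolding inverts_def by blast+
  have DD': "F (D a) * ?X * (F (D' b) * ?X) - F (D q) * x i a * (F (D' q) * x i b) \<in> PX"
    if "a \<le> r i" "b \<le> r i" for a b
    using P(1)[OF that(1)] P(2)[OF that(2)] by (rule PX.mult_diff_mem)
  have "(F (D j) * ?X * (F (D' l) * ?X) - F (D q) * x i j * (F (D' q) * x i l)) -
      (F (D l) * ?X * (F (D' j) * ?X) - F (D q) * x i l * (F (D' q) * x i j)) \<in> PX"
    using DD'[OF jl] DD'[OF jl(2,1)] by (rule PX.diff_mem)
  also have "(F (D j) * ?X * (F (D' l) * ?X) - F (D q) * x i j * (F (D' q) * x i l)) -
      (F (D l) * ?X * (F (D' j) * ?X) - F (D q) * x i l * (F (D' q) * x i j)) =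
      F (D j * D' l - D l * D' j) * (?X * ?X)"
    by (simp add: F.hom_minus F.hom_mult algebra_simps)
  finally have mem: "F (D j * D' l - D l * D' j) \<in> PX"
    using q(2) PX.prime by blast
  obtain e where e: "\<forall>j\<le>r i. homog e (D j)" using D unfolding inverts_def by blast
  obtain e' where e': "\<forall>j\<le>r i. homog e' (D' j)" using D' unfolding inverts_def by blast
  have "homog (e + e') (D j * D' l - D l * D' j)"
    using e e' jl by (intro homog_diff homog_mult) simp_all
  moreover have v: "vars (D j * D' l - D l * D' j) \<subseteq> yvars s"
    using D D' jl unfolding inverts_def by (intro vars_diff_subset vars_mult_subset) auto
  ultimately show "D j * D' l - D l * D' j \<in> \<bb>"
    using form_mem_PY_iff mem mem_extend_ideal_iff[OF v] by blast
qed

text \<open>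
  A tuple that is an inverse on one side is an inverse. Let \<open>D\<close> invert \<open>f\<close> in each factor and fix in
  each block a coordinate \<open>t\<close> and the corresponding entry \<open>\<delta>\<close> of \<open>D\<close>, both nonzero. After
  substituting \<open>f\<close> the tuple \<open>t D\<close> is \<open>\<delta> x\<close>, so the value of a form \<open>p\<close> at \<open>D\<close> is its value at \<open>x\<close>
  times a quotient of monomials in \<open>\<delta>\<close> and \<open>t\<close>. In particular it vanishes for \<open>p\<close> in the ideal of a
  factor, and for the forms \<open>f\<close> the quotient is the same for all of them.
\<close>

lemma inverts_imp_inverse_map:
  assumes D: "\<And>i. i < m \<Longrightarrow> inverts i (D i)"
  shows "inverse_map m r s \<aa> \<bb> f D"
proof -
  have vD: "vars (D i j) \<subseteq> yvars s" if "i < m" "j \<le> r i" for i j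
    using D that unfolding inverts_def by blast
  have "\<forall>i. \<exists>e. i < m \<longrightarrow> (\<forall>j\<le>r i. homog e (D i j))" using D unfolding inverts_def by blast
  then obtain e where e: "\<And>i j. i < m \<Longrightarrow> j \<le> r i \<Longrightarrow> homog (e i) (D i j)" by metis
  have "\<forall>i. \<exists>j. i < m \<longrightarrow> j \<le> r i \<and> D i j \<notin> PY" using D unfolding inverts_def by blast
  then obtain jj where jj: "\<And>i. i < m \<Longrightarrow> jj i \<le> r i" "\<And>i. i < m \<Longrightarrow> D i (jj i) \<notin> PY" by metis
  have parallel: "F (D i j) * x i l - F (D i l) * x i j \<in> PX" if "i < m" "j \<le> r i" "l \<le> r i" for i j l
    using D that unfolding inverts_def by blast
  have nonzero_F: "F (D i j) \<notin> PX" if "i < m" "j \<le> r i" "D i j \<notin> PY" for i j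
    using form_mem_PY_iff[OF vD e] that by blast
  have t: "x i (jj i) \<notin> PX" if i: "i < m" for i
  proof
    assume *: "x i (jj i) \<in> PX"
    obtain l where l: "l \<le> r i" "x i l \<notin> PX" using coordinate_nonzero[OF i] .
    have "F (D i (jj i)) * x i l \<in> PX"
      using parallel[OF i jj(1)[OF i] l(1)] PX.mult_mem[OF *] PX.diff_mem_iff by blast
    then show False using PX.prime nonzero_F[OF i jj(1)[OF i] jj(2)[OF i]] l(2) by blast
  qed
  \<comment> \<open>Block \<open>i\<close> is numbered \<open>i + 1\<close> in degrees, which explains the shift by one.\<close>
  define N where "N = Suc ` {..<m}"
  define T where "T c = (\<Prod>n\<in>N. x (n - 1) (jj (n - 1)) ^ lookup c n)" for c
  define \<Delta> where "\<Delta> c = (\<Prod>n\<in>N. F (D (n - 1) (jj (n - 1))) ^ lookup c n)" for c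
  have T: "T c \<notin> PX" for c
    unfolding T_def using t by (intro PX.prod_not_mem PX.power_not_mem) (auto simp: N_def)
  have \<Delta>: "\<Delta> c \<notin> PX" for c
    unfolding \<Delta>_def using nonzero_F jj by (intro PX.prod_not_mem PX.power_not_mem) (auto simp: N_def)
  have scale: "T c * F (subst_x D p) - \<Delta> c * p \<in> PX" if p: "vars p \<subseteq> xvars m r" "homog c p" for c p
  proof -
    let ?\<sigma> = "F \<circ> (\<lambda>v. case v of XVar i j \<Rightarrow> D i j | YVar j \<Rightarrow> Var (YVar j))"
    have "F \<circ> Const = Const" by (simp add: fun_eq_iff F_Const)
    then have "F (subst_x D p) = mp_eval Const ?\<sigma> p"
      unfolding subst_x_def by (subst hom_mp_eval[OF subst_y_hom Const_hom]) (simp only:)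
    moreover have N: "finite N" "block ` vars p \<subseteq> N"
      using p(1) by (auto simp: N_def xvars_def xvars_of_def)
    ultimately have "T c * F (subst_x D p) =
        mp_eval Const (\<lambda>v. x (block v - 1) (jj (block v - 1)) * ?\<sigma> v) p"
      using mp_eval_scale[OF p(2) N, of "\<lambda>n. x (n - 1) (jj (n - 1))" ?\<sigma>] by (simp add: T_def)
    moreover have "\<Delta> c * p = mp_eval Const (\<lambda>v. F (D (block v - 1) (jj (block v - 1))) * Var v) p"
      using mp_eval_scale[OF p(2) N, of "\<lambda>n. F (D (n - 1) (jj (n - 1)))" Var] by (simp add: \<Delta>_def mp_eval_Const_Var)
    moreover have "x (block v - 1) (jj (block v - 1)) * ?\<sigma> v - F (D (block v - 1) (jj (block v - 1))) * Var v \<in> PX"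
      if "v \<in> vars p" for v
    proof -
      have "v \<in> xvars m r" using that p(1) by blast
      then obtain i j where v: "i < m" "j \<le> r i" "v = XVar i j" by (rule xvars_cases)
      then show ?thesis
        using PX.uminus_mem[OF parallel[OF v(1) jj(1)[OF v(1)] v(2)]] by (simp add: mult.commute)
    qed
    ultimately show ?thesis using PX.mp_eval_diff_mem[of p] by (simp only:)
  qed
  have vsub: "vars (subst_x D p) \<subseteq> yvars s" if "vars p \<subseteq> xvars m r" for p
    unfolding subst_x_def
  proof (rule vars_mp_eval_subset)
    fix v assume "v \<in> vars p"
    then have "v \<in> xvars m r" using that by blast
    then obtain i j where "i < m" "j \<le> r i" "v = XVar i j" by (rule xvars_cases)
    then show "vars (case v of XVar i j \<Rightarrow> D i j | YVar j \<Rightarrow> Var (YVar j)) \<subseteq> yvars s"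
      using vD by simp
  qed
  let ?E = "\<lambda>n. e (n - 1)"
  have hsub: "homog (subst_degree ?E c) (subst_x D p)" if "vars p \<subseteq> xvars m r" "homog c p" for c p
    unfolding subst_x_def
  proof (rule homog_mp_eval[OF that(2)])
    fix v assume "v \<in> vars p"
    then have "v \<in> xvars m r" using that(1) by blast
    then obtain i j where "i < m" "j \<le> r i" "v = XVar i j" by (rule xvars_cases)
    then show "homog (?E (block v)) (case v of XVar i j \<Rightarrow> D i j | YVar j \<Rightarrow> Var (YVar j))"
      using e by simp
  qed
  have ideal: "subst_x D p \<in> \<bb>" if i: "i < m" and p: "p \<in> \<aa> i" for i p
  proof -
    have id: "homogeneous_ideal (\<aa> l) (xvars_of r l)" if "l < m" for l
      using factors[OF that] by (simp add: integral_projective_variety_def)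
    have v\<aa>: "\<aa> l \<subseteq> {p. vars p \<subseteq> xvars_of r l}" if "l < m" for l
      using ideal_polyD(1) id[OF that] unfolding homogeneous_ideal_def by blast
    interpret S: comm_ring_hom "subst_x D" by (rule subst_x_hom)
    have form: "subst_x D (component c p) \<in> \<bb>" for c
    proof -
      have c: "component c p \<in> \<aa> i" using id[OF i] p by (simp add: homogeneous_ideal_iff)
      then have "component c p \<in> J" using subset_prod_ideal[OF v\<aa> i] by blast
      have "vars (component c p) \<subseteq> xvars_of r i" using c v\<aa>[OF i] by blast
      then have v: "vars (component c p) \<subseteq> xvars m r" using i by (auto simp: xvars_def)
      then have "component c p \<in> PX" using \<open>component c p \<in> J\<close> mem_extend_ideal_iff by blast
      then have "T c * F (subst_x D (component c p)) \<in> PX"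
        using scale[OF v homog_component] PX.mult_mem PX.diff_mem_iff by blast
      then have "F (subst_x D (component c p)) \<in> PX" using T PX.prime by blast
      then show ?thesis
        using form_mem_PY_iff[OF vsub[OF v] hsub[OF v homog_component]] mem_extend_ideal_iff[OF vsub[OF v]]
        by blast
    qed
    have "subst_x D p = subst_x D (\<Sum>c\<in>bdeg ` keys p. component c p)"
      by (simp add: sum_component)
    also have "\<dots> = (\<Sum>c\<in>bdeg ` keys p. subst_x D (component c p))"
      by (rule S.hom_sum)
    also have "\<dots> \<in> \<bb>"
      using form by (intro ideal_poly_sum[OF primeideal_polyD(1)[OF prime_b]])
    finally show ?thesis .
  qed
  have tuple: "rational_map_tuple m r s \<aa> \<bb> D"
    unfolding rational_map_tuple_def
  proof (intro allI impI conjI ballI)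
    fix i assume i: "i < m"
    have "D i (jj i) \<noteq> 0" using jj(2)[OF i] PY.zero_mem by metis
    then obtain u where u: "u \<in> keys (D i (jj i))"
      using keys_eq_empty by blast
    then have "bdeg u = e i" "keys u \<subseteq> yvars s"
      using e[OF i jj(1)[OF i]] vD[OF i jj(1)[OF i]] by (auto simp: homog_def vars_def)
    then have "lookup (e i) (Suc l) = 0" for l using lookup_bdeg_yvars by metis
    then have "bdeg_pair (e i) = (\<lambda>_. 0, lookup (e i) 0)"
      by (simp add: bdeg_pair_def)
    then have "homogeneous (\<lambda>_. 0, lookup (e i) 0) (D i j)" if "j \<le> r i" for j
      using e[OF i that] by (metis homogeneous_bdeg_pair)
    then show "\<exists>e. \<forall>j\<le>r i. D i j \<in> carrier (poly_ring (yvars s)) \<and> homogeneous (\<lambda>_. 0, e) (D i j)"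
      using vD[OF i] by auto
    show "\<exists>j\<le>r i. D i j \<notin> \<bb>"
      using jj[OF i] mem_extend_ideal_iff[OF vD[OF i jj(1)[OF i]]] by blast
    show "subst_x D p \<in> \<bb>" if "p \<in> \<aa> i" for p using ideal[OF i that] .
  qed
  have left: "(\<exists>j\<le>r i. F (D i j) \<notin> J) \<and> same_rational_map J (r i) (\<lambda>j. F (D i j)) (\<lambda>j. x i j)"
    if i: "i < m" for i
  proof
    show "\<exists>j\<le>r i. F (D i j) \<notin> J"
      using nonzero_F[OF i jj(1)[OF i] jj(2)[OF i]] jj(1)[OF i]
        mem_extend_ideal_iff[OF vars_F_y[OF vD[OF i jj(1)[OF i]]]] by blast
    show "same_rational_map J (r i) (\<lambda>j. F (D i j)) (\<lambda>j. x i j)"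
      unfolding same_rational_map_def
    proof (intro allI impI)
      fix j l assume jl: "j \<le> r i" "l \<le> r i"
      have "vars (F (D i j) * x i l - F (D i l) * x i j) \<subseteq> xvars m r"
        using jl i by (intro vars_diff_subset vars_mult_subset vars_F_y vD vars_x)
      then show "F (D i j) * x i l - F (D i l) * x i j \<in> J"
        using parallel[OF i jl] mem_extend_ideal_iff by blast
    qed
  qed
  obtain d where d: "\<And>j. j \<le> s \<Longrightarrow> homog d (f j)" using homog_f by blast
  have sf: "T d * F (subst_x D (f j)) - \<Delta> d * f j \<in> PX" if "j \<le> s" for j
    using scale[OF vars_f d] that by blast
  have right1: "\<exists>j\<le>s. subst_x D (f j) \<notin> \<bb>"
  proof -
    obtain j where j: "j \<le> s" "f j \<notin> PX" by (rule f_nonzero)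
    have "F (subst_x D (f j)) \<notin> PX"
    proof
      assume "F (subst_x D (f j)) \<in> PX"
      then have "\<Delta> d * f j \<in> PX" using sf[OF j(1)] PX.mult_mem PX.diff_mem_iff by blast
      then show False using PX.prime \<Delta> j(2) by blast
    qed
    then have "subst_x D (f j) \<notin> \<bb>"
      using form_mem_PY_iff[OF vsub[OF vars_f] hsub[OF vars_f d]] mem_extend_ideal_iff[OF vsub[OF vars_f]] j(1)
      by blast
    then show ?thesis using j(1) by blast
  qed
  have right2: "same_rational_map \<bb> s (\<lambda>j. subst_x D (f j)) (\<lambda>j. Var (YVar j))"
    unfolding same_rational_map_def
  proof (intro allI impI)
    fix j l assume jl: "j \<le> s" "l \<le> s"
    let ?w = "subst_x D (f j) * Var (YVar l) - subst_x D (f l) * Var (YVar j)"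
    have v: "vars ?w \<subseteq> yvars s"
      using jl vsub[OF vars_f] by (intro vars_diff_subset vars_mult_subset) (auto simp: yvars_def)
    have "homog (subst_degree ?E d) (subst_x D (f a))" if "a \<le> s" for a
      using hsub vars_f d that by blast
    from homog_mult[OF this[OF jl(1)] homog_Var[of "YVar l"]] homog_mult[OF this[OF jl(2)] homog_Var[of "YVar j"]]
    have h: "homog (subst_degree ?E d + single 0 1) ?w"
      by (intro homog_diff) simp_all
    have "(T d * F (subst_x D (f j)) - \<Delta> d * f j) * f l - (T d * F (subst_x D (f l)) - \<Delta> d * f l) * f j \<in> PX"
      using PX.mult_mem'[OF sf[OF jl(1)]] PX.mult_mem'[OF sf[OF jl(2)]] by (rule PX.diff_mem)
    also have "(T d * F (subst_x D (f j)) - \<Delta> d * f j) * f l - (T d * F (subst_x D (f l)) - \<Delta> d * f l) * f j =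
        T d * F ?w"
      by (simp add: F.hom_minus F.hom_mult F_Var algebra_simps)
    finally have "F ?w \<in> PX" using PX.prime T by blast
    then show "?w \<in> \<bb>" using form_mem_PY_iff[OF v h] mem_extend_ideal_iff[OF v] by blast
  qed
  show ?thesis
    unfolding inverse_map_def using tuple left right1 right2 by blast
qed

end

section \<open>The Jacobian dual matrices\<close>

locale jacobian_dual_matrices = dominant_rational_map m s r \<aa> \<bb> f
  for m s r and \<aa> :: "nat \<Rightarrow> 'k::field mpoly set" and \<bb> f +
  fixes k :: "nat \<Rightarrow> nat" and h :: "nat \<Rightarrow> nat \<Rightarrow> 'k mpoly"
  assumes generators: "\<And>i. i < m \<Longrightarrow> minimal_generators s (linear_part m r s \<aa> f i) (k i) (h i)"
begin

definition \<psi> :: "nat \<Rightarrow> nat \<Rightarrow> nat \<Rightarrow> 'k mpoly" where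
  "\<psi> i a b = partial_deriv (XVar i b) (h i a)"

lemma generator_linear:
  assumes "i < m" "a < k i"
  shows "h i a \<in> linear_part m r s \<aa> f i"
proof -
  have "h i a = (\<Sum>g\<in>h i ` {..<k i}. (if g = h i a then 1 else 0) * g)"
    using assms(2) by (simp add: if_distrib[of "\<lambda>z. z * _"] cong: if_cong)
  then have "h i a \<in> y_span s (h i ` {..<k i})"
    unfolding y_span_def
    by (intro CollectI exI[of _ "\<lambda>g. if g = h i a then 1 else 0"] conjI) simp_all
  then show ?thesis using generators[OF assms(1)] by (simp add: minimal_generators_def)
qed

lemma generator_expansion:
  assumes "i < m" "a < k i"
  shows "h i a = (\<Sum>b\<le>r i. \<psi> i a b * x i b)" and "vars (\<psi> i a b) \<subseteq> yvars s"
proof -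
  have *: "vars (h i a) \<subseteq> xvars m r \<union> yvars s"
      "\<And>u. u \<in> keys (h i a) \<Longrightarrow> xdeg u = (\<lambda>l. if l = i then 1 else 0)"
    using generator_linear[OF assms] by (auto simp: linear_part_def rees_ideal_def)
  show "h i a = (\<Sum>b\<le>r i. \<psi> i a b * x i b)" "vars (\<psi> i a b) \<subseteq> yvars s"
    unfolding \<psi>_def by (rule linear_form_expansion[OF *], assumption)+
qed

lemma homog_generator:
  assumes "i < m" "a < k i" obtains d where "homog d (h i a)"
  using generators[OF assms(1)] assms(2) homogeneous_imp_homog
  unfolding minimal_generators_def by metis

lemma homog_\<psi>:
  assumes "i < m" "a < k i" obtains e where "\<And>b. homog e (\<psi> i a b)"
proof -
  obtain d where "homog d (h i a)" using homog_generator[OF assms] .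
  then have "homog (d - single (Suc i) 1) (\<psi> i a b)" for b
    unfolding \<psi>_def using homog_partial_deriv[of d "h i a" "XVar i b"] by simp
  then show ?thesis using that by blast
qed

text \<open>The generators lie in the kernel of the map to the Rees algebra.\<close>

lemma \<psi>_coordinates:
  assumes "i < m" "a < k i"
  shows "(\<Sum>b\<le>r i. F (\<psi> i a b) * x i b) \<in> PX"
proof -
  obtain d where d: "homog d (h i a)" using homog_generator[OF assms] .
  have "h i a \<in> rees_ideal m r s \<aa> f" using generator_linear[OF assms] by (simp add: linear_part_def)
  then have "vars (h i a) \<subseteq> xvars m r \<union> yvars s" "F (h i a) \<in> J"
    using mem_rees_ideal_homog_iff[OF d zero_mem_J] by auto
  then have "F (h i a) \<in> PX" using mem_extend_ideal_iff vars_F by blast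
  moreover have "F (h i a) = F (\<Sum>b\<le>r i. \<psi> i a b * x i b)"
    using generator_expansion(1)[OF assms] by simp
  moreover have "\<dots> = (\<Sum>b\<le>r i. F (\<psi> i a b) * x i b)"
    by (simp add: F.hom_sum F.hom_mult F_Var)
  ultimately show ?thesis by simp
qed

text \<open>The coordinates are a nonzero vector in the kernel, so the columns are dependent.\<close>

lemma indep_rows_card_le:
  assumes i: "i < m" and I: "I \<subseteq> {..<k i}" "indep_mod PY {..r i} I (\<psi> i)"
  shows "card I \<le> r i"
proof (rule ccontr)
  let ?n = "Suc (r i)"
  assume "\<not> card I \<le> r i"
  then obtain I' where I': "I' \<subseteq> I" "card I' = ?n" "finite I'"
    by (meson not_less_eq_eq obtain_subset_with_card_n)
  have "indep_mod PY {..r i} I' (\<psi> i)"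
    using PY.indep_mod_subset[OF I(2) I'(1)] finite_subset[OF I(1)] by blast
  moreover have "bij_betw (pick I') {..<?n} I'" using bij_betw_pick[OF I'(3)] I'(2) by simp
  ultimately have "indep_mod PY {..r i} {..<?n} (\<lambda>a. \<psi> i (pick I' a))"
    using indep_mod_reindex_rows by blast
  then obtain \<sigma> where \<sigma>: "\<And>c. c < ?n \<Longrightarrow> \<sigma> c \<in> {..r i}"
      and det: "det (mat ?n ?n (\<lambda>(a, c). \<psi> i (pick I' a) (\<sigma> c))) \<notin> PY"
    using PY.indep_mod_imp_minor by blast
  let ?v = "\<lambda>a c. \<psi> i (pick I' a) (\<sigma> c)"
  have row: "pick I' a < k i" if "a < ?n" for a
    using \<open>bij_betw (pick I') _ _\<close> that I'(1) I(1) by (auto simp: bij_betw_def)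
  have "inj_on \<sigma> {..<?n}"
    using det det_columns_not_inj[of \<sigma> ?n "\<lambda>a. \<psi> i (pick I' a)"] PY.zero_mem by metis
  moreover from this have "\<sigma> ` {..<?n} = {..r i}"
    using \<sigma> by (intro card_subset_eq) (auto simp: card_image)
  ultimately have bij: "bij_betw \<sigma> {..<?n} {..r i}" by (simp add: bij_betw_def)
  have "\<forall>a. \<exists>e. a < ?n \<longrightarrow> (\<forall>b. homog e (\<psi> i (pick I' a) b))"
    using homog_\<psi>[OF i row] by metis
  then obtain e where e: "\<And>a b. a < ?n \<Longrightarrow> homog (e a) (\<psi> i (pick I' a) b)" by metis
  have "homog (\<Sum>a<?n. e a) (det (mat ?n ?n (\<lambda>(a, c). ?v a c)))"
    using e by (intro homog_det)
  moreover have "vars (det (mat ?n ?n (\<lambda>(a, c). ?v a c))) \<subseteq> yvars s"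
    using generator_expansion(2)[OF i row] by (intro vars_det)
  ultimately have "F (det (mat ?n ?n (\<lambda>(a, c). ?v a c))) \<notin> PX"
    using form_mem_PY_iff det by blast
  also have "F (det (mat ?n ?n (\<lambda>(a, c). ?v a c))) = det (map_mat F (mat ?n ?n (\<lambda>(a, c). ?v a c)))"
    by (rule F.hom_det[symmetric])
  also have "map_mat F (mat ?n ?n (\<lambda>(a, c). ?v a c)) = mat ?n ?n (\<lambda>(a, c). F (?v a c))"
    by (rule eq_matI) auto
  finally have det_F: "det (mat ?n ?n (\<lambda>(a, c). F (?v a c))) \<notin> PX" .
  obtain q where q: "q \<le> r i" "x i q \<notin> PX" using coordinate_nonzero[OF i] .
  then obtain c where c: "c < ?n" "\<sigma> c = q"
    using bij by (metis atMost_iff bij_betw_imp_surj_on imageE lessThan_iff)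
  have "det (mat ?n ?n (\<lambda>(a, c). F (?v a c))) * x i (\<sigma> c) \<in> PX"
  proof (rule PX.det_mult_mem[OF _ c(1)])
    fix a assume a: "a < ?n"
    have "(\<Sum>c<?n. F (?v a c) * x i (\<sigma> c)) = (\<Sum>b\<le>r i. F (\<psi> i (pick I' a) b) * x i b)"
      by (rule sum.reindex_bij_betw[OF bij])
    then show "(\<Sum>c<?n. F (?v a c) * x i (\<sigma> c)) \<in> PX"
      using \<psi>_coordinates[OF i row[OF a]] by (simp only:)
  qed
  then show False using det_F q(2) c(2) PX.prime by blast
qed

text \<open>
  An inverting tuple \<open>D\<close> with nonzero entry \<open>D p\<close> yields the linear syzygies \<open>D p x l - D l x p\<close> of
  the coordinates, which are independent for \<open>l \<noteq> p\<close>. They are combinations of the generators.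
\<close>

lemma inverts_imp_indep_rows:
  assumes i: "i < m" and D: "inverts i D"
  obtains I where "I \<subseteq> {..<k i}" "indep_mod PY {..r i} I (\<psi> i)" "r i \<le> card I"
proof -
  obtain e where e: "\<And>j. j \<le> r i \<Longrightarrow> homog e (D j)" using D unfolding inverts_def by blast
  obtain p where p: "p \<le> r i" "D p \<notin> PY" using D unfolding inverts_def by blast
  have vD: "vars (D j) \<subseteq> yvars s" if "j \<le> r i" for j using D that unfolding inverts_def by blast
  define w where "w l = D p * x i l + (- D l) * x i p" for l
  define L where "L = {..r i} - {p}"
  have "D p \<noteq> 0" using p(2) PY.zero_mem by metis
  then obtain u where u: "u \<in> keys (D p)" using keys_eq_empty by blast
  then have "bdeg u = e" "keys u \<subseteq> yvars s"
    using e[OF p(1)] vD[OF p(1)] by (auto simp: homog_def vars_def)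
  then have ex: "lookup e (Suc l) = 0" for l using lookup_bdeg_yvars by metis
  have w: "w l \<in> linear_part m r s \<aa> f i" if l: "l \<le> r i" for l
  proof -
    have "homog (e + single (block (XVar i l)) 1) (D p * x i l)"
        "homog (e + single (block (XVar i p)) 1) ((- D l) * x i p)"
      by (intro homog_mult homog_Var homog_uminus e l p(1))+
    then have h: "homog (e + single (Suc i) 1) (w l)"
      unfolding w_def by (intro homog_add) simp_all
    have "vars (D p * x i l + (- D l) * x i p) \<subseteq> xvars m r \<union> yvars s"
      using vD[OF p(1)] vD[OF l] vars_x[OF i l] vars_x[OF i p(1)]
      by (intro vars_add_subset vars_mult_subset) auto
    moreover have v: "vars (F (w l)) \<subseteq> xvars m r" using calculation unfolding w_def by (rule vars_F)
    have "F (D p) * x i l - F (D l) * x i p \<in> PX" using D p(1) l unfolding inverts_def by blast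
    then have "F (w l) \<in> PX" by (simp add: w_def F.hom_add F.hom_mult F.hom_uminus F.hom_minus F_Var)
    then have "F (w l) \<in> J" using mem_extend_ideal_iff[OF v] by blast
    ultimately have "w l \<in> rees_ideal m r s \<aa> f"
      using mem_rees_ideal_homog_iff[OF h zero_mem_J] by (simp add: w_def)
    moreover have "xdeg u = (\<lambda>l. if l = i then 1 else 0)" if "u \<in> keys (w l)" for u
    proof
      fix l'
      have "bdeg u = e + single (Suc i) 1" using h that by (simp add: homog_def)
      then show "xdeg u l' = (if l' = i then 1 else 0)"
        by (simp add: xdeg_eq_bdeg lookup_add ex lookup_single when_def)
    qed
    ultimately show ?thesis by (simp add: linear_part_def)
  qed
  have inj: "inj_on (h i) {..<k i}" and span: "y_span s (h i ` {..<k i}) = linear_part m r s \<aa> f i"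
    using generators[OF i] by (simp_all add: minimal_generators_def)
  have "\<exists>q. (\<forall>a<k i. vars (q a) \<subseteq> yvars s) \<and> w l = (\<Sum>a<k i. q a * h i a)" if l: "l \<le> r i" for l
  proof -
    have "w l \<in> y_span s (h i ` {..<k i})" using w[OF l] span by simp
    then obtain c where "w l = (\<Sum>g\<in>h i ` {..<k i}. c g * g)" "\<forall>g\<in>h i ` {..<k i}. vars (c g) \<subseteq> yvars s"
      unfolding y_span_def by auto
    then show ?thesis
      by (intro exI[of _ "\<lambda>a. c (h i a)"]) (simp add: sum.reindex[OF inj])
  qed
  then have "\<forall>l. \<exists>q. l \<le> r i \<longrightarrow> (\<forall>a<k i. vars (q a) \<subseteq> yvars s) \<and> w l = (\<Sum>a<k i. q a * h i a)"
    by blast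
  then obtain q where q: "\<And>l a. l \<le> r i \<Longrightarrow> a < k i \<Longrightarrow> vars (q l a) \<subseteq> yvars s"
      "\<And>l. l \<le> r i \<Longrightarrow> w l = (\<Sum>a<k i. q l a * h i a)"
    by metis
  have notin: "XVar i b \<notin> vars p" if "vars p \<subseteq> yvars s" for p :: "'k mpoly" and b
    using that by (auto simp: yvars_def)
  define W where "W l b = partial_deriv (XVar i b) (w l)" for l b
  have comb: "W l b = (\<Sum>a\<in>{..<k i}. q l a * \<psi> i a b)" if "l \<in> L" for l b
    using that notin[OF q(1)] unfolding W_def \<psi>_def L_def
    by (subst q(2)) (auto simp: partial_deriv_sum partial_deriv_mult_const intro!: sum.cong)
  have W: "W l b = (if b = l then D p else 0) - (if b = p then D l else 0)" if "l \<in> L" for l b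
    using that notin[OF vD[OF p(1)]] notin[OF vD[of l]] unfolding W_def w_def L_def
    by (simp add: partial_deriv_add partial_deriv_mult_const partial_deriv_Var del: mult_minus_left)
  have "indep_mod PY {..r i} L W"
    unfolding indep_mod_def
  proof (intro allI impI ballI)
    fix c l assume c: "\<forall>b\<in>{..r i}. (\<Sum>l\<in>L. c l * W l b) \<in> PY" and l: "l \<in> L"
    have "(\<Sum>l'\<in>L. c l' * W l' l) = (\<Sum>l'\<in>L. if l' = l then c l * D p else 0)"
      using l W by (intro sum.cong) (auto simp: L_def)
    also have "\<dots> = c l * D p" using l by (simp add: L_def)
    finally have "c l * D p \<in> PY" using bspec[OF c, of l] l by (simp add: L_def)
    then show "c l \<in> PY" using p(2) PY.prime by blast
  qed
  then obtain I where I: "I \<subseteq> {..<k i}" "indep_mod PY {..r i} I (\<psi> i)" "card L \<le> card I"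
    using PY.indep_mod_combinations[of "{..<k i}" L "{..r i}" W q "\<psi> i"] comb by (auto simp: L_def)
  moreover have "card L = r i" using p(1) by (simp add: L_def)
  ultimately show ?thesis using that by simp
qed

lemma hom_maximal_minor:
  "F (maximal_minor n v j) = maximal_minor n (\<lambda>a b. F (v a b)) j"
proof -
  let ?A = "mat n n (\<lambda>(a, c). v a (if c < j then c else Suc c))"
  have "F (det ?A) = det (map_mat F ?A)" by (rule F.hom_det[symmetric])
  also have "map_mat F ?A = mat n n (\<lambda>(a, c). F (v a (if c < j then c else Suc c)))"
    by (rule eq_matI) auto
  finally show ?thesis
    by (simp add: maximal_minor_def F.hom_mult F.hom_power F.hom_uminus)
qed

text \<open>
  After substituting \<open>f\<close>, the coordinates and the signed minors of \<open>r\<close> independent rows both span the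
  one-dimensional space of vectors killed by these rows.
\<close>

lemma maximal_minors_invert:
  assumes i: "i < m" and I: "I \<subseteq> {..<k i}" "card I = r i" and indep: "indep_mod PY {..r i} I (\<psi> i)"
  shows "inverts i (maximal_minor (r i) (\<lambda>a. \<psi> i (pick I a)))"
proof -
  let ?v = "\<lambda>a. \<psi> i (pick I a)"
  have "finite I" using I(1) finite_subset by blast
  then have bij: "bij_betw (pick I) {..<r i} I" using bij_betw_pick[of I] I(2) by simp
  then have row: "pick I a < k i" if "a < r i" for a
    using that I(1) by (auto simp: bij_betw_def)
  have "\<forall>a. \<exists>e. a < r i \<longrightarrow> (\<forall>b. homog e (?v a b))"
    using homog_\<psi>[OF i row] by metis
  then obtain e where e: "\<And>a b. a < r i \<Longrightarrow> homog (e a) (?v a b)" by metis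
  have "vars (maximal_minor (r i) ?v j) \<subseteq> yvars s" for j
    using generator_expansion(2)[OF i row] by (intro vars_maximal_minor)
  moreover have "homog (\<Sum>a<r i. e a) (maximal_minor (r i) ?v j)" for j
    using e by (intro homog_maximal_minor)
  moreover have "indep_mod PY {..r i} {..<r i} ?v"
    using indep indep_mod_reindex_rows[OF bij] by blast
  then have "\<exists>j\<le>r i. maximal_minor (r i) ?v j \<notin> PY"
    by (rule PY.indep_mod_imp_maximal_minor)
  moreover have "F (maximal_minor (r i) ?v j) * x i l - F (maximal_minor (r i) ?v l) * x i j \<in> PX"
    if "j \<le> r i" "l \<le> r i" for j l
    unfolding hom_maximal_minor
    using \<psi>_coordinates[OF i row] that by (intro PX.maximal_minor_proportional)
  ultimately show ?thesis unfolding inverts_def by blast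
qed

lemma dim_jacobian_dual: "jacobian_dual r k h i \<in> carrier_mat (k i) (Suc (r i))"
  by (simp add: jacobian_dual_def)

lemma index_jacobian_dual: "a < k i \<Longrightarrow> b \<le> r i \<Longrightarrow> jacobian_dual r k h i $$ (a, b) = \<psi> i a b"
  by (simp add: jacobian_dual_def \<psi>_def)

lemma rank_S_eq_rank_mod_\<psi>:
  assumes A: "A \<in> carrier_mat n (Suc (r i))" and i: "i < m"
    and g: "\<And>a. a < n \<Longrightarrow> g a < k i" and entries: "\<And>a b. a < n \<Longrightarrow> b \<le> r i \<Longrightarrow> A $$ (a, b) = \<psi> i (g a) b"
  shows "rank_S s \<bb> A = rank_mod PY n (Suc (r i)) (\<lambda>a. \<psi> i (g a))"
proof -
  have "rank_S s \<bb> A = rank_mod PY (dim_row A) (dim_col A) (\<lambda>a b. A $$ (a, b))"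
    using A entries generator_expansion(2)[OF i g] by (intro rank_S_eq_rank_mod[OF prime_b]) simp
  also have "\<dots> = rank_mod PY n (Suc (r i)) (\<lambda>a. \<psi> i (g a))"
  proof -
    have "indep_mod PY {..<Suc (r i)} I (\<lambda>a b. A $$ (a, b)) \<longleftrightarrow> indep_mod PY {..<Suc (r i)} I (\<lambda>a. \<psi> i (g a))"
      if "I \<subseteq> {..<n}" for I
      using that entries by (intro indep_mod_cong) (auto simp: subset_iff)
    then show ?thesis unfolding rank_mod_def using A
      by (intro arg_cong[where f = Max] Collect_cong) (auto simp: carrier_matD[OF A])
  qed
  finally show ?thesis .
qed

lemma rank_jacobian_dual:
  "i < m \<Longrightarrow> rank_S s \<bb> (jacobian_dual r k h i) = rank_mod PY (k i) (Suc (r i)) (\<psi> i)"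
  by (rule rank_S_eq_rank_mod_\<psi>[where g = "\<lambda>a. a"]) (auto simp: dim_jacobian_dual index_jacobian_dual)

lemma rank_jacobian_dual_attained:
  assumes "i < m"
  obtains I where "I \<subseteq> {..<k i}" "indep_mod PY {..r i} I (\<psi> i)"
    "card I = rank_S s \<bb> (jacobian_dual r k h i)"
  using rank_mod_attained[of "k i" PY "Suc (r i)" "\<psi> i"] rank_jacobian_dual[OF assms]
  by (metis lessThan_Suc_atMost)

lemma rank_jacobian_dual_le: "i < m \<Longrightarrow> rank_S s \<bb> (jacobian_dual r k h i) \<le> r i"
  using rank_jacobian_dual_attained indep_rows_card_le by metis

lemma inverts_imp_rank:
  assumes "i < m" "inverts i D" shows "rank_S s \<bb> (jacobian_dual r k h i) = r i"
proof (rule antisym)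
  obtain I where "I \<subseteq> {..<k i}" "indep_mod PY {..r i} I (\<psi> i)" "r i \<le> card I"
    using inverts_imp_indep_rows[OF assms] .
  then show "r i \<le> rank_S s \<bb> (jacobian_dual r k h i)"
    using rank_mod_ge[of I "k i" PY "Suc (r i)" "\<psi> i"]
    by (simp add: rank_jacobian_dual[OF assms(1)] lessThan_Suc_atMost)
qed (rule rank_jacobian_dual_le[OF assms(1)])

lemma rank_full_jacobian_dual:
  "rank_S s \<bb> (full_jacobian_dual m r k h) = (\<Sum>i<m. rank_S s \<bb> (jacobian_dual r k h i))"
proof -
  let ?A = "full_jacobian_dual m r k h"
  have v: "vars (jacobian_dual r k h i $$ (a, b)) \<subseteq> yvars s"
    if "i < m" "a < dim_row (jacobian_dual r k h i)" "b < dim_col (jacobian_dual r k h i)" for i a b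
    using that generator_expansion(2)[OF that(1)] dim_jacobian_dual[of i]
    by (simp add: index_jacobian_dual)
  have "vars q \<subseteq> yvars s" if "q \<in> elements_mat ?A" for q
  proof -
    have "q = 0 \<or> (\<exists>i<m. q \<in> elements_mat (jacobian_dual r k h i))"
      using subsetD[OF elements_diag_block_mat that[unfolded full_jacobian_dual_def]] by auto
    then show ?thesis
    proof
      assume "\<exists>i<m. q \<in> elements_mat (jacobian_dual r k h i)"
      then obtain i where i: "i < m" "q \<in> elements_mat (jacobian_dual r k h i)" by blast
      then show ?thesis using v[OF i(1)] elements_matD[OF i(2)] by blast
    qed simp
  qed
  then have "vars (?A $$ (a, b)) \<subseteq> yvars s" if "a < dim_row ?A" "b < dim_col ?A" for a b
    using that elements_matI[of ?A "dim_row ?A" "dim_col ?A" a b] by auto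
  then have "rank_S s \<bb> ?A = rank_mat_mod PY ?A"
    unfolding rank_mat_mod_def by (rule rank_S_eq_rank_mod[OF prime_b])
  also have "\<dots> = (\<Sum>i<m. rank_mat_mod PY (jacobian_dual r k h i))"
    by (simp add: full_jacobian_dual_def PY.rank_mat_mod_diag_block comp_def
      interv_sum_list_conv_sum_set_nat atLeast0LessThan)
  also have "\<dots> = (\<Sum>i<m. rank_S s \<bb> (jacobian_dual r k h i))"
    unfolding rank_mat_mod_def using rank_S_eq_rank_mod[OF prime_b v] by (intro sum.cong) auto
  finally show ?thesis .
qed

lemma rank_submatrix_eq_iff:
  assumes i: "i < m" and I: "I \<subseteq> {..<k i}" "card I = r i"
  shows "rank_S s \<bb> (submatrix (jacobian_dual r k h i) I UNIV) = r i \<longleftrightarrow> indep_mod PY {..r i} I (\<psi> i)"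
proof -
  let ?A = "submatrix (jacobian_dual r k h i) I UNIV"
  have "finite I" using I(1) finite_subset by blast
  then have bij: "bij_betw (pick I) {..<r i} I" using bij_betw_pick[of I] I(2) by simp
  then have row: "pick I a < k i" if "a < r i" for a
    using that I(1) by (auto simp: bij_betw_def)
  have I_eq: "{a. a < k i \<and> a \<in> I} = I" using I(1) by auto
  then have card: "card {a. a < dim_row (jacobian_dual r k h i) \<and> a \<in> I} = r i"
      "card {b. b < dim_col (jacobian_dual r k h i) \<and> b \<in> UNIV} = Suc (r i)"
    using I(2) I_eq dim_jacobian_dual[of i] by simp_all
  have "rank_S s \<bb> ?A = rank_mod PY (r i) (Suc (r i)) (\<lambda>a. \<psi> i (pick I a))"
  proof (rule rank_S_eq_rank_mod_\<psi>[OF _ i row])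
    show "?A \<in> carrier_mat (r i) (Suc (r i))"
      using card by (intro carrier_matI) (simp_all add: dim_submatrix)
    show "?A $$ (a, b) = \<psi> i (pick I a) b" if "a < r i" "b \<le> r i" for a b
      using that row by (subst submatrix_index) (simp_all add: I_eq I(2) pick_UNIV index_jacobian_dual carrier_matD[OF dim_jacobian_dual])
  qed
  also have "\<dots> = r i \<longleftrightarrow> indep_mod PY {..<Suc (r i)} {..<r i} (\<lambda>a. \<psi> i (pick I a))"
  proof
    obtain L where L: "L \<subseteq> {..<r i}" "indep_mod PY {..<Suc (r i)} L (\<lambda>a. \<psi> i (pick I a))"
        "card L = rank_mod PY (r i) (Suc (r i)) (\<lambda>a. \<psi> i (pick I a))"
      by (rule rank_mod_attained)
    {
      assume "rank_mod PY (r i) (Suc (r i)) (\<lambda>a. \<psi> i (pick I a)) = r i"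
      then have "L = {..<r i}" using L by (intro card_subset_eq) auto
      then show "indep_mod PY {..<Suc (r i)} {..<r i} (\<lambda>a. \<psi> i (pick I a))" using L(2) by simp
    next
      assume "indep_mod PY {..<Suc (r i)} {..<r i} (\<lambda>a. \<psi> i (pick I a))"
      then have "r i \<le> rank_mod PY (r i) (Suc (r i)) (\<lambda>a. \<psi> i (pick I a))"
        using rank_mod_ge[of "{..<r i}"] by fastforce
      moreover have "card L \<le> r i" using card_mono[OF _ L(1)] by simp
      ultimately show "rank_mod PY (r i) (Suc (r i)) (\<lambda>a. \<psi> i (pick I a)) = r i" using L(3) by simp
    }
  qed
  also have "\<dots> \<longleftrightarrow> indep_mod PY {..r i} I (\<psi> i)"
    using indep_mod_reindex_rows[OF bij, of PY "{..r i}" "\<psi> i"] by (simp only: lessThan_Suc_atMost)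
  finally show ?thesis .
qed

lemma signed_minors_invert:
  assumes i: "i < m" and I: "I \<subseteq> {..<k i}" "card I = r i"
    and rank: "rank_S s \<bb> (submatrix (jacobian_dual r k h i) I UNIV) = r i"
  shows "inverts i (signed_minor (jacobian_dual r k h i) I)"
proof -
  have "finite I" using I(1) finite_subset by blast
  then have row: "pick I a < k i" if "a < r i" for a
    using bij_betw_pick[of I] that I by (auto simp: bij_betw_def)
  have "signed_minor (jacobian_dual r k h i) I j = maximal_minor (r i) (\<lambda>a. \<psi> i (pick I a)) j"
    if j: "j \<le> r i" for j
  proof -
    have "signed_minor (jacobian_dual r k h i) I j =
        maximal_minor (r i) (\<lambda>a b. jacobian_dual r k h i $$ (pick I a, b)) j"
      using I j by (rule signed_minor_eq_maximal_minor[OF dim_jacobian_dual])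
    also have "\<dots> = maximal_minor (r i) (\<lambda>a. \<psi> i (pick I a)) j"
      unfolding maximal_minor_def
      by (intro arg_cong2[where f = "(*)"] refl arg_cong[where f = det] cong_mat)
        (use row in \<open>auto simp: index_jacobian_dual\<close>)
    finally show ?thesis .
  qed
  moreover have "inverts i (maximal_minor (r i) (\<lambda>a. \<psi> i (pick I a)))"
    using maximal_minors_invert[OF i I] rank rank_submatrix_eq_iff[OF i I] by blast
  ultimately show ?thesis using inverts_cong by blast
qed

lemma full_rank_imp_submatrix:
  assumes "i < m" "rank_S s \<bb> (jacobian_dual r k h i) = r i"
  shows "\<exists>I \<subseteq> {..<k i}. card I = r i \<and> rank_S s \<bb> (submatrix (jacobian_dual r k h i) I UNIV) = r i"
  using rank_jacobian_dual_attained[OF assms(1)] assms rank_submatrix_eq_iff by metis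

lemma birational_iff_rank:
  "birational m r s \<aa> \<bb> f \<longleftrightarrow> (\<forall>i<m. rank_S s \<bb> (jacobian_dual r k h i) = r i)"
proof
  assume "birational m r s \<aa> \<bb> f"
  then obtain g where "inverse_map m r s \<aa> \<bb> f g" by (auto simp: birational_def)
  then show "\<forall>i<m. rank_S s \<bb> (jacobian_dual r k h i) = r i"
    using inverse_map_imp_inverts inverts_imp_rank by blast
next
  assume "\<forall>i<m. rank_S s \<bb> (jacobian_dual r k h i) = r i"
  then have "\<forall>i. \<exists>D. i < m \<longrightarrow> inverts i D"
    using full_rank_imp_submatrix signed_minors_invert by meson
  then obtain D where "\<And>i. i < m \<Longrightarrow> inverts i (D i)" by metis
  then show "birational m r s \<aa> \<bb> f"
    using inverts_imp_inverse_map dominant unfolding birational_def by blast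
qed

lemma rank_full_iff:
  "(\<forall>i<m. rank_S s \<bb> (jacobian_dual r k h i) = r i) \<longleftrightarrow>
    rank_S s \<bb> (full_jacobian_dual m r k h) = (\<Sum>i<m. r i)"
proof
  assume "rank_S s \<bb> (full_jacobian_dual m r k h) = (\<Sum>i<m. r i)"
  then have eq: "(\<Sum>i<m. rank_S s \<bb> (jacobian_dual r k h i)) = (\<Sum>i<m. r i)"
    by (simp add: rank_full_jacobian_dual)
  show "\<forall>i<m. rank_S s \<bb> (jacobian_dual r k h i) = r i"
  proof (rule ccontr)
    assume "\<not> ?thesis"
    then obtain i where "i < m" "rank_S s \<bb> (jacobian_dual r k h i) < r i"
      using rank_jacobian_dual_le by (metis le_neq_implies_less)
    then have "(\<Sum>i<m. rank_S s \<bb> (jacobian_dual r k h i)) < (\<Sum>i<m. r i)"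
      using rank_jacobian_dual_le by (intro sum_strict_mono_ex1) auto
    then show False using eq by simp
  qed
qed (simp add: rank_full_jacobian_dual)

end

theorem theorem4p4:
  fixes m s :: nat
    and r k :: "nat \<Rightarrow> nat"
    and \<aa> :: "nat \<Rightarrow> 'k::field mpoly set"
    and \<bb> :: "'k mpoly set"
    and f :: "nat \<Rightarrow> 'k mpoly"
    and h :: "nat \<Rightarrow> nat \<Rightarrow> 'k mpoly"
  assumes "m \<ge> 1"
    and "\<And>i. i < m \<Longrightarrow> integral_projective_variety (xvars_of r i) (\<aa> i)"
    and "integral_scheme m r (prod_ideal m r \<aa>)"
    and "integral_projective_variety (yvars s) \<bb>"
    and "rational_map m r s \<aa> \<bb> f"
    and "dominant m r s \<aa> \<bb> f"
    and "\<And>i. i < m \<Longrightarrow> minimal_generators s (linear_part m r s \<aa> f i) (k i) (h i)"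
  shows
    "(birational m r s \<aa> \<bb> f \<longleftrightarrow> (\<forall>i<m. rank_S s \<bb> (jacobian_dual r k h i) = r i)) \<and>
     ((\<forall>i<m. rank_S s \<bb> (jacobian_dual r k h i) = r i) \<longleftrightarrow>
        rank_S s \<bb> (full_jacobian_dual m r k h) = (\<Sum>i<m. r i)) \<and>
     (birational m r s \<aa> \<bb> f \<longrightarrow>
        (\<forall>i<m. \<exists>I \<subseteq> {..<k i}. card I = r i \<and>
           rank_S s \<bb> (submatrix (jacobian_dual r k h i) I UNIV) = r i) \<and>
        (\<forall>I. (\<forall>i<m. I i \<subseteq> {..<k i} \<and> card (I i) = r i \<and>
                rank_S s \<bb> (submatrix (jacobian_dual r k h i) (I i) UNIV) = r i) \<longrightarrow>
           inverse_map m r s \<aa> \<bb> f (\<lambda>i. signed_minor (jacobian_dual r k h i) (I i)) \<and>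
           (\<forall>g. inverse_map m r s \<aa> \<bb> f g \<longrightarrow>
              (\<forall>i<m. same_rational_map \<bb> (r i) (g i)
                 (signed_minor (jacobian_dual r k h i) (I i))))))"
proof -
  interpret jacobian_dual_matrices m s r \<aa> \<bb> f k h
    using assms(2-7)
    by (intro jacobian_dual_matrices.intro dominant_rational_map.intro jacobian_dual_matrices_axioms.intro)
  show ?thesis
  proof (intro conjI impI allI)
    assume "birational m r s \<aa> \<bb> f"
    then show "\<exists>I \<subseteq> {..<k i}. card I = r i \<and>
        rank_S s \<bb> (submatrix (jacobian_dual r k h i) I UNIV) = r i" if "i < m" for i
      using birational_iff_rank full_rank_imp_submatrix that by blast
  next
    fix I
    assume "\<forall>i<m. I i \<subseteq> {..<k i} \<and> card (I i) = r i \<and>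
        rank_S s \<bb> (submatrix (jacobian_dual r k h i) (I i) UNIV) = r i"
    then have minors: "inverts i (signed_minor (jacobian_dual r k h i) (I i))" if "i < m" for i
      using signed_minors_invert that by blast
    then show "inverse_map m r s \<aa> \<bb> f (\<lambda>i. signed_minor (jacobian_dual r k h i) (I i))"
      by (rule inverts_imp_inverse_map)
    show "same_rational_map \<bb> (r i) (g i) (signed_minor (jacobian_dual r k h i) (I i))"
      if "inverse_map m r s \<aa> \<bb> f g" "i < m" for g i
      using inverts_unique[OF inverse_map_imp_inverts minors] that by blast
  qed (rule birational_iff_rank rank_full_iff)+
qed

end
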